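(* Let $N=N_{M,P,\tau}$ be a generalized Nakamura manifold (as defined in the context) which is not a complex torus. Suppose that for every pair of multi-indices $I,J$ in $\{1,\dots,n\}$ it holds that $$\tau\cdot c_{IJ}\in 2\pi\mathbb{Z}\iff c_{IJ}=0 .$$ Then $N_{M,P,\tau}$ admits a geometrically-Bott-Chern-formal Hermitian metric.
   Context: Generalized Nakamura manifolds. Let $M\in SL(n;\mathbb{Z})$ be diagonalizable over $\mathbb{R}$ with positive eigenvalues $e^{\lambda_1},\dots,e^{\lambda_n}$ ($\lambda_i\in\mathbb{R}$; hence $\sum_i\lambda_i=0$), and let $P\in GL(n;\mathbb{R})$ be such that $PMP^{-1}=\mathrm{diag}(e^{\lambda_1},\dots,e^{\lambda_n})$. Let $\rho:\mathbb{C}\to GL(n;\mathbb{C})$, $\rho(w)=\mathrm{diag}(e^{\frac12\lambda_1(w+\bar w)},\dots,e^{\frac12\lambda_n(w+\bar w)})$, and let $\mathbb{C}\ltimes_\rho\mathbb{C}^n$ be the corresponding semidirect product, with coordinates $(w,z_1,\dots,z_n)$. For $\tau\in\mathbb{R}\setminus\{0\}$ put $\Gamma'_\tau=\mathbb{Z}\oplus\sqrt{-1}\,\tau\mathbb{Z}$, $\Gamma''_P=P\mathbb{Z}^n\oplus\sqrt{-1}P\mathbb{Z}^n$ and $\Gamma_{P,\tau}=\Gamma'_\tau\ltimes_\rho\Gamma''_P$, a discrete subgroup. Then $N_{M,P,\tau}=\Gamma_{P,\tau}\backslash(\mathbb{C}\ltimes_\rho\mathbb{C}^n)$ is a compact complex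 solvmanifold of complex dimension $n+1$. That $N_{M,P,\tau}$ is not a complex torus means that $\lambda_i\neq0$ for some $i$. Notation. Multi-indices are strictly increasing tuples $I=(i_1<\dots<i_p)$, $J=(j_1<\dots<j_q)$ of elements of $\{1,\dots,n\}$, and $c_{IJ}=\sum_{\sigma=1}^p\lambda_{i_\sigma}+\sum_{\sigma=1}^q\lambda_{j_\sigma}$. Geometrically-Bott-Chern-formal metrics. On a compact complex manifold $X$ of complex dimension $m$ with Hermitian metric $g$, let $*:\mathcal{A}^{p,q}(X)\to\mathcal{A}^{m-p,m-q}(X)$ be the $\mathbb{C}$-antilinear Hodge star operator. A $(p,q)$-form $\alpha$ is Bott--Chern harmonic if $\partial\alpha=0$, $\bar\partial\alpha=0$ and $\partial\bar\partial{*}\alpha=0$. The metric $g$ is geometrically-Bott-Chern-formal if the space of Bott--Chern harmonic forms (direct sum over all bidegrees) is closed under the wedge product. *)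

theory Defs
  imports "HOL-Analysis.Analysis" "HOL-Algebra.Coset" "HOL-Library.Option_ord"
begin

section \<open>Exterior algebra of a complex vector space\<close>

text \<open>
  A complex-valued exterior form on the real vector space underlying \<open>\<complex>\<^sup>m\<close> (\<open>m = CARD('m)\<close>) is
  encoded by its values on lists of real tangent vectors; a form of degree \<open>k\<close> vanishes on lists
  whose length is not \<open>k\<close>.
\<close>

type_synonym 'm cvec = "(complex, 'm) vec"
type_synonym 'm ext = "'m cvec list \<Rightarrow> complex"

definition ext_one :: "'m::finite ext" where
  "ext_one vs = (if vs = [] then 1 else 0)"

text \<open>Shuffle formula: \<open>S\<close> is the set of positions fed to the first factor, and the exponent counts
  the inversions of the shuffle, so that \<open>(\<alpha> \<and> \<beta>)(u,v) = \<alpha>(u) \<beta>(v) - \<alpha>(v) \<beta>(u)\<close> for one-forms.\<close>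

definition wedge :: "'m::finite ext \<Rightarrow> 'm ext \<Rightarrow> 'm ext" where
  "wedge \<alpha> \<beta> vs = (\<Sum>S\<in>Pow {..<length vs}.
      (-1) ^ card {(i, j). i < j \<and> i \<in> {..<length vs} - S \<and> j \<in> S} *
      \<alpha> (nths vs S) * \<beta> (nths vs (- S)))"

definition dz :: "'m::finite \<Rightarrow> 'm ext" where
  "dz i vs = (if length vs = 1 then hd vs $ i else 0)"

definition dzbar :: "'m::finite \<Rightarrow> 'm ext" where
  "dzbar i vs = (if length vs = 1 then cnj (hd vs $ i) else 0)"

text \<open>\<open>dz\<^sub>I \<and> dz\<^sub>J\<close>-bar for strictly increasing multi-indices, which are encoded as finite sets.\<close>

definition dz_dzbar :: "'m::{finite,linorder} set \<Rightarrow> 'm set \<Rightarrow> 'm ext" where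
  "dz_dzbar I J =
     foldr wedge (map dz (sorted_list_of_set I) @ map dzbar (sorted_list_of_set J)) ext_one"

definition ext_pq :: "nat \<Rightarrow> nat \<Rightarrow> 'm::{finite,linorder} ext set" where
  "ext_pq p q = {\<omega>. \<exists>f. \<omega> =
     (\<lambda>vs. \<Sum>I\<in>{I. card I = p}. \<Sum>J\<in>{J. card J = q}. f I J * dz_dzbar I J vs)}"


section \<open>Hermitian linear algebra and the Hodge star\<close>

text \<open>Hermitian inner products are linear in the first argument and antilinear in the second; the
  underlying Riemannian inner product is \<open>Re h\<close> and the fundamental form is \<open>- Im h\<close>, that is
  \<open>(u, v) \<mapsto> Re h(\<i>u, v)\<close>.\<close>

definition hermitian_inner :: "('m::finite cvec \<Rightarrow> 'm cvec \<Rightarrow> complex) \<Rightarrow> bool" where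
  "hermitian_inner h \<longleftrightarrow>
     (\<forall>u u' v. h (u + u') v = h u v + h u' v) \<and>
     (\<forall>c u v. h (c *s u) v = c * h u v) \<and>
     (\<forall>u v. h v u = cnj (h u v)) \<and>
     (\<forall>u. u \<noteq> 0 \<longrightarrow> Re (h u u) > 0)"

definition orthonormal_basis ::
    "('m::finite cvec \<Rightarrow> 'm cvec \<Rightarrow> complex) \<Rightarrow> 'm cvec set \<Rightarrow> bool" where
  "orthonormal_basis h B \<longleftrightarrow>
     span B = UNIV \<and> (\<forall>u\<in>B. \<forall>v\<in>B. Re (h u v) = (if u = v then 1 else 0))"

text \<open>The Hermitian inner product on forms of degree \<open>k\<close> for which the increasing wedge products of
  an orthonormal coframe are orthonormal. Each of them is counted \<open>k!\<close> times by the sum over all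
  \<open>k\<close>-tuples of frame vectors. The value does not depend on the chosen orthonormal frame.\<close>

definition ext_inner ::
    "('m::finite cvec \<Rightarrow> 'm cvec \<Rightarrow> complex) \<Rightarrow> nat \<Rightarrow> 'm ext \<Rightarrow> 'm ext \<Rightarrow> complex" where
  "ext_inner h k \<alpha> \<beta> =
     (let B = (SOME B. orthonormal_basis h B)
      in (\<Sum>vs\<in>{vs. set vs \<subseteq> B \<and> length vs = k}. \<alpha> vs * cnj (\<beta> vs)) / fact k)"

definition fundamental_form :: "('m::finite cvec \<Rightarrow> 'm cvec \<Rightarrow> complex) \<Rightarrow> 'm ext" where
  "fundamental_form h vs =
     (if length vs = 2 then - complex_of_real (Im (h (vs ! 0) (vs ! 1))) else 0)"

definition volume_form :: "('m::finite cvec \<Rightarrow> 'm cvec \<Rightarrow> complex) \<Rightarrow> 'm ext" where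
  "volume_form h vs = (wedge (fundamental_form h) ^^ CARD('m)) ext_one vs / fact CARD('m)"

text \<open>The \<open>\<complex>\<close>-antilinear Hodge star on forms of type \<open>(p, q)\<close>.\<close>

definition hodge_star ::
    "('m cvec \<Rightarrow> 'm cvec \<Rightarrow> complex) \<Rightarrow> nat \<Rightarrow> nat \<Rightarrow> 'm::{finite,linorder} ext \<Rightarrow> 'm ext" where
  "hodge_star h p q \<beta> =
     (THE \<gamma>. \<gamma> \<in> ext_pq (CARD('m) - p) (CARD('m) - q) \<and>
       (\<forall>\<alpha>\<in>ext_pq p q. wedge \<alpha> \<gamma> = (\<lambda>vs. ext_inner h (p + q) \<alpha> \<beta> * volume_form h vs)))"


section \<open>Differential calculus on open subsets of complex space\<close>

primrec Ck_on :: "nat \<Rightarrow> 'a::real_normed_vector set \<Rightarrow> ('a \<Rightarrow> complex) \<Rightarrow> bool" where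
  "Ck_on 0 V f \<longleftrightarrow> continuous_on V f"
| "Ck_on (Suc k) V f \<longleftrightarrow>
     (\<forall>x\<in>V. f differentiable (at x)) \<and> (\<forall>v. Ck_on k V (\<lambda>x. frechet_derivative f (at x) v))"

definition smooth_fun_on :: "'a::real_normed_vector set \<Rightarrow> ('a \<Rightarrow> complex) \<Rightarrow> bool" where
  "smooth_fun_on V f \<longleftrightarrow> (\<forall>k. Ck_on k V f)"

definition holomorphic_map_on ::
    "('m::finite cvec \<Rightarrow> 'm cvec) \<Rightarrow> 'm cvec set \<Rightarrow> bool" where
  "holomorphic_map_on f V \<longleftrightarrow>
     (\<forall>x\<in>V. \<exists>D. (f has_derivative D) (at x) \<and> (\<forall>c v. D (c *s v) = c *s D v))"

definition smooth_pq_form_on ::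
    "nat \<Rightarrow> nat \<Rightarrow> 'm cvec set \<Rightarrow> ('m cvec \<Rightarrow> 'm::{finite,linorder} ext) \<Rightarrow> bool" where
  "smooth_pq_form_on p q V \<omega> \<longleftrightarrow>
     (\<exists>f. (\<forall>I J. smooth_fun_on V (f I J)) \<and>
       (\<forall>x\<in>V. \<omega> x =
         (\<lambda>vs. \<Sum>I\<in>{I. card I = p}. \<Sum>J\<in>{J. card J = q}. f I J x * dz_dzbar I J vs)))"

text \<open>The \<open>(1,0)\<close>- and \<open>(0,1)\<close>-parts of the derivative of \<open>f\<close> at \<open>x\<close>, evaluated at the real tangent
  vector \<open>v\<close>: \<open>\<Sum>\<^sub>i \<partial>f/\<partial>z\<^sub>i v\<^sub>i\<close> and \<open>\<Sum>\<^sub>i \<partial>f/\<partial>zbar\<^sub>i cnj v\<^sub>i\<close>.\<close>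

definition wirtinger :: "('m::finite cvec \<Rightarrow> complex) \<Rightarrow> 'm cvec \<Rightarrow> 'm cvec \<Rightarrow> complex" where
  "wirtinger f x v =
     (frechet_derivative f (at x) v - \<i> * frechet_derivative f (at x) (\<i> *s v)) / 2"

definition wirtinger_bar :: "('m::finite cvec \<Rightarrow> complex) \<Rightarrow> 'm cvec \<Rightarrow> 'm cvec \<Rightarrow> complex" where
  "wirtinger_bar f x v =
     (frechet_derivative f (at x) v + \<i> * frechet_derivative f (at x) (\<i> *s v)) / 2"

text \<open>\<open>\<partial>\<close> and \<open>\<partial>\<close>-bar in a holomorphic chart. Evaluated on constant vector fields, they send
  \<open>f dz\<^sub>I \<and> dzbar\<^sub>J\<close> to \<open>\<partial>f \<and> dz\<^sub>I \<and> dzbar\<^sub>J\<close>, respectively to the same expression with \<open>\<partial>\<close>-bar.\<close>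

definition del :: "('m::finite cvec \<Rightarrow> 'm ext) \<Rightarrow> 'm cvec \<Rightarrow> 'm ext" where
  "del \<omega> x vs = (\<Sum>i<length vs.
     (-1) ^ i * wirtinger (\<lambda>y. \<omega> y (take i vs @ drop (Suc i) vs)) x (vs ! i))"

definition delbar :: "('m::finite cvec \<Rightarrow> 'm ext) \<Rightarrow> 'm cvec \<Rightarrow> 'm ext" where
  "delbar \<omega> x vs = (\<Sum>i<length vs.
     (-1) ^ i * wirtinger_bar (\<lambda>y. \<omega> y (take i vs @ drop (Suc i) vs)) x (vs ! i))"


section \<open>Complex manifolds, forms and Hermitian metrics\<close>

text \<open>A chart is a pair of its domain and its coordinate map; the values of the coordinate map
  outside the domain are irrelevant. A tensor on a manifold is a family of local expressions, one
  on the coordinate image of every chart of a fixed holomorphic atlas, that transform into each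
  other under the chart transitions. Values off the coordinate images are junk, so identities
  between tensors are only ever stated on the coordinate images.\<close>

type_synonym ('a, 'm) chart = "'a set \<times> ('a \<Rightarrow> 'm cvec)"
type_synonym ('a, 'm) mform = "('a, 'm) chart \<Rightarrow> 'm cvec \<Rightarrow> 'm ext"
type_synonym ('a, 'm) mmetric =
  "('a, 'm) chart \<Rightarrow> 'm cvec \<Rightarrow> 'm cvec \<Rightarrow> 'm cvec \<Rightarrow> complex"

definition chart_image :: "('a, 'm::finite) chart \<Rightarrow> 'm cvec set" where
  "chart_image c = snd c ` fst c"

definition transition ::
    "('a, 'm::finite) chart \<Rightarrow> ('a, 'm) chart \<Rightarrow> 'm cvec \<Rightarrow> 'm cvec" where
  "transition c c' x = snd c' (inv_into (fst c) (snd c) x)"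

definition holomorphic_atlas :: "'a set \<Rightarrow> ('a, 'm::finite) chart set \<Rightarrow> bool" where
  "holomorphic_atlas X A \<longleftrightarrow>
     (\<Union>c\<in>A. fst c) = X \<and>
     (\<forall>c\<in>A. inj_on (snd c) (fst c) \<and> open (chart_image c)) \<and>
     (\<forall>c\<in>A. \<forall>c'\<in>A. open (snd c ` (fst c \<inter> fst c')) \<and>
        holomorphic_map_on (transition c c') (snd c ` (fst c \<inter> fst c')))"

definition pq_forms ::
    "('a, 'm) chart set \<Rightarrow> nat \<Rightarrow> nat \<Rightarrow> ('a, 'm::{finite,linorder}) mform set" where
  "pq_forms A p q = {\<omega>.
     (\<forall>c\<in>A. smooth_pq_form_on p q (chart_image c) (\<omega> c)) \<and>
     (\<forall>c\<in>A. \<forall>c'\<in>A. \<forall>x \<in> snd c ` (fst c \<inter> fst c'). \<forall>vs.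
        \<omega> c x vs =
        \<omega> c' (transition c c' x) (map (frechet_derivative (transition c c') (at x)) vs))}"

definition hermitian_metric :: "('a, 'm::finite) chart set \<Rightarrow> ('a, 'm) mmetric \<Rightarrow> bool" where
  "hermitian_metric A h \<longleftrightarrow>
     (\<forall>c\<in>A. \<forall>x\<in>chart_image c. hermitian_inner (h c x)) \<and>
     (\<forall>c\<in>A. \<forall>u v. smooth_fun_on (chart_image c) (\<lambda>x. h c x u v)) \<and>
     (\<forall>c\<in>A. \<forall>c'\<in>A. \<forall>x \<in> snd c ` (fst c \<inter> fst c'). \<forall>u v.
        h c x u v =
        h c' (transition c c' x) (frechet_derivative (transition c c') (at x) u)
                                 (frechet_derivative (transition c c') (at x) v))"

definition bc_harmonic_pq ::
    "('a, 'm) chart set \<Rightarrow> ('a, 'm) mmetric \<Rightarrow> nat \<Rightarrow> nat \<Rightarrow>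
     ('a, 'm::{finite,linorder}) mform set" where
  "bc_harmonic_pq A h p q = {\<alpha> \<in> pq_forms A p q.
     \<forall>c\<in>A. \<forall>x\<in>chart_image c. \<forall>vs.
       del (\<alpha> c) x vs = 0 \<and> delbar (\<alpha> c) x vs = 0 \<and>
       del (delbar (\<lambda>y. hodge_star (h c y) p q (\<alpha> c y))) x vs = 0}"

definition bc_harmonic ::
    "('a, 'm) chart set \<Rightarrow> ('a, 'm) mmetric \<Rightarrow> ('a, 'm::{finite,linorder}) mform set" where
  "bc_harmonic A h = {\<alpha>. \<exists>a.
     (\<forall>p\<le>CARD('m). \<forall>q\<le>CARD('m). a p q \<in> bc_harmonic_pq A h p q) \<and>
     (\<forall>c\<in>A. \<forall>x\<in>chart_image c. \<forall>vs.
        \<alpha> c x vs = (\<Sum>p\<le>CARD('m). \<Sum>q\<le>CARD('m). a p q c x vs))}"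

definition geometrically_BC_formal ::
    "('a, 'm::{finite,linorder}) chart set \<Rightarrow> ('a, 'm) mmetric \<Rightarrow> bool" where
  "geometrically_BC_formal A h \<longleftrightarrow>
     (\<forall>\<alpha>\<in>bc_harmonic A h. \<forall>\<beta>\<in>bc_harmonic A h.
        (\<lambda>c x. wedge (\<alpha> c x) (\<beta> c x)) \<in> bc_harmonic A h)"


section \<open>Generalized Nakamura manifolds\<close>

text \<open>Points of \<open>\<complex> \<times> \<complex>\<^sup>n\<close> are vectors indexed by \<open>'n option\<close>: the entry at \<open>None\<close> is the coordinate
  \<open>w\<close>, the entry at \<open>Some i\<close> is \<open>z\<^sub>i\<close>.\<close>

definition w_coord :: "complex^('n::finite option) \<Rightarrow> complex" where
  "w_coord x = x $ None"

definition z_coords :: "complex^('n option) \<Rightarrow> complex^'n" where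
  "z_coords x = (\<chi> i. x $ Some i)"

definition wz_vec :: "complex \<Rightarrow> complex^'n \<Rightarrow> complex^('n option)" where
  "wz_vec w z = (\<chi> k. case k of None \<Rightarrow> w | Some i \<Rightarrow> z $ i)"

definition rho :: "('n \<Rightarrow> real) \<Rightarrow> complex \<Rightarrow> complex^'n^'n" where
  "rho lam w = (\<chi> i j. if i = j then exp (complex_of_real (lam i) / 2 * (w + cnj w)) else 0)"

definition nakamura_group :: "('n::finite \<Rightarrow> real) \<Rightarrow> (complex^('n option)) monoid" where
  "nakamura_group lam =
     \<lparr>carrier = UNIV,
      mult = (\<lambda>x y. wz_vec (w_coord x + w_coord y)
                           (z_coords x + rho lam (w_coord x) *v z_coords y)),
      one = 0\<rparr>"

definition lattice_base :: "real \<Rightarrow> complex set" where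
  "lattice_base \<tau> = {of_int a + \<i> * of_real \<tau> * of_int b | a b. True}"

definition lattice_fibre :: "real^'n^'n \<Rightarrow> (complex^'n) set" where
  "lattice_fibre P =
     {(\<chi> i. complex_of_real ((P *v (\<chi> j. of_int (a $ j))) $ i) +
            \<i> * complex_of_real ((P *v (\<chi> j. of_int (b $ j))) $ i)) | a b :: int^'n. True}"

definition nakamura_lattice :: "real^'n^'n \<Rightarrow> real \<Rightarrow> (complex^('n option)) set" where
  "nakamura_lattice P \<tau> = {x. w_coord x \<in> lattice_base \<tau> \<and> z_coords x \<in> lattice_fibre P}"

text \<open>The orbits of left multiplication by the lattice are the right cosets.\<close>

definition nakamura_manifold ::
    "('n::finite \<Rightarrow> real) \<Rightarrow> real^'n^'n \<Rightarrow> real \<Rightarrow> (complex^('n option)) set set" where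
  "nakamura_manifold lam P \<tau> = rcosets\<^bsub>nakamura_group lam\<^esub> (nakamura_lattice P \<tau>)"

definition nakamura_proj ::
    "('n::finite \<Rightarrow> real) \<Rightarrow> real^'n^'n \<Rightarrow> real \<Rightarrow> complex^('n option) \<Rightarrow> (complex^('n option)) set" where
  "nakamura_proj lam P \<tau> x = nakamura_lattice P \<tau> #>\<^bsub>nakamura_group lam\<^esub> x"

text \<open>The quotient complex structure: the charts are the local inverses of the projection.\<close>

definition nakamura_atlas ::
    "('n::finite \<Rightarrow> real) \<Rightarrow> real^'n^'n \<Rightarrow> real \<Rightarrow> ((complex^('n option)) set, 'n option) chart set" where
  "nakamura_atlas lam P \<tau> =
     {(nakamura_proj lam P \<tau> ` V, inv_into V (nakamura_proj lam P \<tau>)) | V.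
        open V \<and> inj_on (nakamura_proj lam P \<tau>) V}"

definition c_IJ :: "('n \<Rightarrow> real) \<Rightarrow> 'n set \<Rightarrow> 'n set \<Rightarrow> real" where
  "c_IJ lam I J = (\<Sum>i\<in>I. lam i) + (\<Sum>j\<in>J. lam j)"

section \<open>The quotient charts form a holomorphic atlas\<close>

text \<open>The statements about forms and metrics only refer to \<open>nakamura_atlas\<close>. The final result of this
  section shows that this really is an atlas of the quotient: its chart domains cover the whole
  quotient and all transitions are holomorphic.\<close>

lemma int_matrix_right_inverse:
  fixes M :: "int^'n^'n"
  assumes "det M = 1"
  obtains M' :: "int^'n^'n" where
    "(\<chi> i j. real_of_int (M $ i $ j)) ** (\<chi> i j. real_of_int (M' $ i $ j)) = mat 1"
proof -
  have det_int: "det (\<chi> i j. real_of_int (A $ i $ j)) = real_of_int (det A)" for A :: "int^'n^'n"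
    by (simp add: det_def)
  let ?R = "\<chi> i j. real_of_int (M $ i $ j)"
  have R: "det ?R = 1" using assms by (simp add: det_int)
  define C where "C = (\<lambda>k l. (\<chi> i j. if j = l then (if i = k then 1 else 0) else M $ i $ j) :: int^'n^'n)"
  define M' where "M' = (\<chi> l k. det (C k l) :: int^'n^'n)"
  have col: "?R *v (\<chi> l. real_of_int (M' $ l $ k)) = axis k 1" for k
  proof -
    have "(\<chi> l. real_of_int (M' $ l $ k)) =
        (\<chi> l. det (\<chi> i j. if j = l then axis k 1 $ i else ?R $ i $ j) / det ?R)"
    proof -
      have "(\<chi> i j. if j = l then axis k 1 $ i else ?R $ i $ j) =
          (\<chi> i j. real_of_int (C k l $ i $ j))" for l
        by (simp add: vec_eq_iff C_def axis_def)
      thus ?thesis by (simp add: R M'_def det_int del: vec_lambda_beta) (simp add: vec_eq_iff det_int)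
    qed
    thus ?thesis using cramer[of ?R] R by simp
  qed
  have "?R ** (\<chi> i j. real_of_int (M' $ i $ j)) = mat 1"
  proof -
    have "(?R ** (\<chi> i j. real_of_int (M' $ i $ j))) $ i $ k = mat 1 $ i $ k" for i k
      using arg_cong[OF col[of k], of "\<lambda>v. v $ i"]
      by (simp add: matrix_vector_mult_def matrix_matrix_mult_def mat_def axis_def eq_commute)
    thus ?thesis by (simp add: vec_eq_iff)
  qed
  thus ?thesis by (rule that)
qed

definition diag_flow :: "('n::finite \<Rightarrow> real) \<Rightarrow> real \<Rightarrow> real^'n^'n" where
  "diag_flow lam t = (\<chi> i j. if i = j then exp (t * lam i) else 0)"

lemma diag_flow_nth: "(diag_flow lam t *v x) $ i = exp (t * lam i) * x $ i"
  by (simp add: diag_flow_def matrix_vector_mult_def if_distrib [of "\<lambda>z. z * _"] cong: if_cong)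

lemma diag_flow_add: "diag_flow lam (s + t) *v x = diag_flow lam s *v (diag_flow lam t *v x)"
  by (simp add: vec_eq_iff diag_flow_nth distrib_right exp_add)

definition real_lattice :: "real^'n^'n \<Rightarrow> (real^'n) set" where
  "real_lattice P = range (\<lambda>a::int^'n. P *v (\<chi> j. of_int (a $ j)))"

lemma real_lattice_diff:
  fixes P :: "real^'n^'n"
  assumes "x \<in> real_lattice P" "y \<in> real_lattice P" shows "x - y \<in> real_lattice P"
proof -
  obtain a b :: "int^'n" where ab: "x = P *v (\<chi> j. of_int (a $ j))" "y = P *v (\<chi> j. of_int (b $ j))"
    using assms by (auto simp: real_lattice_def)
  have "(\<chi> j. of_int ((a - b) $ j)) = (\<chi> j. of_int (a $ j)) - ((\<chi> j. of_int (b $ j)) :: real^'n)"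
    by (simp add: vec_eq_iff)
  hence "x - y = P *v (\<chi> j. of_int ((a - b) $ j))"
    by (simp only: ab matrix_vector_mult_diff_distrib)
  thus ?thesis unfolding real_lattice_def by blast
qed

lemma real_lattice_0: fixes P :: "real^'n^'n" shows "0 \<in> real_lattice P"
proof -
  have "(\<chi> j. of_int ((0::int^'n) $ j)) = (0::real^'n)" by (simp add: vec_eq_iff)
  hence "P *v (\<chi> j. of_int ((0::int^'n) $ j)) = 0" by simp
  thus ?thesis unfolding real_lattice_def by (rule range_eqI[OF sym])
qed

lemma int_mat_vec: "(\<chi> i j. real_of_int (M $ i $ j)) *v (\<chi> j. of_int (a $ j)) =
  (\<chi> j. of_int ((M *v a) $ j))"
  by (simp add: vec_eq_iff matrix_vector_mult_def)

lemma diag_flow_real_lattice: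
  fixes M :: "int^'n^'n" and P :: "real^'n^'n"
  assumes M: "det M = 1" and P: "invertible P"
    and D: "P ** (\<chi> i j. real_of_int (M $ i $ j)) ** matrix_inv P =
           (\<chi> i j. if i = j then exp (lam i) else 0)"
    and x: "x \<in> real_lattice P"
  shows "diag_flow lam (of_int k) *v x \<in> real_lattice P"
proof -
  let ?R = "\<chi> i j. real_of_int (M $ i $ j)"
  have PP: "matrix_inv P ** P = mat 1" using P unfolding invertible_def matrix_inv_def by (rule someI2_ex) blast
  have e1: "diag_flow lam 1 = P ** ?R ** matrix_inv P" unfolding D by (simp add: vec_eq_iff diag_flow_def)
  have e1P: "diag_flow lam 1 *v (P *v y) = P *v (?R *v y)" for y
  proof -
    have "diag_flow lam 1 ** P = P ** ?R" unfolding e1 matrix_mul_assoc[symmetric] PP by simp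
    thus ?thesis by (simp only: matrix_vector_mul_assoc)
  qed
  have pos: "diag_flow lam 1 *v x \<in> real_lattice P" if "x \<in> real_lattice P" for x
    using that by (auto simp: real_lattice_def e1P int_mat_vec)
  obtain M' :: "int^'n^'n" where M': "?R ** (\<chi> i j. real_of_int (M' $ i $ j)) = mat 1"
    using int_matrix_right_inverse[OF M] .
  have neg: "diag_flow lam (-1) *v x \<in> real_lattice P" if "x \<in> real_lattice P" for x
  proof -
    from that obtain a :: "int^'n" where a: "x = P *v (\<chi> j. of_int (a $ j))" by (auto simp: real_lattice_def)
    have "x = diag_flow lam 1 *v (P *v ((\<chi> i j. real_of_int (M' $ i $ j)) *v (\<chi> j. of_int (a $ j))))"
      unfolding e1P by (simp add: matrix_vector_mul_assoc M' a)
    also have "\<dots> = diag_flow lam 1 *v (P *v (\<chi> j. of_int ((M' *v a) $ j)))" by (simp only: int_mat_vec)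
    finally have "diag_flow lam (-1) *v x = diag_flow lam (-1 + 1) *v (P *v (\<chi> j. of_int ((M' *v a) $ j)))"
      by (simp only: diag_flow_add)
    also have "\<dots> = P *v (\<chi> j. of_int ((M' *v a) $ j))" by (simp add: vec_eq_iff diag_flow_nth)
    finally show ?thesis unfolding real_lattice_def by blast
  qed
  show ?thesis
  proof (induction k rule: int_induct[where k = 0])
    case base
    have "diag_flow lam 0 *v x = x" by (simp add: vec_eq_iff diag_flow_nth)
    then show ?case using x by simp
  next
    case (step1 i)
    have "diag_flow lam (of_int (i + 1)) *v x = diag_flow lam 1 *v (diag_flow lam (of_int i) *v x)"
      by (simp flip: diag_flow_add add: add.commute)
    then show ?case using pos step1 by simp
  next
    case (step2 i)
    have "diag_flow lam (of_int (i - 1)) *v x = diag_flow lam (-1) *v (diag_flow lam (of_int i) *v x)"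
      by (simp flip: diag_flow_add)
    then show ?case using neg step2 by simp
  qed
qed


lemma wz_simps [simp]: "w_coord (wz_vec w z) = w" "z_coords (wz_vec w z) = z"
  "wz_vec w z $ None = w" "wz_vec w z $ Some i = z $ i"
  by (simp_all add: w_coord_def z_coords_def wz_vec_def vec_eq_iff)

lemma wz_eq_iff: "x = y \<longleftrightarrow> w_coord x = w_coord y \<and> z_coords x = z_coords y"
  by (simp add: w_coord_def z_coords_def vec_eq_iff split_option_all)

lemma wz_linear: "w_coord (x + y) = w_coord x + w_coord y" "w_coord (x - y) = w_coord x - w_coord y"
  "z_coords (x + y) = z_coords x + z_coords y" "z_coords (x - y) = z_coords x - z_coords y"
  "w_coord (c *s x) = c * w_coord x" "z_coords (c *s x) = c *s z_coords x"
  "w_coord (r *\<^sub>R x) = r *\<^sub>R w_coord x" "z_coords (r *\<^sub>R x) = r *\<^sub>R z_coords x"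
  "w_coord 0 = 0" "z_coords 0 = 0"
  by (simp_all add: w_coord_def z_coords_def vec_eq_iff)

lemma rho_nth: "(rho lam w *v z) $ i = of_real (exp (Re w * lam i)) * z $ i"
proof -
  have "complex_of_real (lam i) / 2 * (w + cnj w) = of_real (Re w * lam i)"
    by (simp add: complex_add_cnj)
  hence "rho lam w $ i $ j = (if i = j then of_real (exp (Re w * lam i)) else 0)" for j
    by (simp only: rho_def vec_lambda_beta exp_of_real)
  hence "(rho lam w *v z) $ i = (\<Sum>j\<in>UNIV. if i = j then of_real (exp (Re w * lam i)) * z $ j else 0)"
    unfolding matrix_vector_mult_def by (simp add: if_distrib [of "\<lambda>u. u * _"] del: sum.delta sum.delta' cong: if_cong)
  thus ?thesis by simp
qed

lemma rho_add: "rho lam (v + w) *v z = rho lam v *v (rho lam w *v z)"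
  by (simp add: vec_eq_iff rho_nth distrib_right exp_add)

lemma rho_0: "rho lam 0 *v z = z"
  by (simp add: vec_eq_iff rho_nth)

definition re_vec :: "complex^'n \<Rightarrow> real^'n" where "re_vec z = (\<chi> i. Re (z $ i))"
definition im_vec :: "complex^'n \<Rightarrow> real^'n" where "im_vec z = (\<chi> i. Im (z $ i))"

lemma lattice_fibre_iff: "z \<in> lattice_fibre P \<longleftrightarrow> re_vec z \<in> real_lattice P \<and> im_vec z \<in> real_lattice P"
proof -
  have "z \<in> lattice_fibre P \<longleftrightarrow> (\<exists>a b::int^'a. re_vec z = P *v (\<chi> j. of_int (a $ j)) \<and>
      im_vec z = P *v (\<chi> j. of_int (b $ j)))"
    unfolding lattice_fibre_def re_vec_def im_vec_def by (simp add: vec_eq_iff complex_eq_iff all_conj_distrib)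
  thus ?thesis unfolding real_lattice_def by (auto simp: image_iff)
qed

lemma real_lattice_uminus: "x \<in> real_lattice P \<Longrightarrow> - x \<in> real_lattice P"
  using real_lattice_diff[OF real_lattice_0] by fastforce

lemma real_lattice_add: "x \<in> real_lattice P \<Longrightarrow> y \<in> real_lattice P \<Longrightarrow> x + y \<in> real_lattice P"
  using real_lattice_diff[of x P "- y"] real_lattice_uminus by fastforce

lemma re_im_rho:
  "re_vec (rho lam w *v z) = diag_flow lam (Re w) *v re_vec z"
  "im_vec (rho lam w *v z) = diag_flow lam (Re w) *v im_vec z"
  by (simp_all add: vec_eq_iff re_vec_def im_vec_def rho_nth diag_flow_nth del: of_real_exp)

lemma re_im_linear:
  "re_vec (x + y) = re_vec x + re_vec y" "im_vec (x + y) = im_vec x + im_vec y"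
  "re_vec (- x) = - re_vec x" "im_vec (- x) = - im_vec x" 
  "re_vec 0 = 0" "im_vec 0 = 0"
  by (simp_all add: vec_eq_iff re_vec_def im_vec_def)

lemma lattice_base_iff: "w \<in> lattice_base \<tau> \<longleftrightarrow> (\<exists>a b::int. Re w = of_int a \<and> Im w = \<tau> * of_int b)"
  by (auto simp: lattice_base_def complex_eq_iff)

lemma nak_mult: "x \<otimes>\<^bsub>nakamura_group lam\<^esub> y = wz_vec (w_coord x + w_coord y)
                           (z_coords x + rho lam (w_coord x) *v z_coords y)"
  by (simp add: nakamura_group_def)

lemma nak_carrier: "carrier (nakamura_group lam) = UNIV" "\<one>\<^bsub>nakamura_group lam\<^esub> = 0"
  by (simp_all add: nakamura_group_def)

lemma nakamura_inverse:
  "wz_vec (- w_coord x) (rho lam (- w_coord x) *v (- z_coords x)) \<otimes>\<^bsub>nakamura_group lam\<^esub> x = 0"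
  by (simp add: nak_mult wz_eq_iff wz_linear vec_eq_iff rho_nth)

lemma group_nakamura: "group (nakamura_group lam)"
proof (rule groupI)
  fix x y z
  show "x \<otimes>\<^bsub>nakamura_group lam\<^esub> y \<otimes>\<^bsub>nakamura_group lam\<^esub> z =
     x \<otimes>\<^bsub>nakamura_group lam\<^esub> (y \<otimes>\<^bsub>nakamura_group lam\<^esub> z)"
    by (simp add: nak_mult wz_eq_iff add.assoc rho_add matrix_vector_right_distrib)
next
  fix x
  show "\<exists>y\<in>carrier (nakamura_group lam). y \<otimes>\<^bsub>nakamura_group lam\<^esub> x = \<one>\<^bsub>nakamura_group lam\<^esub>"
    using nakamura_inverse by (auto simp: nak_carrier)
qed (simp_all add: nak_carrier nak_mult wz_eq_iff wz_linear rho_0)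

definition flow_preserves :: "('n::finite \<Rightarrow> real) \<Rightarrow> real^'n^'n \<Rightarrow> bool" where
  "flow_preserves lam P \<longleftrightarrow> (\<forall>k. \<forall>x\<in>real_lattice P. diag_flow lam (of_int k) *v x \<in> real_lattice P)"

lemma subgroup_nakamura:
  assumes "flow_preserves lam P"
  shows "subgroup (nakamura_lattice P \<tau>) (nakamura_group lam)"
proof (rule group.subgroupI[OF group_nakamura])
  have "0 \<in> nakamura_lattice P \<tau>"
    by (auto simp: nakamura_lattice_def wz_linear lattice_fibre_iff re_im_linear real_lattice_0 lattice_base_iff
        intro!: exI[of _ 0])
  thus "nakamura_lattice P \<tau> \<noteq> {}" by blast
next
  fix x assume x: "x \<in> nakamura_lattice P \<tau>"
  have inv: "inv\<^bsub>nakamura_group lam\<^esub> x = wz_vec (- w_coord x) (rho lam (- w_coord x) *v (- z_coords x))"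
    by (rule group.inv_equality[OF group_nakamura]) (simp_all add: nak_carrier nakamura_inverse)
  obtain a b :: int where ab: "Re (w_coord x) = of_int a" "Im (w_coord x) = \<tau> * of_int b"
    using x by (auto simp: nakamura_lattice_def lattice_base_iff)
  have "- real_of_int a = of_int (- a) \<and> - (\<tau> * real_of_int b) = \<tau> * of_int (- b)" by simp
  hence "\<exists>c d :: int. - real_of_int a = of_int c \<and> - (\<tau> * real_of_int b) = \<tau> * of_int d" by blast
  moreover have "diag_flow lam (of_int (- a)) *v u \<in> real_lattice P" if "u \<in> real_lattice P" for u
    using assms that by (auto simp: flow_preserves_def simp del: of_int_minus)
  ultimately show "inv\<^bsub>nakamura_group lam\<^esub> x \<in> nakamura_lattice P \<tau>"
    using x by (simp add: inv nakamura_lattice_def lattice_fibre_iff re_im_rho re_im_linear ab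
        lattice_base_iff real_lattice_uminus)
next
  fix x y assume x: "x \<in> nakamura_lattice P \<tau>" and y: "y \<in> nakamura_lattice P \<tau>"
  obtain a b :: int where ab: "Re (w_coord x) = of_int a" "Im (w_coord x) = \<tau> * of_int b"
    using x by (auto simp: nakamura_lattice_def lattice_base_iff)
  obtain a' b' :: int where ab': "Re (w_coord y) = of_int a'" "Im (w_coord y) = \<tau> * of_int b'"
    using y by (auto simp: nakamura_lattice_def lattice_base_iff)
  have "of_int a + of_int a' = real_of_int (a + a') \<and>
     \<tau> * of_int b + \<tau> * of_int b' = \<tau> * of_int (b + b')" by (simp add: distrib_left)
  hence "\<exists>c d :: int. of_int a + of_int a' = real_of_int c \<and> \<tau> * of_int b + \<tau> * of_int b' = \<tau> * of_int d"
    by blast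
  moreover have "diag_flow lam (of_int a) *v u \<in> real_lattice P" if "u \<in> real_lattice P" for u
    using assms that by (auto simp: flow_preserves_def)
  ultimately show "x \<otimes>\<^bsub>nakamura_group lam\<^esub> y \<in> nakamura_lattice P \<tau>"
    using x y by (simp add: nak_mult nakamura_lattice_def lattice_fibre_iff re_im_rho re_im_linear ab ab'
        lattice_base_iff real_lattice_add)
qed (simp_all add: nak_carrier)

lemma proj_eq_iff:
  assumes "flow_preserves lam P"
  shows "nakamura_proj lam P \<tau> x = nakamura_proj lam P \<tau> y \<longleftrightarrow>
    (\<exists>g\<in>nakamura_lattice P \<tau>. y = g \<otimes>\<^bsub>nakamura_group lam\<^esub> x)"
proof -
  interpret group "nakamura_group lam" by (rule group_nakamura)
  note S = subgroup_nakamura[OF assms, of \<tau>]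
  have "nakamura_proj lam P \<tau> x = nakamura_proj lam P \<tau> y \<longleftrightarrow> y \<in> nakamura_proj lam P \<tau> x"
    unfolding nakamura_proj_def
    using repr_independence[OF _ _ S] rcos_self[OF _ S] by (auto simp: nak_carrier)
  thus ?thesis by (auto simp: nakamura_proj_def r_coset_def)
qed

lemma real_lattice_discrete:
  fixes P :: "real^'n^'n"
  assumes "invertible P"
  obtains d where "d > 0" "\<And>u. u \<in> real_lattice P \<Longrightarrow> norm u < d \<Longrightarrow> u = 0"
proof -
  have PP: "matrix_inv P ** P = mat 1"
    using assms unfolding invertible_def matrix_inv_def by (rule someI2_ex) blast
  obtain K where K: "K > 0" "\<And>u. norm (matrix_inv P *v u) \<le> norm u * K"
    using bounded_linear.pos_bounded[OF matrix_vector_mul_bounded_linear[of "matrix_inv P"]] by blast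
  show ?thesis
  proof (rule that)
    show "1 / K > 0" using K by simp
    fix u assume "u \<in> real_lattice P" and n: "norm u < 1 / K"
    then obtain a :: "int^'n" where a: "u = P *v (\<chi> j. of_int (a $ j))" by (auto simp: real_lattice_def)
    have e: "matrix_inv P *v u = (\<chi> j. of_int (a $ j))"
      by (simp add: a matrix_vector_mul_assoc PP)
    have "a $ j = 0" for j
    proof -
      have "\<bar>real_of_int (a $ j)\<bar> \<le> norm (matrix_inv P *v u)"
        using component_le_norm_cart[of "matrix_inv P *v u" j] by (simp add: e)
      also have "\<dots> \<le> norm u * K" by (rule K)
      also have "\<dots> < 1" using n K(1) by (simp add: field_simps)
      finally show ?thesis by linarith
    qed
    hence "(\<chi> j. of_int (a $ j)) = (0 :: real^'n)" by (simp add: vec_eq_iff)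
    thus "u = 0" by (simp add: a)
  qed
qed

lemma re_im_norm: "norm (re_vec z) \<le> norm z" "norm (im_vec z) \<le> norm z"
  by (rule norm_le_componentwise_cart, simp add: re_vec_def im_vec_def abs_Re_le_cmod abs_Im_le_cmod)+

lemma proj_locally_inj:
  fixes P :: "real^'n^'n" and lam :: "'n \<Rightarrow> real"
  assumes "flow_preserves lam P" "invertible P" "\<tau> \<noteq> 0"
  shows "\<exists>V. open V \<and> x \<in> V \<and> inj_on (nakamura_proj lam P \<tau>) V"
proof -
  obtain d where d: "d > 0" "\<And>u. u \<in> real_lattice P \<Longrightarrow> norm u < d \<Longrightarrow> u = 0"
    using real_lattice_discrete[OF assms(2)] by blast
  define r where "r = min (min 1 \<bar>\<tau>\<bar>) d / 2"
  have r: "r > 0" "2 * r \<le> 1" "2 * r \<le> \<bar>\<tau>\<bar>" "2 * r \<le> d" using d assms(3) by (auto simp: r_def)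
  define V where "V = {y. dist (w_coord y) (w_coord x) < r} \<inter> {y. dist (z_coords y) (z_coords x) < r}"
  have "open V" unfolding V_def w_coord_def z_coords_def
    by (intro open_Int open_Collect_less continuous_intros)
  moreover have "x \<in> V" using r by (simp add: V_def)
  moreover have "inj_on (nakamura_proj lam P \<tau>) V"
  proof (rule inj_onI)
    fix y y' assume y: "y \<in> V" "y' \<in> V" and "nakamura_proj lam P \<tau> y = nakamura_proj lam P \<tau> y'"
    then obtain g where g: "g \<in> nakamura_lattice P \<tau>" "y' = g \<otimes>\<^bsub>nakamura_group lam\<^esub> y"
      by (auto simp: proj_eq_iff[OF assms(1)])
    have wy: "dist (w_coord y') (w_coord y) < 2 * r" "dist (z_coords y') (z_coords y) < 2 * r"
      using y dist_triangle2[of "w_coord y'" "w_coord y" "w_coord x"]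
        dist_triangle2[of "z_coords y'" "z_coords y" "z_coords x"]
      unfolding V_def by auto
    have w0: "w_coord g = 0"
    proof -
      obtain a b :: int where ab: "Re (w_coord g) = of_int a" "Im (w_coord g) = \<tau> * of_int b"
        using g by (auto simp: nakamura_lattice_def lattice_base_iff)
      have n: "norm (w_coord g) < 2 * r" using wy(1) by (simp add: g(2) nak_mult dist_norm)
      have "\<bar>of_int a :: real\<bar> < 1" using n abs_Re_le_cmod[of "w_coord g"] r ab by simp
      moreover have "\<bar>\<tau>\<bar> * \<bar>of_int b :: real\<bar> < \<bar>\<tau>\<bar> * 1"
        using n abs_Im_le_cmod[of "w_coord g"] r ab by (simp add: abs_mult)
      ultimately have "a = 0" "b = 0" using assms(3) by (auto simp: mult_less_cancel_left_pos)
      thus ?thesis using ab by (simp add: complex_eq_iff)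
    qed
    have n: "norm (z_coords g) < d" using wy(2) r by (simp add: g(2) nak_mult dist_norm w0 rho_0)
    have "re_vec (z_coords g) = 0" "im_vec (z_coords g) = 0"
      using g n re_im_norm[of "z_coords g"] d(2) by (force simp: nakamura_lattice_def lattice_fibre_iff)+
    hence "z_coords g = 0" by (simp add: vec_eq_iff complex_eq_iff re_vec_def im_vec_def)
    thus "y = y'" by (simp add: g(2) nak_mult w0 wz_eq_iff rho_0)
  qed
  ultimately show ?thesis by blast
qed

lemma nakamura_translation_deriv:
  fixes lam :: "'n::finite \<Rightarrow> real"
  defines "D \<equiv> \<lambda>g v. wz_vec (w_coord v) (rho lam (w_coord g) *v z_coords v)"
  shows "((\<lambda>x. g \<otimes>\<^bsub>nakamura_group lam\<^esub> x) has_derivative D g) (at x)"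
    "D g (c *s v) = c *s D g v"
proof -
  have "linear (D g)"
    by (rule linearI) (simp_all add: D_def wz_eq_iff wz_linear vec_eq_iff rho_nth distrib_left)
  hence "bounded_linear (D g)" by (simp add: linear_conv_bounded_linear)
  moreover have "(\<lambda>x. g \<otimes>\<^bsub>nakamura_group lam\<^esub> x) = (\<lambda>x. g + D g x)"
    by (simp add: fun_eq_iff nak_mult D_def wz_eq_iff wz_linear)
  ultimately show "((\<lambda>x. g \<otimes>\<^bsub>nakamura_group lam\<^esub> x) has_derivative D g) (at x)"
    by (auto intro!: derivative_eq_intros bounded_linear_imp_has_derivative)
  show "D g (c *s v) = c *s D g v"
    by (simp add: D_def wz_eq_iff wz_linear vec_eq_iff rho_nth)
qed

lemma nakamura_holomorphic_atlas:
  fixes M :: "int^('n::finite)^('n::finite)" and P :: "real^'n^'n" and lam :: "'n \<Rightarrow> real"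
  assumes "det M = 1" "invertible P"
    and "P ** (\<chi> i j. real_of_int (M $ i $ j)) ** matrix_inv P =
           (\<chi> i j. if i = j then exp (lam i) else 0)"
    and "\<tau> \<noteq> 0"
  shows "holomorphic_atlas (nakamura_manifold lam P \<tau>) (nakamura_atlas lam P \<tau>)"
proof -
  let ?p = "nakamura_proj lam P \<tau>" and ?G = "nakamura_group lam"
  have pres: "flow_preserves lam P" using diag_flow_real_lattice[OF assms(1-3)] by (simp add: flow_preserves_def)
  note eq = proj_eq_iff[OF pres, of \<tau>]
  have X: "nakamura_manifold lam P \<tau> = range ?p"
    by (auto simp: nakamura_manifold_def nakamura_proj_def RCOSETS_def nak_carrier)
  have cover: "(\<Union>c\<in>nakamura_atlas lam P \<tau>. fst c) = range ?p"
  proof (intro equalityI subsetI)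
    fix q assume "q \<in> range ?p"
    then obtain x where x: "q = ?p x" by blast
    obtain V where V: "open V" "x \<in> V" "inj_on ?p V"
      using proj_locally_inj[OF pres assms(2,4)] by blast
    have "(?p ` V, inv_into V ?p) \<in> nakamura_atlas lam P \<tau>"
      using V unfolding nakamura_atlas_def by blast
    moreover have "q \<in> fst (?p ` V, inv_into V ?p)" using V(2) x by simp
    ultimately show "q \<in> (\<Union>c\<in>nakamura_atlas lam P \<tau>. fst c)" by (rule UN_I)
  qed (auto simp: nakamura_atlas_def)
  have c1: "inj_on (snd c) (fst c) \<and> open (chart_image c)" if c: "c \<in> nakamura_atlas lam P \<tau>" for c
  proof -
    from c obtain V where V: "c = (?p ` V, inv_into V ?p)" "open V" "inj_on ?p V"
      by (auto simp: nakamura_atlas_def)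
    thus ?thesis by (simp add: chart_image_def inj_on_inv_into inv_into_image_cancel)
  qed
  have c2: "open (snd c ` (fst c \<inter> fst c')) \<and>
      holomorphic_map_on (transition c c') (snd c ` (fst c \<inter> fst c'))"
    if c: "c \<in> nakamura_atlas lam P \<tau>" "c' \<in> nakamura_atlas lam P \<tau>" for c c'
  proof -
    from c obtain V W where V: "c = (?p ` V, inv_into V ?p)" "open V" "inj_on ?p V"
      and W: "c' = (?p ` W, inv_into W ?p)" "open W" "inj_on ?p W"
      by (auto simp: nakamura_atlas_def)
    have der: "((\<lambda>x. g \<otimes>\<^bsub>?G\<^esub> x) has_derivative (\<lambda>v. wz_vec (w_coord v) (rho lam (w_coord g) *v z_coords v))) (at x)"
      for g x by (rule nakamura_translation_deriv)
    define U where "U = (\<lambda>g. V \<inter> (\<lambda>x. g \<otimes>\<^bsub>?G\<^esub> x) -` W)"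
    have opU: "open (U g)" for g
    proof -
      have "continuous_on UNIV (\<lambda>x. g \<otimes>\<^bsub>?G\<^esub> x)"
        using has_derivative_continuous[OF der] by (simp add: continuous_at_imp_continuous_on)
      thus ?thesis unfolding U_def using V(2) W(2) by (intro open_Int open_vimage)
    qed
    have im: "snd c ` (fst c \<inter> fst c') = (\<Union>g\<in>nakamura_lattice P \<tau>. U g)"
    proof (intro equalityI subsetI)
      fix x assume "x \<in> snd c ` (fst c \<inter> fst c')"
      then obtain y z where y: "x = inv_into V ?p (?p y)" "y \<in> V" "z \<in> W" "?p y = ?p z"
        unfolding V(1) W(1) by auto
      hence "x = y" using V(3) by (metis inv_into_f_f)
      moreover obtain g where "g \<in> nakamura_lattice P \<tau>" "z = g \<otimes>\<^bsub>?G\<^esub> y"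
        using y(4) eq[of y z] by blast
      ultimately show "x \<in> (\<Union>g\<in>nakamura_lattice P \<tau>. U g)" using y(2,3) unfolding U_def by blast
    next
      fix x assume "x \<in> (\<Union>g\<in>nakamura_lattice P \<tau>. U g)"
      then obtain g where g: "g \<in> nakamura_lattice P \<tau>" "x \<in> V" "g \<otimes>\<^bsub>?G\<^esub> x \<in> W"
        by (auto simp: U_def)
      hence "?p x = ?p (g \<otimes>\<^bsub>?G\<^esub> x)" using eq by blast
      hence "?p x \<in> ?p ` V \<inter> ?p ` W" using g by auto
      moreover have "x = inv_into V ?p (?p x)" using V g by simp
      ultimately show "x \<in> snd c ` (fst c \<inter> fst c')" by (auto simp: V(1) W(1))
    qed
    have tr: "transition c c' x = g \<otimes>\<^bsub>?G\<^esub> x" if "g \<in> nakamura_lattice P \<tau>" "x \<in> U g" for g x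
    proof -
      have x: "x \<in> V" "g \<otimes>\<^bsub>?G\<^esub> x \<in> W" using that by (auto simp: U_def)
      have "inv_into (?p ` V) (inv_into V ?p) x = ?p x"
        using x(1) V(3) by (metis inj_on_inv_into inv_into_f_f imageI order_refl)
      moreover have "?p x = ?p (g \<otimes>\<^bsub>?G\<^esub> x)" using eq that(1) by blast
      ultimately show ?thesis using inv_into_f_f[OF W(3) x(2)] by (simp add: transition_def V(1) W(1))
    qed
    have "holomorphic_map_on (transition c c') (\<Union>g\<in>nakamura_lattice P \<tau>. U g)"
      unfolding holomorphic_map_on_def
    proof
      fix x assume "x \<in> (\<Union>g\<in>nakamura_lattice P \<tau>. U g)"
      then obtain g where g: "g \<in> nakamura_lattice P \<tau>" "x \<in> U g" by blast
      let ?D = "\<lambda>v. wz_vec (w_coord v) (rho lam (w_coord g) *v z_coords v)"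
      have "(transition c c' has_derivative ?D) (at x)"
        by (rule has_derivative_transform_within_open[OF der opU g(2)]) (simp add: tr[OF g(1)])
      thus "\<exists>D. (transition c c' has_derivative D) (at x) \<and> (\<forall>c v. D (c *s v) = c *s D v)"
        using nakamura_translation_deriv(2)[where lam = lam and g = g] by blast
    qed
    thus ?thesis using opU by (simp add: im open_UN)
  qed
  show ?thesis unfolding holomorphic_atlas_def X
    by (rule conjI[OF cover], rule conjI, rule ballI, erule c1, rule ballI, rule ballI, erule (1) c2)
qed

end

theory Submission
  imports Defs
begin

text \<open>Take the left-invariant metric \<open>\<bar>dw\<bar>\<^sup>2 + \<Sum>\<^sub>i e\<close>\<open>\<^bsup>-2 \<lambda>\<^sub>i x\<^esup> \<bar>dz\<^sub>i\<bar>\<^sup>2\<close>, \<open>x = Re w\<close>, and expand the coefficients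
  of a harmonic form in Fourier series along the fibres of \<open>x\<close>, which are tori. The harmonicity equations
  then hold for each frequency \<open>k\<close> separately, as linear ODEs in \<open>x\<close>.

  If the frequency is nontrivial in a fibre direction \<open>z\<^sub>i\<close>, contraction with \<open>\<partial>/\<partial>z\<^sub>i\<close> and
  \<open>\<partial>/\<partial>\<close>\<open>z\<close>-bar\<open>\<^sub>i\<close> gives an explicit \<open>\<partial>\<close>\<open>\<partial>\<close>-bar-primitive of the mode. Pairing with the Hodge star shows
  that the energy density of the mode is, up to a constant, the derivative of a boundary term. If \<open>k\<close> is
  nontrivial only in fibre directions with \<open>\<lambda>\<^sub>j = 0\<close>, this term is \<open>1\<close>-periodic in \<open>x\<close>; otherwise, since \<open>\<Gamma>\<close>
  is a lattice, \<open>k\<close> is nontrivial both in an expanding and in a contracting direction, and smoothness makes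
  the mode decay superexponentially as \<open>x \<rightarrow> \<plusminus>\<infinity>\<close>. Either way the energy vanishes.

  A mode that is constant along the fibre directions is an exponential or, in resonance, a polynomial in
  \<open>x\<close>, while translation \<open>x \<mapsto> x + 1\<close> multiplies it by a factor determined by \<open>c\<^sub>I\<^sub>J\<close>; a nonzero solution
  forces \<open>\<tau> c\<^sub>I\<^sub>J \<in> 2\<pi>\<int>\<close>, so by hypothesis \<open>c\<^sub>I\<^sub>J = 0\<close> and the coefficient is constant. Harmonic forms are
  therefore the constant combinations of the \<open>dz\<^sub>I \<and> d\<close>\<open>z\<close>-bar\<open>\<^sub>J\<close> of weight zero, and weights add under the
  wedge product.\<close>

section \<open>Exterior algebra\<close>

text \<open>A Fourier mode lives on all of \<real>, not on a circle: the fibres over x and x + 1 are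
  glued by \<open>M\<close>, which moves the frequencies. Integrating the energy of a mode over x
  therefore leaves a boundary term, and the case split on \<open>lam\<close> serves to dispose of
  it.

  Forms are written on the cover in the constant coframe dz_i, not in the invariant one. Then
  \<partial> and \<partial>bar have no zeroth-order terms, and the geometry survives only in the
  automorphy factor of the coefficients and in the factor e^(2 c x) of the Hodge star, c being the
  weight. As the \<open>lam i\<close> sum to 0, the volume form is a constant multiple of the top
  monomial and the star reverses weights. Being antilinear, the star also sends frequency k to -k; a
  mode wedged with the mode of its star does not oscillate, and its value is the energy density
  \<Sum> e^(2 c x) |g|^2.

  The number \<tau> enters through the frequencies 2 pi n / \<tau> of Im w. For modes constant along
  the z_i these are the only exponents of the equations in x, and the shift by 1 matches them with
  \<plusminus>c; this is the origin of the resonance condition.\<close>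

definition contract :: "'m::finite cvec \<Rightarrow> 'm ext \<Rightarrow> 'm ext" where
  "contract v \<alpha> = (\<lambda>vs. \<alpha> (v # vs))"

text \<open>The grading involution supplies the sign that a contraction or a one-form acquires when
  it moves past \<alpha>.\<close>

definition grade_inv :: "'m::finite ext \<Rightarrow> 'm ext" where
  "grade_inv \<alpha> = (\<lambda>vs. (-1) ^ length vs * \<alpha> vs)"

lemma wedge_Nil [simp]: "wedge \<alpha> \<beta> [] = \<alpha> [] * \<beta> []"
  by (simp add: wedge_def)

text \<open>Split the shuffles by the factor that receives \<open>v\<close>. If it goes to \<beta>,
  position 0 is inverted with every position in \<open>S\<close>, and the extra sign (-1)^card
  \<open>S\<close> is what \<open>grade_inv\<close> records. Associativity and the sign rules below
  follow from this antiderivation property by induction on the argument list.\<close>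

lemma wedge_Cons:
  "wedge \<alpha> \<beta> (v # vs) = wedge (contract v \<alpha>) \<beta> vs + wedge (grade_inv \<alpha>) (contract v \<beta>) vs"
proof -
  define n where "n = length vs"
  define ivs :: "nat \<Rightarrow> nat set \<Rightarrow> nat" where "ivs = (\<lambda>n S. card {(i, j). i < j \<and> i \<in> {..<n} - S \<and> j \<in> S})"
  have ivs_app: "card {(i, j). i < j \<and> i \<in> {..<n} - S \<and> j \<in> S} = ivs n S" for n S
    by (simp add: ivs_def)
  have ivs1: "ivs (Suc n) (insert 0 (Suc ` S)) = ivs n S" for S
  proof -
    have "{(i, j). i < j \<and> i \<in> {..<Suc n} - insert 0 (Suc ` S) \<and> j \<in> insert 0 (Suc ` S)}
      = map_prod Suc Suc ` {(i, j). i < j \<and> i \<in> {..<n} - S \<and> j \<in> S}" (is "?A = ?B")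
    proof (rule Set.set_eqI)
      fix x :: "nat \<times> nat"
      obtain i j where x: "x = (i, j)" by (cases x)
      show "x \<in> ?A \<longleftrightarrow> x \<in> ?B"
        by (cases i; cases j) (auto simp: x)
    qed
    thus ?thesis by (simp add: ivs_def card_image inj_on_def)
  qed
  have ivs2: "ivs (Suc n) (Suc ` S) = card S + ivs n S" if S: "S \<subseteq> {..<n}" for S
  proof -
    have "{(i, j). i < j \<and> i \<in> {..<Suc n} - Suc ` S \<and> j \<in> Suc ` S}
      = Pair 0 ` Suc ` S \<union> map_prod Suc Suc ` {(i, j). i < j \<and> i \<in> {..<n} - S \<and> j \<in> S}"
      (is "?A = ?B")
    proof (rule Set.set_eqI)
      fix x :: "nat \<times> nat"
      obtain i j where x: "x = (i, j)" by (cases x)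
      show "x \<in> ?A \<longleftrightarrow> x \<in> ?B"
        by (cases i; cases j) (auto simp: x)
    qed
    moreover have "finite S" using S finite_subset by blast
    moreover have "finite {(i, j). i < j \<and> i \<in> {..<n} - S \<and> j \<in> S}"
      by (rule finite_subset[of _ "{..<n} \<times> S"]) (auto simp: \<open>finite S\<close>)
    moreover have "Pair 0 ` Suc ` S \<inter> map_prod Suc Suc ` {(i, j). i < j \<and> i \<in> {..<n} - S \<and> j \<in> S} = {}"
      by auto
    ultimately show ?thesis unfolding ivs_def
      by (simp add: card_Un_disjoint card_image inj_on_def)
  qed
  have len: "length (nths vs S) = card S" if "S \<subseteq> {..<n}" for S
    using that unfolding length_nths n_def by (intro arg_cong[of _ _ card]) auto
  define F where "F = (\<lambda>S. (-1) ^ ivs (Suc n) S * \<alpha> (nths (v # vs) S) * \<beta> (nths (v # vs) (- S)))"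
  have P: "Pow {..<Suc n} = image Suc ` Pow {..<n} \<union> (\<lambda>S. insert 0 (Suc ` S)) ` Pow {..<n}"
    unfolding lessThan_Suc_eq_insert_0 Pow_insert image_Pow_surj[OF refl, of Suc, symmetric] image_image ..
  have "wedge \<alpha> \<beta> (v # vs) = sum F (Pow {..<Suc n})"
    by (simp add: wedge_def F_def ivs_def n_def)
  also have "\<dots> = sum F (image Suc ` Pow {..<n}) + sum F ((\<lambda>S. insert 0 (Suc ` S)) ` Pow {..<n})"
    unfolding P by (rule sum.union_disjoint) auto
  also have "sum F (image Suc ` Pow {..<n}) = (\<Sum>S\<in>Pow {..<n}. F (Suc ` S))"
    by (subst sum.reindex) (auto simp: inj_on_def inj_image_eq_iff)
  also have "sum F ((\<lambda>S. insert 0 (Suc ` S)) ` Pow {..<n}) = (\<Sum>S\<in>Pow {..<n}. F (insert 0 (Suc ` S)))"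
  proof -
    have "S = S'" if "insert 0 (Suc ` S) = insert 0 (Suc ` S')" for S S'
    proof (rule Set.set_eqI)
      fix x show "x \<in> S \<longleftrightarrow> x \<in> S'"
        using arg_cong[OF that, of "\<lambda>A. Suc x \<in> A"] by auto
    qed
    hence "inj_on (\<lambda>S. insert 0 (Suc ` S)) (Pow {..<n})" unfolding inj_on_def by blast
    from sum.reindex[OF this, of F] show ?thesis by simp
  qed
  also have "(\<Sum>S\<in>Pow {..<n}. F (Suc ` S)) = wedge (grade_inv \<alpha>) (contract v \<beta>) vs"
    unfolding wedge_def n_def[symmetric] ivs_app
  proof (rule sum.cong[OF refl])
    fix S assume S: "S \<in> Pow {..<n}"
    have "{j. Suc j \<in> Suc ` S} = S" "{j. Suc j \<in> - Suc ` S} = - S" by auto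
    thus "F (Suc ` S) = (-1) ^ ivs n S * grade_inv \<alpha> (nths vs S) * contract v \<beta> (nths vs (- S))"
      using S by (simp add: F_def nths_Cons ivs2 len grade_inv_def contract_def power_add)
  qed
  also have "(\<Sum>S\<in>Pow {..<n}. F (insert 0 (Suc ` S))) = wedge (contract v \<alpha>) \<beta> vs"
    unfolding wedge_def n_def[symmetric] ivs_app
  proof (rule sum.cong[OF refl])
    fix S assume S: "S \<in> Pow {..<n}"
    have "{j. Suc j \<in> insert 0 (Suc ` S)} = S" "{j. Suc j \<in> - insert 0 (Suc ` S)} = - S" by auto
    thus "F (insert 0 (Suc ` S)) = (-1) ^ ivs n S * contract v \<alpha> (nths vs S) * \<beta> (nths vs (- S))"
      using S by (simp add: F_def nths_Cons ivs1 contract_def)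
  qed
  finally show ?thesis by simp
qed

section \<open>Bilinearity of the wedge product\<close>

lemma wedge_sum_left:
  "wedge (\<lambda>vs. \<Sum>k\<in>A. c k * \<alpha> k vs) \<beta> vs = (\<Sum>k\<in>A. c k * wedge (\<alpha> k) \<beta> vs)"
proof -
  have "wedge (\<lambda>vs. \<Sum>k\<in>A. c k * \<alpha> k vs) \<beta> vs = (\<Sum>S\<in>Pow {..<length vs}. \<Sum>k\<in>A. c k *
      ((-1) ^ card {(i, j). i < j \<and> i \<in> {..<length vs} - S \<and> j \<in> S} *
      \<alpha> k (nths vs S) * \<beta> (nths vs (- S))))"
    unfolding wedge_def by (intro sum.cong refl) (simp add: sum_distrib_left sum_distrib_right mult_ac)
  thus ?thesis unfolding wedge_def by (subst (asm) sum.swap) (simp add: sum_distrib_left)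
qed

lemma wedge_sum_right:
  "wedge \<alpha> (\<lambda>vs. \<Sum>k\<in>A. c k * \<beta> k vs) vs = (\<Sum>k\<in>A. c k * wedge \<alpha> (\<beta> k) vs)"
proof -
  have "wedge \<alpha> (\<lambda>vs. \<Sum>k\<in>A. c k * \<beta> k vs) vs = (\<Sum>S\<in>Pow {..<length vs}. \<Sum>k\<in>A. c k *
      ((-1) ^ card {(i, j). i < j \<and> i \<in> {..<length vs} - S \<and> j \<in> S} *
      \<alpha> (nths vs S) * \<beta> k (nths vs (- S))))"
    unfolding wedge_def by (intro sum.cong refl) (simp add: sum_distrib_left sum_distrib_right mult_ac)
  thus ?thesis unfolding wedge_def by (subst (asm) sum.swap) (simp add: sum_distrib_left)
qed

lemma wedge_add_left: "wedge (\<lambda>vs. \<alpha> vs + \<alpha>' vs) \<beta> vs = wedge \<alpha> \<beta> vs + wedge \<alpha>' \<beta> vs"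
  by (simp add: wedge_def algebra_simps sum.distrib)

lemma wedge_add_right: "wedge \<alpha> (\<lambda>vs. \<beta> vs + \<beta>' vs) vs = wedge \<alpha> \<beta> vs + wedge \<alpha> \<beta>' vs"
  by (simp add: wedge_def algebra_simps sum.distrib)

lemma wedge_scale_left: "wedge (\<lambda>vs. c * \<alpha> vs) \<beta> vs = c * wedge \<alpha> \<beta> vs"
  by (simp add: wedge_def sum_distrib_left mult_ac)

lemma wedge_scale_right: "wedge \<alpha> (\<lambda>vs. c * \<beta> vs) vs = c * wedge \<alpha> \<beta> vs"
  by (simp add: wedge_def sum_distrib_left mult_ac)

lemma wedge_minus_left: "wedge (\<lambda>vs. - \<alpha> vs) \<beta> vs = - wedge \<alpha> \<beta> vs"
  using wedge_scale_left[of "-1"] by simp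

lemma wedge_minus_right: "wedge \<alpha> (\<lambda>vs. - \<beta> vs) vs = - wedge \<alpha> \<beta> vs"
  using wedge_scale_right[of _ "-1"] by simp

lemma wedge_diff_right: "wedge \<alpha> (\<lambda>vs. \<beta> vs - \<beta>' vs) vs = wedge \<alpha> \<beta> vs - wedge \<alpha> \<beta>' vs"
  by (simp add: wedge_def algebra_simps sum_subtractf)

lemma wedge_zero [simp]: "wedge (\<lambda>vs. 0) \<beta> vs = 0" "wedge \<alpha> (\<lambda>vs. 0) vs = 0"
  by (simp_all add: wedge_def)

lemma wedge_fun_simps:
  "wedge (\<lambda>vs. c * \<alpha> vs) \<beta> = (\<lambda>vs. c * wedge \<alpha> \<beta> vs)"
  "wedge \<alpha> (\<lambda>vs. c * \<beta> vs) = (\<lambda>vs. c * wedge \<alpha> \<beta> vs)"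
  "wedge (\<lambda>vs. - \<alpha> vs) \<beta> = (\<lambda>vs. - wedge \<alpha> \<beta> vs)"
  "wedge \<alpha> (\<lambda>vs. - \<beta> vs) = (\<lambda>vs. - wedge \<alpha> \<beta> vs)"
  "wedge (\<lambda>vs. 0) \<beta> = (\<lambda>vs. 0)" "wedge \<alpha> (\<lambda>vs. 0) = (\<lambda>vs. 0)"
  by (simp_all add: fun_eq_iff wedge_scale_left wedge_scale_right wedge_minus_left wedge_minus_right)

section \<open>Grading involution, associativity and unit\<close>

lemma grade_inv_grade_inv [simp]: "grade_inv (grade_inv \<alpha>) = \<alpha>"
  by (simp add: grade_inv_def fun_eq_iff flip: mult.assoc power_mult_distrib)

lemma contract_grade_inv: "contract v (grade_inv \<alpha>) = (\<lambda>vs. - grade_inv (contract v \<alpha>) vs)"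
  by (simp add: grade_inv_def contract_def)

lemma contract_wedge: "contract v (wedge \<alpha> \<beta>) = (\<lambda>vs. wedge (contract v \<alpha>) \<beta> vs + wedge (grade_inv \<alpha>) (contract v \<beta>) vs)"
  by (simp add: contract_def [of _ "wedge \<alpha> \<beta>"] wedge_Cons)

lemma grade_inv_wedge_app: "grade_inv (wedge \<alpha> \<beta>) vs = wedge (grade_inv \<alpha>) (grade_inv \<beta>) vs"
proof (induction vs arbitrary: \<alpha> \<beta>)
  case (Cons v vs)
  have "grade_inv (wedge \<alpha> \<beta>) (v # vs) = - grade_inv (wedge (contract v \<alpha>) \<beta>) vs - grade_inv (wedge (grade_inv \<alpha>) (contract v \<beta>)) vs"
    by (simp add: grade_inv_def wedge_Cons algebra_simps)
  also have "\<dots> = wedge (grade_inv \<alpha>) (grade_inv \<beta>) (v # vs)"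
    by (simp add: Cons.IH wedge_Cons contract_grade_inv wedge_minus_left wedge_minus_right)
  finally show ?case .
qed (simp add: grade_inv_def)

lemma grade_inv_wedge: "grade_inv (wedge \<alpha> \<beta>) = wedge (grade_inv \<alpha>) (grade_inv \<beta>)"
  by (rule ext) (rule grade_inv_wedge_app)

text \<open>Contracting with the first argument turns both sides into the same three terms on a
  shorter list, which replaces the combinatorics of iterated shuffles. The induction must generalise
  over all three forms, because contraction and \<open>grade_inv\<close> change them.\<close>

lemma wedge_assoc_app: "wedge (wedge \<alpha> \<beta>) \<gamma> vs = wedge \<alpha> (wedge \<beta> \<gamma>) vs"
  by (induction vs arbitrary: \<alpha> \<beta> \<gamma>)
    (simp_all add: wedge_Cons contract_wedge grade_inv_wedge wedge_add_left wedge_add_right)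

lemma wedge_assoc: "wedge (wedge \<alpha> \<beta>) \<gamma> = wedge \<alpha> (wedge \<beta> \<gamma>)"
  by (rule ext) (rule wedge_assoc_app)

lemma contract_one: "contract v ext_one = (\<lambda>vs. 0)"
  by (simp add: contract_def ext_one_def)

lemma grade_inv_one: "grade_inv ext_one = ext_one"
  by (simp add: grade_inv_def ext_one_def fun_eq_iff)

lemma wedge_one_left_app: "wedge ext_one \<beta> vs = \<beta> vs"
proof (induction vs arbitrary: \<beta>)
  case Nil thus ?case by (simp add: ext_one_def)
next
  case (Cons v vs) thus ?case by (simp only: wedge_Cons contract_one grade_inv_one wedge_zero) (simp add: contract_def)
qed

lemma wedge_one_left [simp]: "wedge ext_one \<beta> = \<beta>"
  by (rule ext) (rule wedge_one_left_app)

lemma wedge_one_right_app: "wedge \<alpha> ext_one vs = \<alpha> vs"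
proof (induction vs arbitrary: \<alpha>)
  case Nil thus ?case by (simp add: ext_one_def)
next
  case (Cons v vs) thus ?case by (simp only: wedge_Cons contract_one grade_inv_one wedge_zero) (simp add: contract_def)
qed

lemma wedge_one_right [simp]: "wedge \<alpha> ext_one = \<alpha>"
  by (rule ext) (rule wedge_one_right_app)

text \<open>The index \<open>Inl k\<close> stands for \<open>dz\<^sub>k\<close> and \<open>Inr k\<close> for its conjugate.\<close>

fun covec :: "'m + 'm \<Rightarrow> 'm::finite cvec \<Rightarrow> complex" where
  "covec (Inl k) v = v $ k"
| "covec (Inr k) v = cnj (v $ k)"

definition cov :: "'m + 'm \<Rightarrow> 'm::finite ext" where
  "cov t vs = (if length vs = 1 then covec t (hd vs) else 0)"

lemma cov_Inl: "cov (Inl k) = dz k" and cov_Inr: "cov (Inr k) = dzbar k"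
  by (simp_all add: cov_def dz_def dzbar_def fun_eq_iff)

lemma cov_Nil [simp]: "cov t [] = 0"
  by (simp add: cov_def)

lemma contract_cov: "contract v (cov t) = (\<lambda>vs. covec t v * ext_one vs)"
  by (auto simp: contract_def cov_def ext_one_def)

lemma grade_inv_cov: "grade_inv (cov t) = (\<lambda>vs. - cov t vs)"
  by (auto simp: grade_inv_def cov_def)

lemma wedge_cov_Cons:
  "wedge (cov t) \<beta> (v # vs) = covec t v * \<beta> vs - wedge (cov t) (contract v \<beta>) vs"
  by (simp add: wedge_Cons contract_cov grade_inv_cov wedge_scale_left wedge_minus_left)

lemma contract_wedge_cov: "contract v (wedge (cov t) \<beta>) = (\<lambda>vs. covec t v * \<beta> vs - wedge (cov t) (contract v \<beta>) vs)"
  by (simp add: contract_def [of _ "wedge _ _"] wedge_cov_Cons)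

lemma wedge_cov_anticomm_app:
  "wedge (cov s) (wedge (cov t) \<beta>) vs = - wedge (cov t) (wedge (cov s) \<beta>) vs"
  by (induction vs arbitrary: \<beta>)
    (simp_all add: wedge_cov_Cons contract_wedge_cov wedge_diff_right wedge_scale_right)

lemma wedge_cov_anticomm:
  "wedge (cov s) (wedge (cov t) \<beta>) = (\<lambda>vs. - wedge (cov t) (wedge (cov s) \<beta>) vs)"
  by (rule ext) (rule wedge_cov_anticomm_app)

lemma wedge_cov_same: "wedge (cov t) (wedge (cov t) \<beta>) = (\<lambda>vs. 0)"
  using wedge_cov_anticomm_app[of t t \<beta>] by (auto simp: fun_eq_iff eq_neg_iff_add_eq_0)

lemma wedge_cov_commute_app: "wedge \<beta> (cov t) vs = wedge (cov t) (grade_inv \<beta>) vs"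
proof (induction vs arbitrary: \<beta>)
  case Nil thus ?case by (simp add: cov_def)
next
  case (Cons v vs)
  show ?case
    by (simp only: wedge_cov_Cons)
      (simp add: wedge_Cons Cons.IH contract_cov wedge_scale_right contract_grade_inv wedge_minus_right)
qed

lemma wedge_cov_commute: "wedge \<beta> (wedge (cov t) \<gamma>) = wedge (cov t) (wedge (grade_inv \<beta>) \<gamma>)"
proof -
  have "wedge \<beta> (cov t) = wedge (cov t) (grade_inv \<beta>)" by (rule ext) (rule wedge_cov_commute_app)
  thus ?thesis by (metis wedge_assoc)
qed

section \<open>Wedge monomials and their coefficients\<close>

definition es :: "('m + 'm) list \<Rightarrow> 'm::finite ext" where
  "es ks = foldr (\<lambda>t. wedge (cov t)) ks ext_one"

lemma es_simps [simp]: "es [] = ext_one" "es (k # ks) = wedge (cov k) (es ks)"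
  by (simp_all add: es_def)

lemma es_append: "es (ks @ ls) = wedge (es ks) (es ls)"
  by (induction ks) (simp_all add: wedge_assoc)

lemma es_move_front: "\<exists>s\<in>{1, -1}. es (as @ k # bs) = (\<lambda>vs. s * es (k # as @ bs) vs)"
proof (induction as)
  case Nil thus ?case by (intro bexI[of _ 1]) auto
next
  case (Cons a as)
  then obtain s where s: "s \<in> {1, -1}" "es (as @ k # bs) = (\<lambda>vs. s * es (k # as @ bs) vs)" by blast
  have "es ((a # as) @ k # bs) vs = - s * es (k # (a # as) @ bs) vs" for vs
    using wedge_cov_anticomm_app[of a k "es (as @ bs)" vs] s(2) by (simp add: wedge_scale_right)
  thus ?case using s(1) by (intro bexI[of _ "- s"]) auto
qed

text \<open>The sign of the permutation stays anonymous; later arguments use only that it is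
  \<plusminus>1.\<close>

lemma es_perm:
  assumes "distinct ks" "distinct ls" "set ks = set ls"
  shows "\<exists>s\<in>{1, -1}. es ls = (\<lambda>vs. s * es ks vs)"
  using assms
proof (induction ks arbitrary: ls)
  case Nil thus ?case by (intro bexI[of _ 1]) auto
next
  case (Cons k ks)
  then obtain as bs where ls: "ls = as @ k # bs" by (metis list.set_intros(1) split_list)
  hence "distinct ks" "distinct (as @ bs)" "set ks = set (as @ bs)" using Cons.prems by auto
  from Cons.IH[OF this] obtain s where s: "s \<in> {1, -1}" "es (as @ bs) = (\<lambda>vs. s * es ks vs)"
    by (rule bexE)
  obtain s' where s': "s' \<in> {1, -1}" "es ls = (\<lambda>vs. s' * es (k # as @ bs) vs)"
    using es_move_front[of as k bs] ls by blast
  have "es ls = (\<lambda>vs. (s' * s) * es (k # ks) vs)" using s' s(2) by (simp add: wedge_scale_right mult.assoc)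
  thus ?case using s(1) s'(1) by (intro bexI[of _ "s' * s"]) auto
qed

lemma es_not_distinct: "\<not> distinct ks \<Longrightarrow> es ks = (\<lambda>vs. 0)"
proof (induction ks)
  case (Cons k ks)
  show ?case
  proof (cases "distinct ks")
    case False thus ?thesis using Cons.IH by simp
  next
    case True
    hence "k \<in> set ks" using Cons.prems by simp
    then obtain as bs where ks: "ks = as @ k # bs" by (metis split_list)
    then obtain s where "es ks = (\<lambda>vs. s * es (k # as @ bs) vs)"
      using es_move_front[of as k bs] by blast
    hence "wedge (cov k) (es ks) = (\<lambda>vs. s * wedge (cov k) (wedge (cov k) (es (as @ bs))) vs)"
      by (simp add: wedge_fun_simps)
    thus ?thesis by (simp add: wedge_cov_same)
  qed
qed simp

text \<open>Contraction with the complex vector field dual to \<open>cov t\<close>, expressed through the real vectors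
  at which forms are evaluated.\<close>

definition iota :: "'m + 'm \<Rightarrow> 'm ext \<Rightarrow> 'm::finite ext" where
  "iota t \<beta> vs = (case t of
      Inl k \<Rightarrow> (\<beta> (axis k 1 # vs) - \<i> * \<beta> (axis k \<i> # vs)) / 2
    | Inr k \<Rightarrow> (\<beta> (axis k 1 # vs) + \<i> * \<beta> (axis k \<i> # vs)) / 2)"

lemma iota_linear:
  "iota t (\<lambda>vs. 0) = (\<lambda>vs. 0)"
  "iota t (\<lambda>vs. c * \<beta> vs) = (\<lambda>vs. c * iota t \<beta> vs)"
  "iota t (\<lambda>vs. - \<beta> vs) = (\<lambda>vs. - iota t \<beta> vs)"
  "iota t (\<lambda>vs. \<beta> vs + \<gamma> vs) = (\<lambda>vs. iota t \<beta> vs + iota t \<gamma> vs)"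
  "iota t (\<lambda>vs. \<beta> vs - \<gamma> vs) = (\<lambda>vs. iota t \<beta> vs - iota t \<gamma> vs)"
  by (auto simp: iota_def fun_eq_iff field_simps split: sum.splits)

lemma iota_sum: "iota t (\<lambda>vs. \<Sum>k\<in>A. c k * \<beta> k vs) = (\<lambda>vs. \<Sum>k\<in>A. c k * iota t (\<beta> k) vs)"
  by (induction A rule: infinite_finite_induct) (simp_all add: iota_linear)

text \<open>Combining the real contractions in the directions 1 and \<i> separates complex linear
  from antilinear covectors, so \<open>iota t\<close> is dual to \<open>cov t\<close>. The result is
  the anticommutation relation between exterior multiplication and contraction.\<close>

lemma iota_wedge_cov:
  "iota t (wedge (cov s) \<beta>) = (\<lambda>vs. (if s = t then \<beta> vs else 0) - wedge (cov s) (iota t \<beta>) vs)"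
proof
  fix vs
  have split: "iota t \<beta> = (\<lambda>vs. 1/2 * contract (axis (case t of Inl k \<Rightarrow> k | Inr k \<Rightarrow> k) 1) \<beta> vs +
     (case t of Inl _ \<Rightarrow> -\<i>/2 | Inr _ \<Rightarrow> \<i>/2) * contract (axis (case t of Inl k \<Rightarrow> k | Inr k \<Rightarrow> k) \<i>) \<beta> vs)"
    by (auto simp: iota_def contract_def fun_eq_iff field_simps split: sum.splits)
  have w: "wedge (cov s) (iota t \<beta>) vs = 1/2 * wedge (cov s) (contract (axis (case t of Inl k \<Rightarrow> k | Inr k \<Rightarrow> k) 1) \<beta>) vs +
     (case t of Inl _ \<Rightarrow> -\<i>/2 | Inr _ \<Rightarrow> \<i>/2) * wedge (cov s) (contract (axis (case t of Inl k \<Rightarrow> k | Inr k \<Rightarrow> k) \<i>) \<beta>) vs"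
    unfolding split wedge_add_right wedge_scale_right ..
  show "iota t (wedge (cov s) \<beta>) vs = (if s = t then \<beta> vs else 0) - wedge (cov s) (iota t \<beta>) vs"
    unfolding w
    by (cases s; cases t) (auto simp: iota_def wedge_cov_Cons axis_def field_simps)
qed

lemma iota_one: "iota t ext_one = (\<lambda>vs. 0)"
  by (auto simp: iota_def ext_one_def fun_eq_iff split: sum.splits)

lemma iota_es_notin: "t \<notin> set ks \<Longrightarrow> iota t (es ks) = (\<lambda>vs. 0)"
  by (induction ks) (auto simp: iota_one iota_wedge_cov)

lemma iota_es_in:
  "distinct ks \<Longrightarrow> t \<in> set ks \<Longrightarrow> \<exists>s\<in>{1, -1}. iota t (es ks) = (\<lambda>vs. s * es (remove1 t ks) vs)"
proof (induction ks)
  case (Cons k ks)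
  show ?case
  proof (cases "k = t")
    case True
    hence "iota t (es ks) = (\<lambda>vs. 0)" using Cons.prems by (intro iota_es_notin) auto
    thus ?thesis using True by (intro bexI[of _ 1]) (auto simp: iota_wedge_cov)
  next
    case False
    hence "distinct ks" "t \<in> set ks" using Cons.prems by auto
    from Cons.IH[OF this] obtain s where "s \<in> {1, -1}" "iota t (es ks) = (\<lambda>vs. s * es (remove1 t ks) vs)"
      by (rule bexE)
    thus ?thesis using False
      by (intro bexI[of _ "- s"]) (auto simp: iota_wedge_cov wedge_scale_right)
  qed
qed simp

text \<open>Contracting successively with the fields dual to \<open>ks\<close> reads off the
  coefficient of \<open>es ks\<close> linearly, so coefficients can be compared without a separate
  proof that the monomials are independent.\<close>

definition coef :: "('m + 'm) list \<Rightarrow> 'm::finite ext \<Rightarrow> complex" where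
  "coef ks \<beta> = fold iota ks \<beta> []"

lemma coef_simps [simp]: "coef [] \<beta> = \<beta> []" "coef (k # ks) \<beta> = coef ks (iota k \<beta>)"
  by (simp_all add: coef_def)

lemma coef_linear:
  "coef ks (\<lambda>vs. c * \<beta> vs) = c * coef ks \<beta>"
  "coef ks (\<lambda>vs. 0) = 0"
  by (induction ks arbitrary: \<beta>) (simp_all add: iota_linear)

lemma coef_sum: "coef ks (\<lambda>vs. \<Sum>k\<in>A. c k * \<beta> k vs) = (\<Sum>k\<in>A. c k * coef ks (\<beta> k))"
  by (induction ks arbitrary: \<beta>) (simp_all add: iota_sum)

lemma coef_es_same: "distinct ks \<Longrightarrow> coef ks (es ks) = 1"
  by (induction ks) (simp_all add: ext_one_def iota_wedge_cov iota_es_notin)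

lemma es_Nil: "ks \<noteq> [] \<Longrightarrow> es ks [] = 0"
  by (cases ks) simp_all

lemma coef_es_diff:
  "distinct ks \<Longrightarrow> distinct ls \<Longrightarrow> set ks \<noteq> set ls \<Longrightarrow> coef ks (es ls) = 0"
proof (induction ks arbitrary: ls)
  case Nil thus ?case by (auto simp: es_Nil)
next
  case (Cons k ks)
  show ?case
  proof (cases "k \<in> set ls")
    case False thus ?thesis by (simp add: iota_es_notin coef_linear)
  next
    case True
    then obtain s where s: "iota k (es ls) = (\<lambda>vs. s * es (remove1 k ls) vs)"
      using iota_es_in Cons.prems by blast
    have "set ks \<noteq> set (remove1 k ls)" using Cons.prems True by auto
    thus ?thesis using Cons s by (simp add: coef_linear)
  qed
qed

inductive homog :: "nat \<Rightarrow> 'm::finite ext \<Rightarrow> bool" where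
  es: "length ks = j \<Longrightarrow> homog j (es ks)"
| lin: "homog j \<alpha> \<Longrightarrow> homog j \<beta> \<Longrightarrow> homog j (\<lambda>vs. a * \<alpha> vs + b * \<beta> vs)"

lemma homog_scale: "homog j \<alpha> \<Longrightarrow> homog j (\<lambda>vs. c * \<alpha> vs)"
  using homog.lin[of j \<alpha> \<alpha> c 0] by simp

lemma homog_zero: "homog j (\<lambda>vs. 0)"
  \<comment> \<open>Any monomial with \<open>j\<close> factors will do; \<open>replicate\<close>
    supplies one.\<close>
  using homog_scale[OF homog.es[of "replicate j undefined" j], of 0] by simp

lemma homog_add: "homog j \<alpha> \<Longrightarrow> homog j \<beta> \<Longrightarrow> homog j (\<lambda>vs. \<alpha> vs + \<beta> vs)"
  using homog.lin[of j \<alpha> \<beta> 1 1] by simp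

lemma homog_sum: "(\<And>k. k \<in> A \<Longrightarrow> homog j (\<beta> k)) \<Longrightarrow> homog j (\<lambda>vs. \<Sum>k\<in>A. \<beta> k vs)"
  by (induction A rule: infinite_finite_induct) (simp_all add: homog_zero homog_add)

lemma homog_wedge: "homog i \<alpha> \<Longrightarrow> homog j \<beta> \<Longrightarrow> homog (i + j) (wedge \<alpha> \<beta>)"
proof (induction rule: homog.induct)
  case (es ks i)
  show ?case using es(2)
  proof (induction rule: homog.induct)
    case (es ls j)
    show ?case using homog.es[of "ks @ ls" "i + j"] es \<open>length ks = i\<close> by (simp add: es_append)
  next
    case (lin j \<alpha> \<beta> a b)
    have "wedge (es ks) (\<lambda>vs. a * \<alpha> vs + b * \<beta> vs) =
        (\<lambda>vs. a * wedge (es ks) \<alpha> vs + b * wedge (es ks) \<beta> vs)"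
      by (rule ext) (simp add: wedge_add_right wedge_scale_right)
    thus ?case using homog.lin[OF lin.IH, of a b] by simp
  qed
next
  case (lin i \<alpha> \<alpha>' a b)
  have "wedge (\<lambda>vs. a * \<alpha> vs + b * \<alpha>' vs) \<beta> = (\<lambda>vs. a * wedge \<alpha> \<beta> vs + b * wedge \<alpha>' \<beta> vs)"
    by (rule ext) (simp add: wedge_add_left wedge_scale_left)
  thus ?case using homog.lin[OF lin.IH(1)[OF lin.prems] lin.IH(2)[OF lin.prems], of a b] by simp
qed

lemma homog_cov: "homog j \<beta> \<Longrightarrow> homog (Suc j) (wedge (cov t) \<beta>)"
  using homog_wedge[OF homog.es[of "[t]" 1]] by simp

lemma homog_iota_es: "length ks = Suc j \<Longrightarrow> homog j (iota t (es ks))"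
proof (induction ks arbitrary: j)
  case (Cons k ks)
  have 1: "homog j (\<lambda>vs. if k = t then es ks vs else 0)"
    using Cons.prems by (cases "k = t") (auto simp: homog_zero intro: homog.es)
  have 2: "homog j (wedge (cov k) (iota t (es ks)))"
  proof (cases j)
    case 0 thus ?thesis using Cons.prems homog_zero by (simp add: iota_one wedge_fun_simps)
  next
    case (Suc i) thus ?thesis using Cons by (auto intro: homog_cov)
  qed
  show ?case using homog.lin[OF 1 2, of 1 "-1"] by (simp add: iota_wedge_cov)
qed simp

lemma homog_iota: "homog (Suc j) \<beta> \<Longrightarrow> homog j (iota t \<beta>)"
proof (induction "Suc j" \<beta> rule: homog.induct)
  case (es ks) thus ?case by (rule homog_iota_es)
next
  case (lin \<alpha> \<beta> a b) thus ?case by (simp add: iota_linear homog.lin)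
qed

text \<open>A list without repetition that is as long as the number of basis covectors exhausts them
  and is a rearrangement of \<open>fs\<close>; lists with repetition contribute zero.\<close>

lemma homog_top:
  fixes \<beta> :: "'m::finite ext"
  assumes "homog (2 * CARD('m)) \<beta>" and "distinct fs" "set fs = UNIV"
  shows "\<exists>c. \<beta> = (\<lambda>vs. c * es fs vs)"
  using assms(1)
proof (induction "2 * CARD('m)" \<beta> rule: homog.induct)
  case (es ks)
  show ?case
  proof (cases "distinct ks")
    case False thus ?thesis by (intro exI[of _ 0]) (simp add: es_not_distinct)
  next
    case True
    hence "card (set ks) = CARD('m + 'm)" using es by (simp add: distinct_card card_UNIV_sum)
    hence "set ks = UNIV" by (intro card_subset_eq) auto
    thus ?thesis using es_perm[OF assms(2) True] assms(3) by metis
  qed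
next
  case (lin \<alpha> \<beta> a b)
  then obtain c d where "\<alpha> = (\<lambda>vs. c * es fs vs)" "\<beta> = (\<lambda>vs. d * es fs vs)" by blast
  thus ?case by (intro exI[of _ "a * c + b * d"]) (auto simp: algebra_simps)
qed

lemma wedge_map_app: "wedge \<alpha> \<beta> (map T vs) = wedge (\<lambda>us. \<alpha> (map T us)) (\<lambda>us. \<beta> (map T us)) vs"
  by (simp add: wedge_def nths_map)

text \<open>The alternating sum is the one in the definitions of \<open>del\<close> and
  \<open>delbar\<close>; through it these operators become exterior multiplication by
  covectors.\<close>

lemma wedge_cov_expand:
  "wedge (cov t) \<beta> vs = (\<Sum>i<length vs. (-1) ^ i * covec t (vs ! i) * \<beta> (take i vs @ drop (Suc i) vs))"
proof (induction vs arbitrary: \<beta>)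
  case (Cons v vs)
  have "wedge (cov t) (contract v \<beta>) vs =
     (\<Sum>i<length vs. (-1) ^ i * covec t (vs ! i) * \<beta> (v # take i vs @ drop (Suc i) vs))"
    by (simp add: Cons.IH contract_def)
  thus ?case by (simp add: wedge_cov_Cons sum.lessThan_Suc_shift sum_negf del: sum.lessThan_Suc)
qed simp

section \<open>Hodge star of a diagonal metric\<close>

definition hdiag :: "('m::finite \<Rightarrow> real) \<Rightarrow> 'm cvec \<Rightarrow> 'm cvec \<Rightarrow> complex" where
  "hdiag w u v = (\<Sum>k\<in>UNIV. of_real (w k) * (u $ k * cnj (v $ k)))"

definition index_of :: "'m + 'm \<Rightarrow> 'm" where
  "index_of t = (case t of Inl k \<Rightarrow> k | Inr k \<Rightarrow> k)"

lemma index_of_simps [simp]: "index_of (Inl k) = k" "index_of (Inr k) = k"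
  by (simp_all add: index_of_def)

lemma hermitian_inner_hdiag:
  assumes w: "\<And>k. w k > 0"
  shows "hermitian_inner (hdiag w)"
  unfolding hermitian_inner_def
proof (intro conjI allI impI)
  fix u :: "'a cvec" assume "u \<noteq> 0"
  then obtain k where k: "u $ k \<noteq> 0" by (auto simp: vec_eq_iff)
  have "Re (hdiag w u u) = (\<Sum>k\<in>UNIV. w k * (norm (u $ k))\<^sup>2)"
    by (simp add: hdiag_def cmod_power2) (simp add: power2_eq_square)
  also have "\<dots> > 0"
    by (rule sum_pos2[of _ k]) (use w k in \<open>auto intro!: mult_nonneg_nonneg less_imp_le[OF w]\<close>)
  finally show "Re (hdiag w u u) > 0" .
qed (simp_all add: hdiag_def algebra_simps sum.distrib sum_distrib_left)

text \<open>An isometry from the real part of \<open>hdiag w\<close> onto the standard inner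
  product, through which Euclidean orthonormal bases are transported.\<close>

definition rsc :: "('m::finite \<Rightarrow> real) \<Rightarrow> 'm cvec \<Rightarrow> 'm cvec" where
  "rsc w v = (\<chi> k. sqrt (w k) *\<^sub>R (v $ k))"

context
  fixes w :: "'m::finite \<Rightarrow> real"
  assumes w: "\<And>k. w k > 0"
begin

lemma linear_rsc: "linear (rsc w)"
  by (rule linearI) (simp_all add: rsc_def vec_eq_iff scaleR_right_distrib mult.commute)

lemma rsc_inverse: "rsc w (rsc (\<lambda>k. 1 / w k) v) = v" "rsc (\<lambda>k. 1 / w k) (rsc w v) = v"
  using w by (simp_all add: rsc_def vec_eq_iff real_sqrt_divide less_imp_neq[OF w, symmetric])

lemma Re_hdiag: "Re (hdiag w u v) = rsc w u \<bullet> rsc w v"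
proof -
  have *: "sqrt (w k) * a * (sqrt (w k) * b) = w k * (a * b)" for a b k
  proof -
    have "sqrt (w k) * sqrt (w k) = w k" using w[of k] by simp
    thus ?thesis by (metis mult.assoc mult.left_commute)
  qed
  show ?thesis by (simp add: hdiag_def inner_vec_def rsc_def inner_complex_def distrib_left * del: mult.assoc)
qed

lemma ex_orthonormal_basis: "\<exists>B. orthonormal_basis (hdiag w) B"
proof
  let ?i = "rsc (\<lambda>k. 1 / w k)"
  have lin: "linear ?i" by (rule linearI) (simp_all add: rsc_def vec_eq_iff scaleR_right_distrib mult.commute)
  have "span (?i ` Basis) = ?i ` UNIV" by (simp add: linear_span_image[OF lin] span_Basis)
  moreover have "surj ?i" by (rule surjI[of _ "rsc w"]) (rule rsc_inverse)
  moreover have "?i u = ?i v \<longleftrightarrow> u = v" for u v using rsc_inverse(1) by metis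
  ultimately show "orthonormal_basis (hdiag w) (?i ` Basis)"
    by (auto simp: orthonormal_basis_def Re_hdiag rsc_inverse inner_Basis)
qed

text \<open>\<open>ext_inner\<close> works with an orthonormal frame picked by choice, so the Gram
  matrix is computed for every frame, by Parseval's identity for pairs of real coordinate vectors.
  The 2 arises because dz_k = dx_k + \<i> dy_k and both real covectors have squared length 1 /
  \<open>w k\<close>.\<close>

lemma orthonormal_basis_gram:
  assumes B: "orthonormal_basis (hdiag w) B"
  shows "finite B"
    "(\<Sum>v\<in>B. covec s v * cnj (covec t v)) = (if s = t then of_real (2 / w (index_of t)) else 0)"
proof -
  have inj: "inj (rsc w)" by (rule injI) (metis rsc_inverse(2))
  let ?C = "rsc w ` B"
  have orth: "pairwise orthogonal ?C"
    using B by (auto simp: pairwise_def orthogonal_def orthonormal_basis_def Re_hdiag)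
  have nrm: "norm i = 1" if "i \<in> ?C" for i
    using that B by (auto simp: norm_eq_1 orthonormal_basis_def Re_hdiag)
  have fin: "finite ?C" using orth by (rule pairwise_orthogonal_imp_finite)
  thus finB: "finite B" using inj by (meson finite_imageD inj_on_subset top_greatest)
  have "surj (rsc w)" by (rule surjI) (rule rsc_inverse)
  hence span: "span ?C = UNIV"
    using B by (simp add: linear_span_image[OF linear_rsc] orthonormal_basis_def)
  have par: "x \<bullet> y = (\<Sum>v\<in>B. (x \<bullet> rsc w v) * (y \<bullet> rsc w v))" for x y
  proof -
    have "x = (\<Sum>i\<in>?C. (x \<bullet> i) *\<^sub>R i)"
      by (rule orthonormal_basis_expand[symmetric]) (use orth nrm fin span in auto)
    hence "x \<bullet> y = (\<Sum>i\<in>?C. (x \<bullet> i) *\<^sub>R i) \<bullet> y" by simp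
    also have "\<dots> = (\<Sum>i\<in>?C. (x \<bullet> i) * (y \<bullet> i))"
      unfolding inner_sum_left inner_scaleR_left by (simp add: inner_commute[of y])
    also have "\<dots> = (\<Sum>v\<in>B. (x \<bullet> rsc w v) * (y \<bullet> rsc w v))"
      by (subst sum.reindex) (auto intro: inj_on_subset[OF inj])
    finally show ?thesis .
  qed
  have ax: "axis k 1 \<bullet> rsc w v = sqrt (w k) * Re (v $ k)" "axis k \<i> \<bullet> rsc w v = sqrt (w k) * Im (v $ k)"
    for k :: 'm and v
    by (simp_all add: inner_axis' rsc_def inner_complex_def)
  have wk: "sqrt (w k) \<noteq> 0" "sqrt (w k) * sqrt (w k) = w k" for k
    using w[of k] by simp_all
  have RR: "(\<Sum>v\<in>B. Re (v $ k) * Re (v $ l)) = (if k = l then 1 / w k else 0)"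
    and II: "(\<Sum>v\<in>B. Im (v $ k) * Im (v $ l)) = (if k = l then 1 / w k else 0)"
    and RI: "(\<Sum>v\<in>B. Re (v $ k) * Im (v $ l)) = 0"
    and IR: "(\<Sum>v\<in>B. Im (v $ k) * Re (v $ l)) = 0" for k l
  proof -
    have "(\<Sum>v\<in>B. Re (v $ k) * Re (v $ l)) * (sqrt (w k) * sqrt (w l)) = axis k 1 \<bullet> (axis l 1 :: 'm cvec)"
      "(\<Sum>v\<in>B. Im (v $ k) * Im (v $ l)) * (sqrt (w k) * sqrt (w l)) = axis k \<i> \<bullet> (axis l \<i> :: 'm cvec)"
      "(\<Sum>v\<in>B. Re (v $ k) * Im (v $ l)) * (sqrt (w k) * sqrt (w l)) = axis k 1 \<bullet> (axis l \<i> :: 'm cvec)"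
      "(\<Sum>v\<in>B. Im (v $ k) * Re (v $ l)) * (sqrt (w k) * sqrt (w l)) = axis k \<i> \<bullet> (axis l 1 :: 'm cvec)"
      unfolding par[of "axis k 1" "axis l 1"] par[of "axis k \<i>" "axis l \<i>"]
        par[of "axis k 1" "axis l \<i>"] par[of "axis k \<i>" "axis l 1"] ax sum_distrib_right
      by (auto intro!: sum.cong)
    thus "(\<Sum>v\<in>B. Re (v $ k) * Re (v $ l)) = (if k = l then 1 / w k else 0)"
      "(\<Sum>v\<in>B. Im (v $ k) * Im (v $ l)) = (if k = l then 1 / w k else 0)"
      "(\<Sum>v\<in>B. Re (v $ k) * Im (v $ l)) = 0" "(\<Sum>v\<in>B. Im (v $ k) * Re (v $ l)) = 0"
      using wk[of k] wk[of l]
      by (cases "k = l"; simp add: inner_axis_axis inner_complex_def eq_divide_eq)+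
  qed
  show "(\<Sum>v\<in>B. covec s v * cnj (covec t v)) = (if s = t then of_real (2 / w (index_of t)) else 0)"
    by (cases s; cases t)
      (auto simp: complex_eq_iff sum.distrib sum_subtractf RR II RI IR sum_negf)
qed

end

section \<open>Inner products of monomials\<close>

definition ip :: "'m cvec set \<Rightarrow> nat \<Rightarrow> 'm::finite ext \<Rightarrow> 'm ext \<Rightarrow> complex" where
  "ip B k \<alpha> \<beta> = (\<Sum>vs\<in>{vs. set vs \<subseteq> B \<and> length vs = k}. \<alpha> vs * cnj (\<beta> vs))"

lemma ip_0: "ip B 0 \<alpha> \<beta> = \<alpha> [] * cnj (\<beta> [])"
proof -
  have "{vs. set vs \<subseteq> B \<and> length vs = 0} = {[]}" by auto
  thus ?thesis by (simp add: ip_def)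
qed

lemma ip_Suc: "ip B (Suc k) \<alpha> \<beta> = (\<Sum>v\<in>B. ip B k (contract v \<alpha>) (contract v \<beta>))"
proof -
  let ?L = "{vs. set vs \<subseteq> B \<and> length vs = k}"
  have "ip B (Suc k) \<alpha> \<beta> = (\<Sum>(us, v)\<in>?L \<times> B. \<alpha> (v # us) * cnj (\<beta> (v # us)))"
    unfolding ip_def lists_length_Suc_eq
    by (subst sum.reindex) (auto simp: inj_on_def intro!: sum.cong)
  also have "\<dots> = (\<Sum>v\<in>B. \<Sum>us\<in>?L. \<alpha> (v # us) * cnj (\<beta> (v # us)))"
    unfolding sum.cartesian_product[symmetric] by (rule sum.swap)
  finally show ?thesis by (simp add: ip_def contract_def)
qed

lemma ip_linear_left:
  "ip B k (\<lambda>vs. a * \<alpha> vs - \<beta> vs) \<gamma> = a * ip B k \<alpha> \<gamma> - ip B k \<beta> \<gamma>"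
  by (simp add: ip_def algebra_simps sum_subtractf sum_distrib_left)

lemma ip_minus_right: "ip B k \<alpha> (\<lambda>vs. - \<beta> vs) = - ip B k \<alpha> \<beta>"
  by (simp add: ip_def sum_negf)

lemma ip_scale_right: "ip B k \<alpha> (\<lambda>vs. c * \<beta> vs) = cnj c * ip B k \<alpha> \<beta>"
  by (simp add: ip_def sum_distrib_left mult_ac)

lemma ip_sum_left: "ip B k (\<lambda>vs. \<Sum>i\<in>A. c i * \<alpha> i vs) \<gamma> = (\<Sum>i\<in>A. c i * ip B k (\<alpha> i) \<gamma>)"
  unfolding ip_def sum_distrib_right by (subst sum.swap) (simp add: sum_distrib_left mult_ac)

definition alternating :: "'m::finite ext \<Rightarrow> bool" where
  "alternating \<beta> \<longleftrightarrow> (\<forall>xs u v ys. \<beta> (xs @ u # v # ys) = - \<beta> (xs @ v # u # ys))"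

lemma alternating_contract: "alternating \<beta> \<Longrightarrow> alternating (contract v \<beta>)"
  unfolding alternating_def contract_def by (metis append_Cons)

lemma alternating_contract_swap: "alternating \<beta> \<Longrightarrow> contract u (contract v \<beta>) = (\<lambda>vs. - contract v (contract u \<beta>) vs)"
  unfolding alternating_def contract_def by (metis append_Nil)

lemma alternating_wedge_cov:
  assumes "alternating \<beta>" shows "alternating (wedge (cov t) \<beta>)"
  unfolding alternating_def
proof (intro allI)
  fix xs u v ys
  show "wedge (cov t) \<beta> (xs @ u # v # ys) = - wedge (cov t) \<beta> (xs @ v # u # ys)"
    using assms
  proof (induction xs arbitrary: \<beta>)
    case Nil
    show ?case by (simp add: wedge_cov_Cons alternating_contract_swap[OF Nil, of v u] wedge_minus_right)
        (simp add: contract_def)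
  next
    case (Cons x xs)
    have "\<beta> (xs @ u # v # ys) = - \<beta> (xs @ v # u # ys)"
      using Cons.prems unfolding alternating_def by blast
    thus ?case using Cons.IH[OF alternating_contract[OF Cons.prems]]
      by (simp only: append_Cons wedge_cov_Cons) simp
  qed
qed

lemma homog_alternating: "homog j \<beta> \<Longrightarrow> alternating \<beta>"
proof (induction rule: homog.induct)
  case (es ks)
  have one: "alternating ext_one" by (simp add: alternating_def ext_one_def)
  show ?case by (induction ks) (simp_all add: one alternating_wedge_cov)
next
  case (lin j \<alpha> \<beta> a b)
  show ?case unfolding alternating_def
  proof (intro allI)
    fix xs u v ys
    have "\<alpha> (xs @ u # v # ys) = - \<alpha> (xs @ v # u # ys)" "\<beta> (xs @ u # v # ys) = - \<beta> (xs @ v # u # ys)"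
      using lin.IH unfolding alternating_def by blast+
    thus "a * \<alpha> (xs @ u # v # ys) + b * \<beta> (xs @ u # v # ys) = - (a * \<alpha> (xs @ v # u # ys) + b * \<beta> (xs @ v # u # ys))"
      by simp
  qed
qed

text \<open>Exterior multiplication is adjoint to contraction. Since \<open>ip\<close> sums over all
  tuples without dividing by a factorial, the covector may sit in any of the \<open>Suc k\<close>
  slots; alternation moves it to the front, and every slot contributes the same amount.\<close>

lemma ip_wedge_cov:
  assumes B: "finite B"
  shows "alternating \<beta> \<Longrightarrow> ip B (Suc k) (wedge (cov t) \<alpha>) \<beta> =
     of_nat (Suc k) * (\<Sum>v\<in>B. covec t v * ip B k \<alpha> (contract v \<beta>))"
proof (induction k arbitrary: \<alpha> \<beta>)
  case 0
  show ?case by (simp add: ip_Suc ip_0 contract_wedge_cov mult.assoc)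
next
  case (Suc k)
  have 1: "ip B (Suc k) (wedge (cov t) (contract v \<alpha>)) (contract v \<beta>) =
      - (of_nat (Suc k) * (\<Sum>u\<in>B. covec t u * ip B k (contract v \<alpha>) (contract v (contract u \<beta>))))" for v
    by (subst Suc.IH[OF alternating_contract[OF Suc.prems]], subst alternating_contract_swap[OF Suc.prems])
      (simp add: ip_minus_right sum_negf)
  have "ip B (Suc (Suc k)) (wedge (cov t) \<alpha>) \<beta> =
      (\<Sum>v\<in>B. covec t v * ip B (Suc k) \<alpha> (contract v \<beta>)) +
      (\<Sum>v\<in>B. of_nat (Suc k) * (\<Sum>u\<in>B. covec t u * ip B k (contract v \<alpha>) (contract v (contract u \<beta>))))"
    unfolding ip_Suc[of B "Suc k"] contract_wedge_cov[of _ t] ip_linear_left 1 by (simp add: sum.distrib sum_subtractf sum_negf)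
  also have "(\<Sum>v\<in>B. of_nat (Suc k) * (\<Sum>u\<in>B. covec t u * ip B k (contract v \<alpha>) (contract v (contract u \<beta>)))) =
      of_nat (Suc k) * (\<Sum>u\<in>B. covec t u * ip B (Suc k) \<alpha> (contract u \<beta>))"
    unfolding sum_distrib_left[symmetric] ip_Suc[of B k]
    by (subst sum.swap) (simp only: sum_distrib_left)
  finally show ?case by (simp add: algebra_simps)
qed

definition hnorm :: "('m \<Rightarrow> real) \<Rightarrow> 'm + 'm \<Rightarrow> real" where
  "hnorm w t = 2 / w (index_of t)"

context
  fixes w :: "'m::finite \<Rightarrow> real"
  assumes w: "\<And>k. w k > 0"
begin

lemma ip_es:
  assumes B: "orthonormal_basis (hdiag w) B"
  shows "homog j \<beta> \<Longrightarrow> ip B (length ks) (es ks) \<beta> =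
     fact (length ks) * of_real (\<Prod>t\<leftarrow>ks. hnorm w t) * cnj (coef ks \<beta>)"
proof (induction ks arbitrary: j \<beta>)
  case Nil thus ?case by (simp add: ip_0 ext_one_def)
next
  case (Cons t ks)
  note fin = orthonormal_basis_gram(1)[OF w B]
  \<comment> \<open>\<open>J\<close> contracts with the metric dual of \<open>cov t\<close>,
    expressed in the frame; the Gram matrix identifies it with a multiple of
    \<open>iota t\<close>.\<close>
  define J where "J = (\<lambda>\<beta> vs. \<Sum>v\<in>B. cnj (covec t v) * contract v \<beta> vs)"
  have J: "J \<beta> = (\<lambda>vs. of_real (hnorm w t) * iota t \<beta> vs)" if "homog j \<beta>" for j \<beta>
    using that
  proof (induction rule: homog.induct)
    case (es ks)
    show ?case
    proof (induction ks)
      case Nil thus ?case by (simp add: J_def iota_one contract_one)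
    next
      case (Cons s ks)
      have "J (es (s # ks)) vs = of_real (hnorm w t) * iota t (es (s # ks)) vs" for vs
      proof -
        have "J (es (s # ks)) vs = (\<Sum>v\<in>B. covec s v * cnj (covec t v)) * es ks vs -
          (\<Sum>v\<in>B. cnj (covec t v) * wedge (cov s) (contract v (es ks)) vs)"
          by (simp add: J_def contract_wedge_cov right_diff_distrib sum_subtractf sum_distrib_left sum_distrib_right mult_ac)
        also have "(\<Sum>v\<in>B. cnj (covec t v) * wedge (cov s) (contract v (es ks)) vs) = wedge (cov s) (J (es ks)) vs"
          unfolding J_def by (rule wedge_sum_right[symmetric])
        also have "wedge (cov s) (J (es ks)) vs = of_real (hnorm w t) * wedge (cov s) (iota t (es ks)) vs"
          by (simp only: Cons wedge_scale_right)
        also have "(\<Sum>v\<in>B. covec s v * cnj (covec t v)) = (if s = t then of_real (hnorm w t) else 0)"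
          by (simp add: orthonormal_basis_gram(2)[OF w B] hnorm_def)
        finally show ?thesis by (auto simp: iota_wedge_cov algebra_simps)
      qed
      thus ?case by blast
    qed
  next
    case (lin j \<alpha> \<beta> a b)
    have "J (\<lambda>vs. a * \<alpha> vs + b * \<beta> vs) = (\<lambda>vs. a * J \<alpha> vs + b * J \<beta> vs)"
      by (simp add: J_def contract_def fun_eq_iff sum.distrib sum_distrib_left algebra_simps)
    thus ?case using lin.IH by (simp add: iota_linear algebra_simps)
  qed
  have "ip B (Suc (length ks)) (wedge (cov t) (es ks)) \<beta> =
      of_nat (Suc (length ks)) * (\<Sum>v\<in>B. covec t v * ip B (length ks) (es ks) (contract v \<beta>))"
    by (rule ip_wedge_cov[OF fin homog_alternating[OF Cons.prems]])
  also have "(\<Sum>v\<in>B. covec t v * ip B (length ks) (es ks) (contract v \<beta>)) = ip B (length ks) (es ks) (J \<beta>)"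
    unfolding ip_def J_def cnj_sum sum_distrib_left by (subst sum.swap) (simp add: mult_ac)
  also have "\<dots> = of_real (hnorm w t) * ip B (length ks) (es ks) (iota t \<beta>)"
    by (simp add: J[OF Cons.prems] ip_scale_right)
  also have "ip B (length ks) (es ks) (iota t \<beta>) =
      fact (length ks) * of_real (\<Prod>t\<leftarrow>ks. hnorm w t) * cnj (coef ks (iota t \<beta>))"
  proof (cases j)
    case (Suc i)
    thus ?thesis using Cons.IH homog_iota Cons.prems by blast
  next
    case 0
    have "iota t \<beta> = (\<lambda>vs. 0)" using Cons.prems
      unfolding 0 by (induction "0::nat" \<beta> rule: homog.induct) (auto simp: iota_one iota_linear)
    thus ?thesis using Cons.IH[OF homog_zero] by simp
  qed
  finally show ?case by (simp add: algebra_simps)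
qed

lemma ext_inner_es:
  assumes "homog j \<beta>"
  shows "ext_inner (hdiag w) (length ks) (es ks) \<beta> = of_real (\<Prod>t\<leftarrow>ks. hnorm w t) * cnj (coef ks \<beta>)"
proof -
  have "orthonormal_basis (hdiag w) (SOME B. orthonormal_basis (hdiag w) B)"
    by (rule someI_ex, rule ex_orthonormal_basis, rule w)
  from ip_es[OF this assms, of ks] show ?thesis
    by (simp add: ext_inner_def Let_def ip_def)
qed

end

lemma ext_inner_sum_left:
  "ext_inner h k (\<lambda>vs. \<Sum>i\<in>A. c i * \<alpha> i vs) \<gamma> = (\<Sum>i\<in>A. c i * ext_inner h k (\<alpha> i) \<gamma>)"
  unfolding ext_inner_def Let_def ip_def[symmetric] ip_sum_left sum_divide_distrib by simp

section \<open>Powers of the fundamental form and the volume form\<close>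

definition two_form :: "('m \<Rightarrow> complex) \<Rightarrow> 'm set \<Rightarrow> 'm::finite ext \<Rightarrow> 'm ext" where
  "two_form c A \<beta> = (\<lambda>vs. \<Sum>k\<in>A. c k * wedge (cov (Inl k)) (wedge (cov (Inr k)) \<beta>) vs)"

lemma two_form_comm:
  "wedge (cov (Inl k)) (wedge (cov (Inr k)) (two_form c A \<beta>)) =
   two_form c A (wedge (cov (Inl k)) (wedge (cov (Inr k)) \<beta>))"
proof -
  have comm: "wedge (cov t) (wedge (cov s) (wedge (cov u) (wedge (cov v) \<beta>))) =
     wedge (cov u) (wedge (cov v) (wedge (cov t) (wedge (cov s) \<beta>)))" for s t u v
  proof -
    have "wedge (cov s) (wedge (cov u) (wedge (cov v) \<beta>)) = wedge (cov u) (wedge (cov v) (wedge (cov s) \<beta>))" for s \<beta>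
      unfolding wedge_cov_anticomm[of s u] wedge_cov_anticomm[of s v] wedge_fun_simps by simp
    thus ?thesis by simp
  qed
  have "wedge (cov (Inl k)) (wedge (cov (Inr k)) (two_form c A \<beta>)) vs =
   two_form c A (wedge (cov (Inl k)) (wedge (cov (Inr k)) \<beta>)) vs" for vs
    unfolding two_form_def wedge_assoc[symmetric, of "cov (Inl k)" "cov (Inr k)"] wedge_sum_right
    unfolding wedge_assoc by (simp only: comm)
  thus ?thesis by blast
qed

text \<open>Binomial expansion of the power of a sum of two commuting operators. The one for
  \<open>k\<close> multiplies by dz_k \<and> dzbar_k, whose square is 0, so the expansion stops
  after the linear term.\<close>

lemma two_form_pow_insert:
  assumes "finite A" "k \<notin> A"
  shows "(two_form c (insert k A) ^^ Suc j) \<beta> = (\<lambda>vs. (two_form c A ^^ Suc j) \<beta> vs +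
     of_nat (Suc j) * c k * wedge (cov (Inl k)) (wedge (cov (Inr k)) ((two_form c A ^^ j) \<beta>)) vs)"
proof (induction j)
  case 0 thus ?case using assms by (simp add: two_form_def add.commute)
next
  case (Suc j)
  let ?a = "\<lambda>\<beta>. wedge (cov (Inl k)) (wedge (cov (Inr k)) \<beta>)" and ?T = "two_form c A"
  have ins: "two_form c (insert k A) \<gamma> vs = c k * ?a \<gamma> vs + ?T \<gamma> vs" for \<gamma> vs
    using assms by (simp add: two_form_def)
  have aa: "?a (?a \<gamma>) vs = 0" for \<gamma> vs
    unfolding wedge_cov_anticomm[of "Inr k" "Inl k"] wedge_fun_simps wedge_cov_same by simp
  have aadd: "?a (\<lambda>vs. \<gamma> vs + d * ?a \<delta> vs) vs = ?a \<gamma> vs" for \<gamma> \<delta> d vs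
    unfolding wedge_assoc[symmetric, of "cov (Inl k)" "cov (Inr k)"] wedge_add_right wedge_scale_right
    unfolding wedge_assoc aa by simp
  have Tadd: "?T (\<lambda>vs. \<gamma> vs + d * \<delta> vs) vs = ?T \<gamma> vs + d * ?T \<delta> vs" for \<gamma> \<delta> d vs
    by (simp add: two_form_def wedge_add_right[abs_def] wedge_add_right wedge_fun_simps sum.distrib sum_distrib_left algebra_simps)
  have "(two_form c (insert k A) ^^ Suc (Suc j)) \<beta> vs =
     c k * ?a ((?T ^^ Suc j) \<beta>) vs + (?T ((?T ^^ Suc j) \<beta>) vs + of_nat (Suc j) * c k * ?T (?a ((?T ^^ j) \<beta>)) vs)" for vs
    by (subst funpow.simps, subst o_apply, subst ins, subst (1 2) Suc, subst aadd, subst Tadd) simp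
  moreover have "?T (?a ((?T ^^ j) \<beta>)) = ?a ((?T ^^ Suc j) \<beta>)"
    by (simp add: two_form_comm)
  ultimately show ?case by (simp add: fun_eq_iff algebra_simps)
qed

text \<open>The vanishing of the next power is carried along because the induction step uses it to
  discard the first term of the expansion. One list \<open>ks\<close> serves all \<open>c\<close>,
  so the volume forms at different points are multiples of one fixed monomial.\<close>

lemma two_form_pow_card:
  assumes "finite A"
  shows "\<exists>ks. distinct ks \<and> set ks = Inl ` A \<union> Inr ` A \<and>
    (\<forall>c \<beta>. (two_form c A ^^ card A) \<beta> = (\<lambda>vs. fact (card A) * (\<Prod>k\<in>A. c k) * wedge (es ks) \<beta> vs) \<and>
     (two_form c A ^^ Suc (card A)) \<beta> = (\<lambda>vs. 0))"
  using assms
proof (induction A rule: finite_induct)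
  case empty
  show ?case by (intro exI[of _ "[]"]) (simp add: two_form_def)
next
  case (insert k A)
  then obtain ks where ks: "distinct ks" "set ks = Inl ` A \<union> Inr ` A"
    and ks': "\<forall>c \<beta>. (two_form c A ^^ card A) \<beta> = (\<lambda>vs. fact (card A) * (\<Prod>k\<in>A. c k) * wedge (es ks) \<beta> vs) \<and>
      (two_form c A ^^ Suc (card A)) \<beta> = (\<lambda>vs. 0)" by (elim exE conjE)
  note ks = ks ks'[rule_format, THEN conjunct1] ks'[rule_format, THEN conjunct2]
  have z: "(two_form c A ^^ Suc (Suc (card A))) \<beta> = (\<lambda>vs. 0)" for c \<beta>
    unfolding funpow.simps(2)[of "Suc (card A)"] o_apply ks(4) by (simp add: two_form_def wedge_fun_simps)
  have c: "card (insert k A) = Suc (card A)" using insert by simp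
  show ?case
  proof (intro exI[of _ "Inl k # Inr k # ks"] conjI allI)
    fix c \<beta>
    show "(two_form c (insert k A) ^^ card (insert k A)) \<beta> = (\<lambda>vs. fact (card (insert k A)) *
        (\<Prod>k\<in>insert k A. c k) * wedge (es (Inl k # Inr k # ks)) \<beta> vs)"
      unfolding c two_form_pow_insert[OF insert.hyps] ks(3,4) using insert.hyps
      by (simp add: wedge_fun_simps wedge_assoc mult_ac)
    show "(two_form c (insert k A) ^^ Suc (card (insert k A))) \<beta> = (\<lambda>vs. 0)"
      unfolding c two_form_pow_insert[OF insert.hyps] z ks(4) by (simp add: wedge_fun_simps)
  qed (use ks(1,2) insert.hyps in auto)
qed

text \<open>By - Im z = (\<i>/2) (z - cnj z) the fundamental form is (\<i>/2) \<Sum> w_k dz_k \<and>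
  dzbar_k.\<close>

lemma wedge_fundamental_form:
  "wedge (fundamental_form (hdiag w)) \<beta> = two_form (\<lambda>k. \<i> / 2 * of_real (w k)) UNIV \<beta>"
proof -
  have im: "- complex_of_real (Im z) = \<i> / 2 * (z - cnj z)" for z
    by (simp add: complex_eq_iff)
  have w0: "wedge (cov s) (cov t) vs = (if length vs = 2 then
      covec s (vs ! 0) * covec t (vs ! 1) - covec t (vs ! 0) * covec s (vs ! 1) else 0)" for s t :: "'a + 'a" and vs
  proof (cases vs)
    case (Cons v us)
    have "wedge (cov s) (cov t) vs = covec s v * cov t us - covec t v * cov s us"
      by (simp add: Cons wedge_cov_Cons contract_cov wedge_scale_right)
    thus ?thesis by (cases us) (auto simp: Cons cov_def algebra_simps)
  qed simp
  have "fundamental_form (hdiag w) = (\<lambda>vs. \<Sum>k\<in>UNIV. \<i> / 2 * of_real (w k) * wedge (cov (Inl k)) (cov (Inr k)) vs)"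
    unfolding fundamental_form_def w0 hdiag_def im
    by (auto simp: fun_eq_iff sum_subtractf[symmetric] sum_distrib_left algebra_simps intro!: sum.cong)
  thus ?thesis by (simp only: wedge_sum_left[abs_def] two_form_def wedge_assoc)
qed

lemma volume_form_hdiag:
  obtains ks where "distinct ks" "set ks = UNIV"
    "\<And>w::'m::finite \<Rightarrow> real. volume_form (hdiag w) = (\<lambda>vs. (\<Prod>k\<in>UNIV. \<i> / 2 * of_real (w k)) * es ks vs)"
proof -
  obtain ks where ks: "distinct ks" "set ks = Inl ` UNIV \<union> Inr ` UNIV"
    "\<And>c \<beta>. (two_form c UNIV ^^ CARD('m)) \<beta> =
      (\<lambda>vs. fact CARD('m) * (\<Prod>k\<in>UNIV. c k) * wedge (es ks) (\<beta> :: 'm ext) vs)"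
    using two_form_pow_card[OF finite[of "UNIV :: 'm set"]] by blast
  have "(wedge (fundamental_form (hdiag w)) ^^ CARD('m)) ext_one =
      (two_form (\<lambda>k. \<i> / 2 * of_real (w k)) UNIV ^^ CARD('m)) (ext_one :: 'm ext)" for w
    using wedge_fundamental_form[of w] by (metis ext)
  hence "volume_form (hdiag w) = (\<lambda>vs. (\<Prod>k\<in>UNIV. \<i> / 2 * of_real (w k)) * es ks vs)" for w :: "'m \<Rightarrow> real"
    by (simp add: volume_form_def[abs_def] ks(3))
  moreover have "set ks = UNIV" using ks(2) by (simp add: UNIV_sum)
  ultimately show ?thesis using that ks(1) by blast
qed

section \<open>The basis of type-homogeneous forms\<close>

definition lst :: "'m::{finite,linorder} set \<times> 'm set \<Rightarrow> ('m + 'm) list" where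
  "lst K = map Inl (sorted_list_of_set (fst K)) @ map Inr (sorted_list_of_set (snd K))"

definition ee :: "'m::{finite,linorder} set \<times> 'm set \<Rightarrow> 'm ext" where
  "ee K = es (lst K)"

definition idx :: "nat \<Rightarrow> nat \<Rightarrow> ('m set \<times> 'm set) set" where
  "idx p q = {I. card I = p} \<times> {J. card J = q}"

definition cpl :: "'m set \<times> 'm set \<Rightarrow> 'm set \<times> 'm set" where
  "cpl K = (- fst K, - snd K)"

definition full :: "'m set \<times> 'm set" where
  "full = (UNIV, UNIV)"

lemma lst_simps:
  "distinct (lst K)" "set (lst K) = Inl ` fst K \<union> Inr ` snd K"
  "length (lst K) = card (fst K) + card (snd K)"
  for K :: "'m::{finite,linorder} set \<times> 'm set"
  by (auto simp: lst_def distinct_map sorted_list_of_set_unique[symmetric])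

lemma set_lst_eq: "set (lst K) = set (lst L) \<longleftrightarrow> K = L"
  for K L :: "'m::{finite,linorder} set \<times> 'm set"
proof
  assume a: "set (lst K) = set (lst L)"
  have "fst K = {k. Inl k \<in> set (lst K)} \<and> snd K = {k. Inr k \<in> set (lst K)}"
    for K :: "'m set \<times> 'm set" by (auto simp: lst_simps)
  with a show "K = L" by (simp add: prod_eq_iff)
qed simp

lemma dz_dzbar_ee: "dz_dzbar I J = ee (I, J)"
proof -
  have "map (\<lambda>t. wedge (cov t)) (lst (I, J)) = map wedge (map dz (sorted_list_of_set I) @ map dzbar (sorted_list_of_set J))"
    by (simp add: lst_def cov_Inl cov_Inr)
  hence "fold (\<lambda>f. f) (rev (map (\<lambda>t. wedge (cov t)) (lst (I, J)))) ext_one =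
     fold (\<lambda>f. f) (rev (map wedge (map dz (sorted_list_of_set I) @ map dzbar (sorted_list_of_set J)))) ext_one"
    by simp
  thus ?thesis
    by (simp only: dz_dzbar_def ee_def es_def foldr_conv_fold rev_map fold_map o_def)
qed

lemma sum_dz_dzbar:
  "(\<Sum>I\<in>{I. card I = p}. \<Sum>J\<in>{J. card J = q}. f I J * dz_dzbar I J vs) =
   (\<Sum>K\<in>idx p q. f (fst K) (snd K) * ee K vs)"
  by (simp add: idx_def sum.cartesian_product case_prod_unfold dz_dzbar_ee)

lemma ext_pq_iff: "\<omega> \<in> ext_pq p q \<longleftrightarrow> (\<exists>f. \<omega> = (\<lambda>vs. \<Sum>K\<in>idx p q. f K * ee K vs))"
proof
  assume "\<omega> \<in> ext_pq p q"
  then obtain f where "\<omega> = (\<lambda>vs. \<Sum>K\<in>idx p q. f (fst K) (snd K) * ee K vs)"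
    by (auto simp: ext_pq_def sum_dz_dzbar)
  thus "\<exists>f. \<omega> = (\<lambda>vs. \<Sum>K\<in>idx p q. f K * ee K vs)"
    by (intro exI[of _ "\<lambda>K. f (fst K) (snd K)"])
next
  assume "\<exists>f. \<omega> = (\<lambda>vs. \<Sum>K\<in>idx p q. f K * ee K vs)"
  then obtain f where "\<omega> = (\<lambda>vs. \<Sum>K\<in>idx p q. f K * ee K vs)" by blast
  thus "\<omega> \<in> ext_pq p q" unfolding ext_pq_def sum_dz_dzbar by (auto intro!: exI[of _ "\<lambda>I J. f (I, J)"])
qed

lemma coef_ee: "coef (lst K) (ee L) = (if K = L then 1 else 0)"
  by (auto simp: ee_def coef_es_same lst_simps(1) set_lst_eq intro!: coef_es_diff)

lemma finite_idx [simp]: "finite (idx p q :: ('m::finite set \<times> 'm set) set)"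
  by (rule finite)

lemma coef_sum_ee: "finite A \<Longrightarrow> coef (lst K) (\<lambda>vs. \<Sum>L\<in>A. f L * ee L vs) = (if K \<in> A then f K else 0)"
  by (simp add: coef_sum coef_ee if_distrib[of "\<lambda>x. _ * x"] cong: if_cong)

lemma homog_ee: "K \<in> idx p q \<Longrightarrow> homog (p + q) (ee K)"
  unfolding ee_def by (rule homog.es) (auto simp: lst_simps idx_def)

lemma set_lst_full: "set (lst full) = UNIV"
  by (auto simp: lst_simps full_def UNIV_sum)

lemma ee_full_nonzero: "\<exists>vs::'m::{finite,linorder} cvec list. ee full vs \<noteq> 0"
proof (rule ccontr)
  assume "\<not> ?thesis"
  hence "ee full = (\<lambda>vs::'m cvec list. 0)" by auto
  hence "coef (lst full) (ee full :: 'm ext) = 0" by (simp add: coef_linear)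
  thus False by (simp add: coef_ee)
qed

lemma wedge_ee_not_disjoint:
  assumes "fst K \<inter> fst L \<noteq> {} \<or> snd K \<inter> snd L \<noteq> {}"
  shows "wedge (ee K) (ee L) = (\<lambda>vs. 0)"
  unfolding ee_def es_append[symmetric]
  by (rule es_not_distinct) (use assms in \<open>auto simp: lst_simps\<close>)

lemma wedge_ee_disjoint:
  assumes "fst K \<inter> fst L = {}" "snd K \<inter> snd L = {}"
  shows "\<exists>s\<in>{1, -1}. wedge (ee K) (ee L) = (\<lambda>vs. s * ee (fst K \<union> fst L, snd K \<union> snd L) vs)"
  unfolding ee_def es_append[symmetric]
  by (rule es_perm) (use assms in \<open>auto simp: lst_simps\<close>)

text \<open>Fixed by choice instead of by a count of transpositions; what counts is that it is
  \<plusminus>1.\<close>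

definition cpl_sign :: "'m::{finite,linorder} set \<times> 'm set \<Rightarrow> complex" where
  "cpl_sign K = (SOME s. s \<in> {1, -1} \<and> wedge (ee K) (ee (cpl K)) = (\<lambda>vs. s * ee full vs))"

lemma cpl_sign: "cpl_sign K \<in> {1, -1}" "wedge (ee K) (ee (cpl K)) = (\<lambda>vs. cpl_sign K * ee full vs)"
proof -
  have "fst K \<union> fst (cpl K) = UNIV" "snd K \<union> snd (cpl K) = UNIV" by (auto simp: cpl_def)
  hence "\<exists>s. s \<in> {1, -1} \<and> wedge (ee K) (ee (cpl K)) = (\<lambda>vs. s * ee full vs)"
    using wedge_ee_disjoint[of K "cpl K"] by (auto simp: cpl_def full_def)
  from someI_ex[OF this, folded cpl_sign_def]
  show "cpl_sign K \<in> {1, -1}" "wedge (ee K) (ee (cpl K)) = (\<lambda>vs. cpl_sign K * ee full vs)"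
    by (rule conjunct1, rule conjunct2)
qed

lemma cpl_sign_square: "cpl_sign K * cpl_sign K = 1"
  using cpl_sign(1)[of K] by auto

text \<open>If K and L differ but have the same type, some component of K is not contained in that
  of L; then K meets the complement of L and a covector is repeated. Thus complementary monomials
  form a dual basis up to sign.\<close>

lemma wedge_ee_cpl:
  fixes K L :: "'m::{finite,linorder} set \<times> 'm set"
  assumes "K \<in> idx p q" "L \<in> idx p q"
  shows "wedge (ee K) (ee (cpl L)) = (\<lambda>vs. (if K = L then cpl_sign K else 0) * ee full vs)"
proof (cases "K = L")
  case False
  have "fst K \<inter> - fst L \<noteq> {} \<or> snd K \<inter> - snd L \<noteq> {}"
  proof (rule ccontr)
    assume "\<not> ?thesis"
    hence "fst K \<subseteq> fst L" "snd K \<subseteq> snd L" by auto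
    moreover have "card (fst K) = card (fst L)" "card (snd K) = card (snd L)"
      using assms by (auto simp: idx_def)
    ultimately have "fst K = fst L" "snd K = snd L" using card_subset_eq finite by metis+
    thus False using False by (simp add: prod_eq_iff)
  qed
  thus ?thesis using False wedge_ee_not_disjoint[of K "cpl L"] by (simp add: cpl_def)
qed (simp add: cpl_sign)

lemma wedge_sum_ee_cpl:
  "wedge (\<lambda>vs. \<Sum>K\<in>idx p q. f K * ee K vs) (\<lambda>vs. \<Sum>K\<in>idx p q. g K * ee (cpl K) vs) vs =
   (\<Sum>K\<in>idx p q. f K * g K * cpl_sign K) * ee full vs"
proof -
  have "wedge (\<lambda>vs. \<Sum>K\<in>idx p q. f K * ee K vs) (\<lambda>vs. \<Sum>K\<in>idx p q. g K * ee (cpl K) vs) vs =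
     (\<Sum>K\<in>idx p q. \<Sum>L\<in>idx p q. f K * (g L * ((if K = L then cpl_sign K else 0) * ee full vs)))"
    by (simp add: wedge_sum_left wedge_sum_right wedge_ee_cpl sum_distrib_left cong: sum.cong)
  also have "\<dots> = (\<Sum>K\<in>idx p q. f K * g K * cpl_sign K * ee full vs)"
    by (rule sum.cong[OF refl]) (simp add: if_distrib[of "\<lambda>x. x * _"] if_distrib[of "\<lambda>x. _ * x"] cong: if_cong)
  finally show ?thesis by (simp add: sum_distrib_right)
qed

lemma bij_cpl:
  assumes "p \<le> CARD('m::finite)" "q \<le> CARD('m)"
  shows "bij_betw cpl (idx p q) (idx (CARD('m) - p) (CARD('m) - q) :: ('m set \<times> 'm set) set)"
proof (rule bij_betw_byWitness[where f' = cpl])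
  have c: "card (- A) = CARD('m) - card A" for A :: "'m set"
    by (simp add: Compl_eq_Diff_UNIV card_Diff_subset)
  show "cpl ` idx p q \<subseteq> (idx (CARD('m) - p) (CARD('m) - q) :: ('m set \<times> 'm set) set)"
    by (auto simp: cpl_def idx_def c)
  show "cpl ` idx (CARD('m) - p) (CARD('m) - q) \<subseteq> (idx p q :: ('m set \<times> 'm set) set)"
    using assms by (auto simp: cpl_def idx_def c)
qed (auto simp: cpl_def)

section \<open>The Hodge star in the monomial basis\<close>

lemma volume_form_full:
  obtains C where "C \<noteq> 0"
    "\<And>w::'m::{finite,linorder} \<Rightarrow> real. volume_form (hdiag w) = (\<lambda>vs. C * of_real (\<Prod>k\<in>UNIV. w k) * ee full vs)"
proof -
  obtain ks where ks: "distinct ks" "set ks = UNIV"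
    "\<And>w::'m \<Rightarrow> real. volume_form (hdiag w) = (\<lambda>vs. (\<Prod>k\<in>UNIV. \<i> / 2 * of_real (w k)) * es ks vs)"
    by (rule volume_form_hdiag) blast
  obtain s where s: "s \<in> {1, -1}" "es ks = (\<lambda>vs. s * ee full vs)"
    using es_perm[of "lst full" ks] ks(1,2) lst_simps(1) set_lst_full unfolding ee_def by metis
  show ?thesis
  proof (rule that)
    show "(\<i> / 2) ^ CARD('m) * s \<noteq> 0" using s(1) by auto
    fix w :: "'m \<Rightarrow> real"
    show "volume_form (hdiag w) = (\<lambda>vs. (\<i> / 2) ^ CARD('m) * s * of_real (\<Prod>k\<in>UNIV. w k) * ee full vs)"
      unfolding ks(3) s(2) prod.distrib by (simp add: mult_ac)
  qed
qed

definition pnorm :: "('m \<Rightarrow> real) \<Rightarrow> 'm::{finite,linorder} set \<times> 'm set \<Rightarrow> real" where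
  "pnorm w K = (\<Prod>t\<leftarrow>lst K. hnorm w t)"

text \<open>Complementary monomials are dual to those of type (p, q), so the defining equation
  determines every coefficient. The conjugate comes from the antilinearity of
  \<open>ext_inner\<close> in its second argument, and the sign can be moved to the other side
  because it squares to 1.\<close>

lemma hodge_star_hdiag:
  fixes w :: "'m::{finite,linorder} \<Rightarrow> real"
  assumes w: "\<And>k. w k > 0" and pq: "p \<le> CARD('m)" "q \<le> CARD('m)"
    and V: "volume_form (hdiag w) = (\<lambda>vs. V * ee full vs)" "V \<noteq> 0"
  shows "hodge_star (hdiag w) p q (\<lambda>vs. \<Sum>K\<in>idx p q. f K * ee K vs) =
    (\<lambda>vs. \<Sum>K\<in>idx p q. cnj (f K) * of_real (pnorm w K) * cpl_sign K * V * ee (cpl K) vs)"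
proof -
  let ?\<beta> = "\<lambda>vs. \<Sum>K\<in>idx p q. f K * ee K vs"
  let ?\<gamma> = "\<lambda>vs. \<Sum>K\<in>idx p q. cnj (f K) * of_real (pnorm w K) * cpl_sign K * V * ee (cpl K) vs"
  have star_sum: "\<gamma> \<in> ext_pq (CARD('m) - p) (CARD('m) - q) \<longleftrightarrow>
      (\<exists>g. \<gamma> = (\<lambda>vs. \<Sum>K\<in>idx p q. g K * ee (cpl K) vs))" for \<gamma> :: "'m ext"
  proof -
    have "(\<Sum>K\<in>idx (CARD('m) - p) (CARD('m) - q). g K * ee K vs) =
       (\<Sum>K\<in>idx p q. g (cpl K) * ee (cpl K) vs)" for g and vs :: "'m cvec list"
      by (rule sum.reindex_bij_betw[OF bij_cpl[OF pq], symmetric])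
    note re = this
    have cc: "cpl (cpl K) = K" for K :: "'m set \<times> 'm set" by (simp add: cpl_def)
    show ?thesis unfolding ext_pq_iff
    proof (intro iffI; elim exE)
      fix g assume "\<gamma> = (\<lambda>vs. \<Sum>K\<in>idx (CARD('m) - p) (CARD('m) - q). g K * ee K vs)"
      thus "\<exists>g. \<gamma> = (\<lambda>vs. \<Sum>K\<in>idx p q. g K * ee (cpl K) vs)"
        unfolding re by (intro exI[of _ "\<lambda>K. g (cpl K)"])
    next
      fix g assume "\<gamma> = (\<lambda>vs. \<Sum>K\<in>idx p q. g K * ee (cpl K) vs)"
      thus "\<exists>g. \<gamma> = (\<lambda>vs. \<Sum>K\<in>idx (CARD('m) - p) (CARD('m) - q). g K * ee K vs)"
        unfolding re by (intro exI[of _ "\<lambda>K. g (cpl K)"]) (simp add: cc)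
    qed
  qed
  have inner: "ext_inner (hdiag w) (p + q) (\<lambda>vs. \<Sum>K\<in>idx p q. a K * ee K vs) ?\<beta> =
     (\<Sum>K\<in>idx p q. a K * (of_real (pnorm w K) * cnj (f K)))" for a
  proof -
    have h: "homog (p + q) ?\<beta>" by (intro homog_sum homog_scale homog_ee)
    have "ext_inner (hdiag w) (p + q) (ee K) ?\<beta> = of_real (pnorm w K) * cnj (f K)" if "K \<in> idx p q" for K
      using ext_inner_es[OF w h, where ks = "lst K"] that
      by (simp add: ee_def[of K, symmetric] pnorm_def coef_sum_ee) (simp add: lst_simps idx_def mem_Times_iff)
    thus ?thesis by (simp add: ext_inner_sum_left)
  qed
  have ex: "wedge \<alpha> ?\<gamma> = (\<lambda>vs. ext_inner (hdiag w) (p + q) \<alpha> ?\<beta> * volume_form (hdiag w) vs)"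
    if "\<alpha> \<in> ext_pq p q" for \<alpha>
  proof -
    from that obtain a where a: "\<alpha> = (\<lambda>vs. \<Sum>K\<in>idx p q. a K * ee K vs)" by (auto simp: ext_pq_iff)
    have eq: "a K * (cnj (f K) * of_real (pnorm w K) * cpl_sign K * V) * cpl_sign K = a K * (of_real (pnorm w K) * cnj (f K)) * V" for K
      using cpl_sign_square[of K] by (simp add: algebra_simps)
    show ?thesis unfolding a inner V(1)
      unfolding wedge_sum_ee_cpl eq by (simp add: sum_distrib_right mult.assoc)
  qed
  show ?thesis unfolding hodge_star_def
  proof (rule the_equality)
    show "?\<gamma> \<in> ext_pq (CARD('m) - p) (CARD('m) - q) \<and> (\<forall>\<alpha>\<in>ext_pq p q. wedge \<alpha> ?\<gamma> =
        (\<lambda>vs. ext_inner (hdiag w) (p + q) \<alpha> ?\<beta> * volume_form (hdiag w) vs))"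
    proof (intro conjI ballI)
      show "?\<gamma> \<in> ext_pq (CARD('m) - p) (CARD('m) - q)" unfolding star_sum
        by (intro exI[of _ "\<lambda>K. cnj (f K) * of_real (pnorm w K) * cpl_sign K * V"]) (rule refl)
    qed (rule ex)
    fix \<gamma> assume \<gamma>: "\<gamma> \<in> ext_pq (CARD('m) - p) (CARD('m) - q) \<and> (\<forall>\<alpha>\<in>ext_pq p q. wedge \<alpha> \<gamma> =
        (\<lambda>vs. ext_inner (hdiag w) (p + q) \<alpha> ?\<beta> * volume_form (hdiag w) vs))"
    then obtain g where g: "\<gamma> = (\<lambda>vs. \<Sum>K\<in>idx p q. g K * ee (cpl K) vs)"
      using star_sum[THEN iffD1, OF conjunct1[OF \<gamma>]] by (elim exE)
    have "g K = cnj (f K) * of_real (pnorm w K) * cpl_sign K * V" if K: "K \<in> idx p q" for K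
    proof -
      \<comment> \<open>Testing against the single monomial \<open>ee K\<close> isolates
        \<open>g K\<close>; this gives uniqueness.\<close>
      let ?a = "\<lambda>L. if L = K then 1 else (0::complex)"
      let ?\<alpha> = "\<lambda>vs. \<Sum>L\<in>idx p q. ?a L * ee L vs"
      have "?\<alpha> \<in> ext_pq p q" by (auto simp: ext_pq_iff)
      hence eq: "wedge ?\<alpha> \<gamma> vs = wedge ?\<alpha> ?\<gamma> vs" for vs using \<gamma> ex[of ?\<alpha>] by simp
      obtain vs :: "'m cvec list" where vs: "ee full vs \<noteq> 0" using ee_full_nonzero by blast
      have "(\<Sum>L\<in>idx p q. ?a L * g L * cpl_sign L) =
         (\<Sum>L\<in>idx p q. ?a L * (cnj (f L) * of_real (pnorm w L) * cpl_sign L * V) * cpl_sign L)"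
        using eq[of vs] unfolding g wedge_sum_ee_cpl mult_right_cancel[OF vs] .
      hence "g K * cpl_sign K = (cnj (f K) * of_real (pnorm w K) * cpl_sign K * V) * cpl_sign K"
        using K by (simp add: if_distrib[of "\<lambda>x. x * _"] cong: if_cong)
      thus ?thesis using cpl_sign(1)[of K] by auto
    qed
    thus "\<gamma> = ?\<gamma>" unfolding g by (simp cong: sum.cong)
  qed
qed

section \<open>Smooth functions and Wirtinger derivatives\<close>

definition dir_deriv :: "'a::real_normed_vector \<Rightarrow> ('a \<Rightarrow> complex) \<Rightarrow> 'a \<Rightarrow> complex" where
  "dir_deriv v f x = frechet_derivative f (at x) v"

lemma dir_deriv_eqI: "(f has_derivative D) (at x) \<Longrightarrow> dir_deriv v f x = D v"
  by (metis dir_deriv_def frechet_derivative_at)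

lemma Ck_on_Suc: "Ck_on (Suc k) V f \<longleftrightarrow> (\<forall>x\<in>V. f differentiable (at x)) \<and> (\<forall>v. Ck_on k V (dir_deriv v f))"
  by (simp add: dir_deriv_def[abs_def])

declare Ck_on.simps(2) [simp del]

lemma dir_deriv_cong_open:
  assumes "open V" "x \<in> V" "\<And>y. y \<in> V \<Longrightarrow> f y = g y"
  shows "f differentiable (at x) \<longleftrightarrow> g differentiable (at x)" "dir_deriv v f x = dir_deriv v g x"
proof -
  have *: "(f has_derivative D) (at x) \<longleftrightarrow> (g has_derivative D) (at x)" for D
    using has_derivative_transform_within_open[OF _ assms(1,2), of f D UNIV g]
      has_derivative_transform_within_open[OF _ assms(1,2), of g D UNIV f] assms(3) by auto
  show "f differentiable (at x) \<longleftrightarrow> g differentiable (at x)" by (simp add: differentiable_def *)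
  show "dir_deriv v f x = dir_deriv v g x" by (simp add: dir_deriv_def frechet_derivative_def *)
qed

lemma Ck_on_cong: "open V \<Longrightarrow> (\<And>x. x \<in> V \<Longrightarrow> f x = g x) \<Longrightarrow> Ck_on k V f \<Longrightarrow> Ck_on k V g"
proof (induction k arbitrary: f g)
  case 0 thus ?case using continuous_on_cong by force
next
  case (Suc k)
  show ?case unfolding Ck_on_Suc
  proof (intro conjI ballI allI)
    fix x assume "x \<in> V"
    thus "g differentiable (at x)" using Suc.prems dir_deriv_cong_open(1)[OF Suc.prems(1), of x f g] by (auto simp: Ck_on_Suc)
  next
    fix v
    show "Ck_on k V (dir_deriv v g)"
      by (rule Suc.IH[of "dir_deriv v f"]) (use Suc.prems dir_deriv_cong_open(2)[OF Suc.prems(1), of _ f g] in \<open>auto simp: Ck_on_Suc\<close>)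
  qed
qed

lemma Ck_on_subset: "Ck_on k V f \<Longrightarrow> W \<subseteq> V \<Longrightarrow> Ck_on k W f"
  by (induction k arbitrary: f) (auto simp: Ck_on_Suc simp del: Ck_on.simps(2) intro: continuous_on_subset)

text \<open>Coefficients of a form on the quotient are known to be smooth only on single chart
  images; this glues them.\<close>

lemma Ck_on_local: "(\<And>x. x \<in> V \<Longrightarrow> \<exists>U. open U \<and> x \<in> U \<and> Ck_on k U f) \<Longrightarrow> Ck_on k V f"
proof (induction k arbitrary: f)
  case 0
  have "isCont f x" if "x \<in> V" for x
    using 0[OF that] by (auto simp: continuous_on_eq_continuous_at)
  thus ?case by (simp add: continuous_at_imp_continuous_on)
next
  case (Suc k)
  show ?case unfolding Ck_on_Suc
  proof (intro conjI ballI allI)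
    fix x assume "x \<in> V"
    thus "f differentiable (at x)" using Suc.prems by (metis Ck_on_Suc)
  next
    fix v show "Ck_on k V (dir_deriv v f)"
      by (rule Suc.IH) (use Suc.prems in \<open>metis Ck_on_Suc\<close>)
  qed
qed

lemma Ck_on_pred: "Ck_on (Suc k) V f \<Longrightarrow> Ck_on k V f"
proof (induction k arbitrary: f)
  case 0 thus ?case
    by (auto simp: Ck_on_Suc intro!: continuous_at_imp_continuous_on differentiable_imp_continuous_within)
next
  case (Suc k) thus ?case unfolding Ck_on_Suc[of "Suc k"] by (auto simp: Ck_on_Suc)
qed

lemma differentiable_dir_deriv: "f differentiable (at x) \<Longrightarrow> (f has_derivative (\<lambda>v. dir_deriv v f x)) (at x)"
  by (simp add: dir_deriv_def frechet_derivative_works[symmetric])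

lemma Ck_lin: "Ck_on k UNIV f \<Longrightarrow> Ck_on k UNIV g \<Longrightarrow> Ck_on k UNIV (\<lambda>x. a * f x + b * g x)"
proof (induction k arbitrary: f g)
  case 0 thus ?case by (simp add: continuous_intros)
next
  case (Suc k)
  have d: "((\<lambda>x. a * f x + b * g x) has_derivative (\<lambda>v. a * dir_deriv v f x + b * dir_deriv v g x)) (at x)" for x
    using Suc.prems by (auto simp: Ck_on_Suc intro!: derivative_eq_intros differentiable_dir_deriv)
  have "dir_deriv v (\<lambda>x. a * f x + b * g x) = (\<lambda>x. a * dir_deriv v f x + b * dir_deriv v g x)" for v
    by (rule ext) (rule dir_deriv_eqI[OF d])
  thus ?case using Suc differentiableI[OF d] by (auto simp: Ck_on_Suc)
qed

lemma Ck_mult: "Ck_on k UNIV f \<Longrightarrow> Ck_on k UNIV g \<Longrightarrow> Ck_on k UNIV (\<lambda>x. f x * g x)"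
proof (induction k arbitrary: f g)
  case 0 thus ?case by (simp add: continuous_intros)
next
  case (Suc k)
  \<comment> \<open>The factors 1 give the derivative the shape of \<open>Ck_lin\<close>.\<close>
  have d: "((\<lambda>x. f x * g x) has_derivative (\<lambda>v. 1 * (f x * dir_deriv v g x) + 1 * (dir_deriv v f x * g x))) (at x)" for x
    using Suc.prems by (auto simp: Ck_on_Suc intro!: derivative_eq_intros differentiable_dir_deriv)
  have eq: "dir_deriv v (\<lambda>x. f x * g x) = (\<lambda>x. 1 * (f x * dir_deriv v g x) + 1 * (dir_deriv v f x * g x))" for v
    by (rule ext) (rule dir_deriv_eqI[OF d])
  have "Ck_on k UNIV f" "Ck_on k UNIV g" using Suc.prems by (auto intro: Ck_on_pred)
  moreover have "Ck_on k UNIV (dir_deriv v f)" "Ck_on k UNIV (dir_deriv v g)" for v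
    using Suc.prems by (auto simp: Ck_on_Suc)
  ultimately have "Ck_on k UNIV (\<lambda>x. 1 * (f x * dir_deriv v g x) + 1 * (dir_deriv v f x * g x))" for v
    by (intro Ck_lin Suc.IH)
  thus ?case using differentiableI[OF d] eq by (simp add: Ck_on_Suc)
qed

lemma Ck_cnj: "Ck_on k UNIV f \<Longrightarrow> Ck_on k UNIV (\<lambda>x. cnj (f x))"
proof (induction k arbitrary: f)
  case 0 thus ?case by (simp add: continuous_intros)
next
  case (Suc k)
  have d: "((\<lambda>x. cnj (f x)) has_derivative (\<lambda>v. cnj (dir_deriv v f x))) (at x)" for x
    using Suc.prems
    by (auto simp: Ck_on_Suc intro!: bounded_linear.has_derivative[OF bounded_linear_cnj] differentiable_dir_deriv)
  have "dir_deriv v (\<lambda>x. cnj (f x)) = (\<lambda>x. cnj (dir_deriv v f x))" for v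
    by (rule ext) (rule dir_deriv_eqI[OF d])
  thus ?case using Suc differentiableI[OF d] by (auto simp: Ck_on_Suc)
qed

lemma dir_deriv_const: "dir_deriv v (\<lambda>x. c) = (\<lambda>x. 0)"
  by (rule ext) (rule dir_deriv_eqI[OF has_derivative_const])

lemma Ck_const: "Ck_on k UNIV (\<lambda>x. c)"
  by (induction k arbitrary: c) (auto simp: Ck_on_Suc dir_deriv_const)

lemma Ck_exp_Re: "Ck_on k UNIV (\<lambda>x::'m::finite cvec. complex_of_real (exp (c * Re (x $ j))))"
proof (induction k)
  case 0 show ?case by (auto intro!: continuous_intros)
next
  case (Suc k)
  let ?f = "\<lambda>x::'m cvec. complex_of_real (exp (c * Re (x $ j)))"

  have d: "(?f has_derivative (\<lambda>v. of_real (c * Re (v $ j)) * ?f x)) (at x)" for x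
    by (rule has_derivative_of_real[THEN has_derivative_eq_rhs])
      (auto intro!: derivative_eq_intros bounded_linear_imp_has_derivative[OF bounded_linear_vec_nth])
  have "dir_deriv v ?f = (\<lambda>x. of_real (c * Re (v $ j)) * ?f x)" for v
    by (rule ext) (rule dir_deriv_eqI[OF d])
  moreover have "Ck_on k UNIV (\<lambda>x. of_real (c * Re (v $ j)) * ?f x)" for v
    by (rule Ck_mult[OF Ck_const Suc])
  ultimately show ?case using differentiableI[OF d] by (auto simp: Ck_on_Suc)
qed

section \<open>Functions smooth on the whole space\<close>

definition smooth :: "('a::real_normed_vector \<Rightarrow> complex) \<Rightarrow> bool" where
  "smooth f \<longleftrightarrow> smooth_fun_on UNIV f"

lemma smooth_simps:
  "smooth f \<Longrightarrow> smooth g \<Longrightarrow> smooth (\<lambda>x. a * f x + b * g x)"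
  "smooth f \<Longrightarrow> smooth g \<Longrightarrow> smooth (\<lambda>x. f x * g x)"
  "smooth f \<Longrightarrow> smooth (\<lambda>x. cnj (f x))" "smooth (\<lambda>x. c)"
  by (simp_all add: smooth_def smooth_fun_on_def Ck_lin Ck_mult Ck_cnj Ck_const)

lemma smooth_exp_Re: "smooth (\<lambda>x::'m::finite cvec. complex_of_real (exp (c * Re (x $ j))))"
  by (simp only: smooth_def smooth_fun_on_def Ck_exp_Re) simp

lemma smooth_sum: "(\<And>i. i \<in> A \<Longrightarrow> smooth (f i)) \<Longrightarrow> smooth (\<lambda>x. \<Sum>i\<in>A. f i x)"
  by (induction A rule: infinite_finite_induct)
    (use smooth_simps(1)[of _ _ 1 1] smooth_simps(4) in auto)

lemma smooth_differentiable: "smooth f \<Longrightarrow> f differentiable (at x)"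
  unfolding smooth_def smooth_fun_on_def using Ck_on_Suc[of 0 UNIV f] by blast

lemma smooth_has_derivative: "smooth f \<Longrightarrow> (f has_derivative (\<lambda>v. dir_deriv v f x)) (at x)"
  by (intro differentiable_dir_deriv smooth_differentiable)

lemma smooth_dir_deriv: "smooth f \<Longrightarrow> smooth (dir_deriv v f)"
  unfolding smooth_def smooth_fun_on_def using Ck_on_Suc[of _ UNIV f] by blast

lemma smooth_continuous: "smooth f \<Longrightarrow> continuous_on A f"
  unfolding smooth_def smooth_fun_on_def by (metis Ck_on.simps(1) continuous_on_subset top_greatest)

lemma smooth_fun_on_smooth: "smooth f \<Longrightarrow> smooth_fun_on V f"
  unfolding smooth_def smooth_fun_on_def by (metis Ck_on_subset top_greatest)

lemma dir_deriv_linear: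
  assumes "f differentiable (at x)"
  shows "linear (\<lambda>v. dir_deriv v f x)"
  using differentiable_dir_deriv[OF assms] has_derivative_bounded_linear bounded_linear.linear by blast

section \<open>Wirtinger derivatives and coordinate formulas for \<open>del\<close> and
  \<open>delbar\<close>\<close>

definition wirtinger_deriv :: "'m + 'm \<Rightarrow> ('m::finite cvec \<Rightarrow> complex) \<Rightarrow> 'm cvec \<Rightarrow> complex" where
  "wirtinger_deriv t f x = (case t of
      Inl k \<Rightarrow> (dir_deriv (axis k 1) f x - \<i> * dir_deriv (axis k \<i>) f x) / 2
    | Inr k \<Rightarrow> (dir_deriv (axis k 1) f x + \<i> * dir_deriv (axis k \<i>) f x) / 2)"

lemma real_linear_expand:
  fixes D :: "'m::finite cvec \<Rightarrow> complex"
  assumes "linear D"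
  shows "D v = (\<Sum>k\<in>UNIV. of_real (Re (v $ k)) * D (axis k 1) + of_real (Im (v $ k)) * D (axis k \<i>))"
proof -
  have v: "v = (\<Sum>k\<in>UNIV. Re (v $ k) *\<^sub>R axis k 1 + Im (v $ k) *\<^sub>R axis k \<i>)"
  proof -
    have "(Re (v $ k) *\<^sub>R axis k 1 + Im (v $ k) *\<^sub>R axis k \<i>) $ j = (if k = j then v $ k else 0)" for k j
      by (auto simp: axis_def complex_eq_iff)
    thus ?thesis by (simp add: vec_eq_iff sum_component del: vector_add_component)
  qed
  show ?thesis
    by (subst v) (simp add: linear_sum[OF assms] linear_add[OF assms] linear_scale[OF assms],
        simp add: scaleR_conv_of_real)
qed

lemma wirtinger_expand:
  assumes "f differentiable (at x)"
  shows "wirtinger f x v = (\<Sum>k\<in>UNIV. covec (Inl k) v * wirtinger_deriv (Inl k) f x)"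
    "wirtinger_bar f x v = (\<Sum>k\<in>UNIV. covec (Inr k) v * wirtinger_deriv (Inr k) f x)"
proof -
  note e = real_linear_expand[OF dir_deriv_linear[OF assms]]
  have z: "of_real (Re z) = (z + cnj z) / 2" "of_real (Im z) = - \<i> * (z - cnj z) / 2" for z
    by (simp_all add: complex_eq_iff)
  show "wirtinger f x v = (\<Sum>k\<in>UNIV. covec (Inl k) v * wirtinger_deriv (Inl k) f x)"
    unfolding wirtinger_def dir_deriv_def[symmetric] e[of v] e[of "\<i> *s v"] wirtinger_deriv_def sum_distrib_left
      sum_subtractf[symmetric] sum_divide_distrib
    by (rule sum.cong[OF refl]) (simp add: z algebra_simps add_divide_distrib diff_divide_distrib)
  show "wirtinger_bar f x v = (\<Sum>k\<in>UNIV. covec (Inr k) v * wirtinger_deriv (Inr k) f x)"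
    unfolding wirtinger_bar_def dir_deriv_def[symmetric] e[of v] e[of "\<i> *s v"] wirtinger_deriv_def sum_distrib_left
      sum.distrib[symmetric] sum_divide_distrib
    by (rule sum.cong[OF refl]) (simp add: z algebra_simps add_divide_distrib diff_divide_distrib)
qed

text \<open>The forms \<open>\<beta> K\<close> are constant, so every derivative falls on a
  coefficient and the alternating sum becomes exterior multiplication by a covector. The expansion
  is assumed only on an open set, since local expressions are junk off the chart image.\<close>

lemma del_expand:
  fixes \<omega> :: "'m::finite cvec \<Rightarrow> 'm ext"
  assumes V: "open V" "x \<in> V" and A: "finite A"
    and \<omega>: "\<And>y vs. y \<in> V \<Longrightarrow> \<omega> y vs = (\<Sum>K\<in>A. f K y * \<beta> K vs)"
    and f: "\<And>K. K \<in> A \<Longrightarrow> f K differentiable (at x)"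
  shows "del \<omega> x vs = (\<Sum>k\<in>UNIV. \<Sum>K\<in>A. wirtinger_deriv (Inl k) (f K) x * wedge (cov (Inl k)) (\<beta> K) vs)"
    "delbar \<omega> x vs = (\<Sum>k\<in>UNIV. \<Sum>K\<in>A. wirtinger_deriv (Inr k) (f K) x * wedge (cov (Inr k)) (\<beta> K) vs)"
proof -
  have d: "((\<lambda>y. \<omega> y us) has_derivative (\<lambda>v. \<Sum>K\<in>A. dir_deriv v (f K) x * \<beta> K us)) (at x)" for us
  proof (rule has_derivative_transform_within_open[OF _ V])
    show "((\<lambda>y. \<Sum>K\<in>A. f K y * \<beta> K us) has_derivative (\<lambda>v. \<Sum>K\<in>A. dir_deriv v (f K) x * \<beta> K us)) (at x)"
      by (intro has_derivative_sum has_derivative_mult_left differentiable_dir_deriv f)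
  qed (simp add: \<omega>)
  have D: "frechet_derivative (\<lambda>y. \<omega> y us) (at x) = (\<lambda>v. \<Sum>K\<in>A. dir_deriv v (f K) x * \<beta> K us)" for us
    by (rule frechet_derivative_at[OF d, symmetric])
  have 1: "wirtinger (\<lambda>y. \<omega> y us) x v = (\<Sum>K\<in>A. (\<Sum>k\<in>UNIV. covec (Inl k) v * wirtinger_deriv (Inl k) (f K) x) * \<beta> K us)" for us v
  proof -
    have "wirtinger (\<lambda>y. \<omega> y us) x v = (\<Sum>K\<in>A. wirtinger (f K) x v * \<beta> K us)"
      by (simp add: wirtinger_def D dir_deriv_def sum_distrib_left sum_divide_distrib algebra_simps
          add_divide_distrib diff_divide_distrib sum.distrib sum_subtractf)
    thus ?thesis by (simp add: wirtinger_expand(1) f)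
  qed
  have 2: "wirtinger_bar (\<lambda>y. \<omega> y us) x v = (\<Sum>K\<in>A. (\<Sum>k\<in>UNIV. covec (Inr k) v * wirtinger_deriv (Inr k) (f K) x) * \<beta> K us)" for us v
  proof -
    have "wirtinger_bar (\<lambda>y. \<omega> y us) x v = (\<Sum>K\<in>A. wirtinger_bar (f K) x v * \<beta> K us)"
      by (simp add: wirtinger_bar_def D dir_deriv_def sum_distrib_left sum_divide_distrib algebra_simps
          add_divide_distrib diff_divide_distrib sum.distrib sum_subtractf)
    thus ?thesis by (simp add: wirtinger_expand(2) f)
  qed
  have gen: "(\<Sum>i<length vs. (-1) ^ i * (\<Sum>K\<in>A. (\<Sum>k\<in>UNIV. covec (t k) (vs ! i) * wirtinger_deriv (t k) (f K) x) *
        \<beta> K (take i vs @ drop (Suc i) vs))) =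
      (\<Sum>k\<in>UNIV. \<Sum>K\<in>A. wirtinger_deriv (t k) (f K) x * wedge (cov (t k)) (\<beta> K) vs)" for t :: "'m \<Rightarrow> 'm + 'm"
  proof -
    have "(\<Sum>i<length vs. (-1) ^ i * (\<Sum>K\<in>A. (\<Sum>k\<in>UNIV. covec (t k) (vs ! i) * wirtinger_deriv (t k) (f K) x) *
        \<beta> K (take i vs @ drop (Suc i) vs))) =
      (\<Sum>i<length vs. \<Sum>K\<in>A. \<Sum>k\<in>UNIV. wirtinger_deriv (t k) (f K) x *
        ((-1) ^ i * covec (t k) (vs ! i) * \<beta> K (take i vs @ drop (Suc i) vs)))"
      by (simp add: sum_distrib_left sum_distrib_right mult_ac)
    also have "\<dots> = (\<Sum>K\<in>A. \<Sum>k\<in>UNIV. \<Sum>i<length vs. wirtinger_deriv (t k) (f K) x *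
        ((-1) ^ i * covec (t k) (vs ! i) * \<beta> K (take i vs @ drop (Suc i) vs)))"
      by (subst sum.swap) (intro sum.cong refl sum.swap)
    also have "\<dots> = (\<Sum>K\<in>A. \<Sum>k\<in>UNIV. wirtinger_deriv (t k) (f K) x * wedge (cov (t k)) (\<beta> K) vs)"
      by (simp add: wedge_cov_expand sum_distrib_left)
    also have "\<dots> = (\<Sum>k\<in>UNIV. \<Sum>K\<in>A. wirtinger_deriv (t k) (f K) x * wedge (cov (t k)) (\<beta> K) vs)"
      by (rule sum.swap)
    finally show ?thesis .
  qed
  show "del \<omega> x vs = (\<Sum>k\<in>UNIV. \<Sum>K\<in>A. wirtinger_deriv (Inl k) (f K) x * wedge (cov (Inl k)) (\<beta> K) vs)"
    unfolding del_def 1 by (rule gen)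
  show "delbar \<omega> x vs = (\<Sum>k\<in>UNIV. \<Sum>K\<in>A. wirtinger_deriv (Inr k) (f K) x * wedge (cov (Inr k)) (\<beta> K) vs)"
    unfolding delbar_def 2 by (rule gen)
qed

lemma smooth_wirtinger_deriv: "smooth f \<Longrightarrow> smooth (wirtinger_deriv t f)"
proof -
  assume f: "smooth f"
  have "wirtinger_deriv t f = (\<lambda>x. (1/2) * dir_deriv (axis (index_of t) 1) f x + (case t of Inl k \<Rightarrow> -\<i>/2 | Inr k \<Rightarrow> \<i>/2) * dir_deriv (axis (index_of t) \<i>) f x)"
    by (auto simp: wirtinger_deriv_def index_of_def fun_eq_iff field_simps split: sum.splits)
  thus ?thesis
    using smooth_simps(1)[OF smooth_dir_deriv[OF f, of "axis (index_of t) 1"] smooth_dir_deriv[OF f, of "axis (index_of t) \<i>"],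
        of "1/2" "case t of Inl k \<Rightarrow> -\<i>/2 | Inr k \<Rightarrow> \<i>/2"] by simp
qed

text \<open>\<open>delbar \<omega>\<close> is again a sum of functions times constant forms, indexed
  by pairs of a direction and an element of \<open>A\<close>, so the first-order formula can be
  applied twice.\<close>

lemma del_delbar_expand:
  fixes \<omega> :: "'m::finite cvec \<Rightarrow> 'm ext"
  assumes V: "open V" "x \<in> V" and A: "finite A"
    and \<omega>: "\<And>y vs. y \<in> V \<Longrightarrow> \<omega> y vs = (\<Sum>K\<in>A. f K y * \<beta> K vs)"
    and f: "\<And>K. K \<in> A \<Longrightarrow> smooth (f K)"
  shows "del (delbar \<omega>) x vs = (\<Sum>k\<in>UNIV. \<Sum>l\<in>UNIV. \<Sum>K\<in>A.
     wirtinger_deriv (Inl k) (wirtinger_deriv (Inr l) (f K)) x * wedge (cov (Inl k)) (wedge (cov (Inr l)) (\<beta> K)) vs)"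
proof -
  have "delbar \<omega> y vs = (\<Sum>(l, K)\<in>UNIV \<times> A. wirtinger_deriv (Inr l) (f K) y * wedge (cov (Inr l)) (\<beta> K) vs)"
    if "y \<in> V" for y vs
    unfolding sum.cartesian_product[symmetric]
    by (rule del_expand(2)[OF V(1) that A \<omega> smooth_differentiable[OF f]])
  hence "del (delbar \<omega>) x vs = (\<Sum>k\<in>UNIV. \<Sum>lK\<in>UNIV \<times> A. wirtinger_deriv (Inl k) (wirtinger_deriv (Inr (fst lK)) (f (snd lK))) x *
      wedge (cov (Inl k)) (wedge (cov (Inr (fst lK))) (\<beta> (snd lK))) vs)"
    by (intro del_expand(1)[OF V, where f = "\<lambda>lK. wirtinger_deriv (Inr (fst lK)) (f (snd lK))" and
          \<beta> = "\<lambda>lK. wedge (cov (Inr (fst lK))) (\<beta> (snd lK))"])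
      (auto simp: A case_prod_unfold intro!: smooth_differentiable smooth_wirtinger_deriv f)
  thus ?thesis by (simp add: sum.cartesian_product case_prod_unfold)
qed

section \<open>Fourier analysis on tori\<close>

definition torus_mean :: "('a::euclidean_space \<Rightarrow> complex) \<Rightarrow> complex" where
  "torus_mean \<phi> = integral (cbox 0 One) \<phi>"

definition torus_periodic :: "('a::euclidean_space \<Rightarrow> 'b) \<Rightarrow> bool" where
  "torus_periodic \<phi> \<longleftrightarrow> (\<forall>t. \<forall>b\<in>Basis. \<phi> (t + b) = \<phi> t)"

definition intvec :: "'a::euclidean_space \<Rightarrow> bool" where
  "intvec k \<longleftrightarrow> (\<forall>b\<in>Basis. k \<bullet> b \<in> \<int>)"

definition character :: "'a::euclidean_space \<Rightarrow> 'a \<Rightarrow> complex" where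
  "character k t = cis (2 * pi * (k \<bullet> t))"

lemma intvec_simps: "intvec 0" "intvec k \<Longrightarrow> intvec l \<Longrightarrow> intvec (k + l)" "intvec k \<Longrightarrow> intvec (- k)"
  by (auto simp: intvec_def inner_add_left)

lemma intvec_Basis: "b \<in> Basis \<Longrightarrow> intvec b"
  by (auto simp: intvec_def inner_Basis)

lemma intvec_expand: "(\<Sum>b\<in>Basis. (k \<bullet> b) *\<^sub>R b) = k"
  by (rule euclidean_representation)

lemma torus_periodic_of_int:
  assumes "torus_periodic \<phi>" "b \<in> Basis" shows "\<phi> (t + of_int n *\<^sub>R b) = \<phi> t"
proof (induction n arbitrary: t rule: int_induct[where k = 0])
  case (step1 n)
  have "\<phi> (t + of_int (n + 1) *\<^sub>R b) = \<phi> ((t + of_int n *\<^sub>R b) + b)" by (simp add: algebra_simps)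
  thus ?case using step1 assms by (simp add: torus_periodic_def)
next
  case (step2 n)
  have "\<phi> (t + of_int (n - 1) *\<^sub>R b) = \<phi> ((t + of_int (n - 1) *\<^sub>R b) + b)"
    using assms by (simp add: torus_periodic_def)
  thus ?case using step2 by (simp add: algebra_simps)
qed simp

lemma torus_periodic_intvec:
  assumes "torus_periodic \<phi>" "intvec k" shows "\<phi> (t + k) = \<phi> t"
proof -
  have "\<phi> (t + (\<Sum>b\<in>A. (k \<bullet> b) *\<^sub>R b)) = \<phi> t" if "A \<subseteq> Basis" for A
    using finite_subset[OF that finite_Basis] that
  proof (induction A rule: finite_induct)
    case (insert b A)
    obtain n :: int where n: "k \<bullet> b = of_int n" using assms insert.prems unfolding intvec_def by (metis Ints_cases insert_subset)
    have "\<phi> (t + (\<Sum>b\<in>insert b A. (k \<bullet> b) *\<^sub>R b)) = \<phi> ((t + (\<Sum>b\<in>A. (k \<bullet> b) *\<^sub>R b)) + of_int n *\<^sub>R b)"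
      using insert.hyps by (simp add: n[symmetric] add_ac)
    thus ?case using insert torus_periodic_of_int[OF assms(1)] by simp
  qed simp
  from this[OF order_refl] show ?thesis by (simp add: intvec_expand)
qed

lemma intvec_reduce: "\<exists>k. intvec k \<and> t + k \<in> cbox 0 One"
proof (intro exI conjI)
  let ?k = "- (\<Sum>b\<in>Basis. of_int \<lfloor>t \<bullet> b\<rfloor> *\<^sub>R b)"
  have k: "?k \<bullet> b = - of_int \<lfloor>t \<bullet> b\<rfloor>" if "b \<in> Basis" for b
    using that by (simp add: inner_minus_left)
  show "intvec ?k" unfolding intvec_def using k by simp
  show "t + ?k \<in> cbox 0 One" unfolding mem_box
  proof
    fix b :: 'a assume b: "b \<in> Basis"
    have "of_int \<lfloor>t \<bullet> b\<rfloor> \<le> t \<bullet> b" "t \<bullet> b \<le> of_int \<lfloor>t \<bullet> b\<rfloor> + 1" by linarith+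
    moreover have "(t + ?k) \<bullet> b = t \<bullet> b - of_int \<lfloor>t \<bullet> b\<rfloor>"
      unfolding inner_add_left k[OF b] by simp
    moreover have "One \<bullet> b = 1" "0 \<bullet> b = 0" using b by simp_all
    ultimately show "0 \<bullet> b \<le> (t + ?k) \<bullet> b \<and> (t + ?k) \<bullet> b \<le> One \<bullet> b" by linarith
  qed
qed

lemma character_simps:
  "character k (s + t) = character k s * character k t" "character (k + l) t = character k t * character l t"
  "character 0 t = 1" "character (- k) t = cnj (character k t)" "character k t * cnj (character k t) = 1"
  by (simp_all add: character_def inner_add_right inner_add_left distrib_left cis_mult cis_cnj)

lemma norm_character [simp]: "norm (character k t) = 1"
  by (simp add: character_def)

lemma continuous_character [continuous_intros]:
  "continuous_on S f \<Longrightarrow> continuous_on S (\<lambda>x. character k (f x))"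
  unfolding character_def by (intro continuous_intros)

lemma intvec_inner_Ints: "intvec k \<Longrightarrow> intvec l \<Longrightarrow> k \<bullet> l \<in> \<int>"
  unfolding intvec_def by (subst euclidean_inner) (auto intro!: Ints_sum Ints_mult)

lemma character_intvec: "intvec k \<Longrightarrow> intvec l \<Longrightarrow> character k l = 1"
  by (simp add: character_def cis_multiple_2pi intvec_inner_Ints)

lemma character_0: "character 0 = (\<lambda>t. 1)"
  by (simp add: character_simps fun_eq_iff)

lemma torus_periodic_character: "intvec k \<Longrightarrow> torus_periodic (character k)"
  by (simp add: torus_periodic_def character_simps character_intvec intvec_Basis)

section \<open>The mean over the torus and its invariance under shifts\<close>

lemma integrable_torus_mean: "continuous_on UNIV \<phi> \<Longrightarrow> \<phi> integrable_on cbox a b"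
  for \<phi> :: "'a::euclidean_space \<Rightarrow> complex"
  by (meson continuous_on_subset integrable_continuous top_greatest)

lemma torus_mean_bound:
  fixes \<phi> :: "'a::euclidean_space \<Rightarrow> complex"
  assumes "continuous_on UNIV \<phi>" "\<And>t. norm (\<phi> t) \<le> B"
  shows "norm (torus_mean \<phi>) \<le> B"
proof -
  have "0 \<le> B" using assms(2)[of 0] norm_ge_zero order_trans by blast
  from has_integral_bound[OF this integrable_integral[OF integrable_torus_mean[OF assms(1), of 0 One]], of]
  show ?thesis using assms(2) by (simp add: torus_mean_def content_unit)
qed

lemma torus_mean_lin:
  assumes "continuous_on UNIV \<phi>" "continuous_on UNIV \<psi>"
  shows "torus_mean (\<lambda>t. a * \<phi> t + b * \<psi> t) = a * torus_mean \<phi> + b * torus_mean \<psi>"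
  unfolding torus_mean_def
  by (subst integral_add) (auto intro!: integrable_torus_mean continuous_intros assms)

lemma torus_mean_add: "continuous_on UNIV \<phi> \<Longrightarrow> continuous_on UNIV \<psi> \<Longrightarrow>
   torus_mean (\<lambda>t. \<phi> t + \<psi> t) = torus_mean \<phi> + torus_mean \<psi>"
  using torus_mean_lin[of \<phi> \<psi> 1 1] by simp

lemma torus_mean_diff: "continuous_on UNIV \<phi> \<Longrightarrow> continuous_on UNIV \<psi> \<Longrightarrow>
   torus_mean (\<lambda>t. \<phi> t - \<psi> t) = torus_mean \<phi> - torus_mean \<psi>"
  using torus_mean_lin[of \<phi> \<psi> 1 "-1"] by simp

lemma torus_mean_scale: "torus_mean (\<lambda>t. c * \<phi> t) = c * torus_mean \<phi>"
  by (simp add: torus_mean_def)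

lemma torus_mean_scale_right: "torus_mean (\<lambda>t. \<phi> t * c) = torus_mean \<phi> * c"
  by (simp add: torus_mean_def)

lemma torus_mean_zero: "torus_mean (\<lambda>t. 0) = 0"
  by (simp add: torus_mean_def)

lemma torus_mean_const: "torus_mean (\<lambda>t. c) = c"
  by (simp add: torus_mean_def content_unit)

lemma torus_mean_cnj: "continuous_on UNIV \<phi> \<Longrightarrow> torus_mean (\<lambda>t. cnj (\<phi> t)) = cnj (torus_mean \<phi>)"
  unfolding torus_mean_def
  by (rule integral_unique, rule has_integral_cnj[THEN iffD2, unfolded o_def], rule integrable_integral, rule integrable_torus_mean)

text \<open>Cut the shifted box where the coordinate along \<open>b\<close> equals 1 and move the
  protruding slab back by one period; it then fills the part of the unit box where that coordinate
  is at most \<open>s\<close>.\<close>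

lemma torus_mean_shift_Basis:
  fixes \<phi> :: "'a::euclidean_space \<Rightarrow> complex"
  assumes c: "continuous_on UNIV \<phi>" and p: "torus_periodic \<phi>" and b: "b \<in> Basis" and s: "0 \<le> s" "s \<le> 1"
  shows "torus_mean (\<lambda>t. \<phi> (t + s *\<^sub>R b)) = torus_mean \<phi>"
proof -
  note int = integrable_integral[OF integrable_torus_mean[OF c]]
  have I: "((\<lambda>t. \<phi> (t + s *\<^sub>R b)) has_integral i) (cbox 0 One)"
    if "(\<phi> has_integral i) (cbox (s *\<^sub>R b) (One + s *\<^sub>R b))" for i
    using that has_integral_shift_cbox_iff[of \<phi> "s *\<^sub>R b" i 0 One] by (simp add: o_def add.commute)
  have J: "integral (cbox b (One + s *\<^sub>R b)) \<phi> = integral (cbox 0 (One - (1 - s) *\<^sub>R b)) \<phi>"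
  proof -
    have "(\<phi> \<circ> (+) b has_integral integral (cbox b (One + s *\<^sub>R b)) \<phi>) (cbox 0 (One - (1 - s) *\<^sub>R b))"
      using int[of b "One + s *\<^sub>R b"] has_integral_shift_cbox_iff[of \<phi> b _ 0 "One - (1 - s) *\<^sub>R b"]
      by (simp add: algebra_simps)
    moreover have "\<phi> \<circ> (+) b = \<phi>" using p b by (simp add: fun_eq_iff torus_periodic_def add.commute)
    ultimately show ?thesis by (simp add: integral_unique)
  qed
  have s1: "cbox (s *\<^sub>R b) (One + s *\<^sub>R b) \<inter> {x. x \<bullet> b \<le> 1} = cbox (s *\<^sub>R b) One"
    and s2: "cbox (s *\<^sub>R b) (One + s *\<^sub>R b) \<inter> {x. x \<bullet> b \<ge> 1} = cbox b (One + s *\<^sub>R b)"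
    and s3: "cbox 0 One \<inter> {x. x \<bullet> b \<le> s} = cbox 0 (One - (1 - s) *\<^sub>R b)"
    and s4: "cbox 0 One \<inter> {x. x \<bullet> b \<ge> s} = cbox (s *\<^sub>R b) One"
    using b s
    by (auto simp: mem_box inner_add_left inner_diff_left inner_Basis split: if_splits)
      (insert b s, fastforce+)
  have "(\<phi> has_integral (integral (cbox (s *\<^sub>R b) One) \<phi> + integral (cbox b (One + s *\<^sub>R b)) \<phi>))
      (cbox (s *\<^sub>R b) (One + s *\<^sub>R b))"
    by (rule has_integral_split[where c = 1, OF _ _ b]) (simp_all only: s1 s2 int)
  from integral_unique[OF I[OF this]]
  have 1: "torus_mean (\<lambda>t. \<phi> (t + s *\<^sub>R b)) = integral (cbox (s *\<^sub>R b) One) \<phi> + integral (cbox b (One + s *\<^sub>R b)) \<phi>"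
    by (simp add: torus_mean_def)
  have "(\<phi> has_integral (integral (cbox 0 (One - (1 - s) *\<^sub>R b)) \<phi> + integral (cbox (s *\<^sub>R b) One) \<phi>)) (cbox 0 One)"
    by (rule has_integral_split[where c = s, OF _ _ b]) (simp_all only: s3 s4 int)
  from integral_unique[OF this] show ?thesis using 1 J by (simp add: torus_mean_def)
qed

lemma torus_mean_character:
  assumes k: "intvec k" "k \<noteq> 0" shows "torus_mean (character k) = 0"
proof -
  obtain b where b: "b \<in> Basis" "k \<bullet> b \<noteq> 0" using k(2) by (metis euclidean_all_zero_iff)
  then obtain n :: int where n: "k \<bullet> b = of_int n" "n \<noteq> 0"
    using k(1) unfolding intvec_def by (metis Ints_cases of_int_0)
  \<comment> \<open>Half a period of the character in direction \<open>b\<close>, so that the shift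
    changes its sign. It is at most 1 because \<open>n\<close> is a nonzero integer, which puts it
    in the range of \<open>torus_mean_shift_Basis\<close>.\<close>
  define s where "s = 1 / (2 * \<bar>real_of_int n\<bar>)"
  have "\<bar>real_of_int n\<bar> \<ge> 1" using n(2) by linarith
  hence s: "0 \<le> s" "s \<le> 1" by (auto simp: s_def field_simps)
  have "character k (s *\<^sub>R b) = -1"
  proof -
    have "2 * pi * (k \<bullet> (s *\<^sub>R b)) = pi \<or> 2 * pi * (k \<bullet> (s *\<^sub>R b)) = - pi"
      using n by (auto simp: s_def abs_if)
    thus ?thesis unfolding character_def by (elim disjE) (simp_all only:, simp_all add: complex_eq_iff)
  qed
  hence "torus_mean (\<lambda>t. character k (t + s *\<^sub>R b)) = - torus_mean (character k)"
    using torus_mean_scale[of "-1" "character k"] by (simp add: character_simps)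
  moreover have "torus_mean (\<lambda>t. character k (t + s *\<^sub>R b)) = torus_mean (character k)"
    by (rule torus_mean_shift_Basis[OF _ torus_periodic_character[OF k(1)] b(1) s]) (intro continuous_intros)
  ultimately show ?thesis by (simp add: eq_neg_iff_add_eq_0)
qed

section \<open>Density of trigonometric polynomials and uniqueness of Fourier series\<close>

inductive trig :: "('a::euclidean_space \<Rightarrow> complex) \<Rightarrow> bool" where
  character: "intvec k \<Longrightarrow> trig (character k)"
| lin: "trig p \<Longrightarrow> trig q \<Longrightarrow> trig (\<lambda>t. a * p t + b * q t)"

lemma trig_const: "trig (\<lambda>t. c)"
  using trig.lin[OF trig.character[OF intvec_simps(1)] trig.character[OF intvec_simps(1)], of c 0] by (simp add: character_0)

lemma trig_add: "trig p \<Longrightarrow> trig q \<Longrightarrow> trig (\<lambda>t. p t + q t)"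
  using trig.lin[of p q 1 1] by simp

lemma trig_scale: "trig p \<Longrightarrow> trig (\<lambda>t. c * p t)"
  using trig.lin[of p p c 0] by simp

lemma trig_sum: "(\<And>i. i \<in> A \<Longrightarrow> trig (p i)) \<Longrightarrow> trig (\<lambda>t. \<Sum>i\<in>A. p i t)"
  by (induction A rule: infinite_finite_induct) (auto intro: trig_const trig_add)

lemma trig_mult: "trig p \<Longrightarrow> trig q \<Longrightarrow> trig (\<lambda>t. p t * q t)"
proof (induction rule: trig.induct)
  case (character k)
  show ?case using character(2)
  proof (induction rule: trig.induct)
    case (character l)
    have "(\<lambda>t. character k t * character l t) = character (k + l)" by (simp add: fun_eq_iff character_simps)
    thus ?case using trig.character[OF intvec_simps(2)[OF \<open>intvec k\<close> \<open>intvec l\<close>]] by simp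
  next
    case (lin p q a b)
    thus ?case using trig.lin[OF lin.IH, of a b] by (simp add: algebra_simps)
  qed
next
  case (lin p p' a b)
  thus ?case using trig.lin[OF lin.IH(1)[OF lin.prems] lin.IH(2)[OF lin.prems], of a b]
    by (simp add: algebra_simps)
qed

lemma trig_cont: "trig p \<Longrightarrow> continuous_on UNIV p"
  by (induction rule: trig.induct) (auto intro!: continuous_intros continuous_character continuous_on_id simp: continuous_on_mult_left)

lemma trig_cos_sin:
  assumes "b \<in> Basis"
  shows "trig (\<lambda>t. of_real (cos (2 * pi * (t \<bullet> b))))" "trig (\<lambda>t. of_real (sin (2 * pi * (t \<bullet> b))))"
proof -
  have b: "intvec b" "intvec (- b)" using assms by (auto intro: intvec_Basis intvec_simps)
  have "of_real (cos (2 * pi * (t \<bullet> b))) = (1/2) * character b t + (1/2) * character (-b) t" for t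
    by (simp add: character_def complex_eq_iff inner_commute)
  thus "trig (\<lambda>t. of_real (cos (2 * pi * (t \<bullet> b))))" using trig.lin[OF b[THEN trig.character], of "1/2" "1/2"] by simp
  have "of_real (sin (2 * pi * (t \<bullet> b))) = (-\<i>/2) * character b t + (\<i>/2) * character (-b) t" for t
    by (simp add: character_def complex_eq_iff inner_commute)
  thus "trig (\<lambda>t. of_real (sin (2 * pi * (t \<bullet> b))))" using trig.lin[OF b[THEN trig.character], of "-\<i>/2" "\<i>/2"] by simp
qed

text \<open>The map \<open>T\<close> identifies exactly the points that differ by integer vectors,
  so \<phi> descends to a continuous function on a compact subset of Euclidean space.
  Stone-Weierstrass gives a polynomial there, and polynomials in the sines and cosines are
  trigonometric.\<close>

lemma trig_dense_real:
  fixes \<phi> :: "'a::euclidean_space \<Rightarrow> real"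
  assumes c: "continuous_on UNIV \<phi>" and p: "torus_periodic \<phi>" and e: "e > 0"
  shows "\<exists>q. trig q \<and> (\<forall>t. norm (of_real (\<phi> t) - q t) < e)"
proof -
  define T :: "'a \<Rightarrow> 'a \<times> 'a" where
    "T = (\<lambda>t. (\<Sum>b\<in>Basis. cos (2 * pi * (t \<bullet> b)) *\<^sub>R b, \<Sum>b\<in>Basis. sin (2 * pi * (t \<bullet> b)) *\<^sub>R b))"
  define K where "K = cbox (0::'a) One"
  define S where "S = T ` K"
  have contT: "continuous_on A T" for A unfolding T_def by (intro continuous_intros)
  have eqT: "intvec (t' - t)" if "T t = T t'" for t t'
    unfolding intvec_def
  proof
    fix b :: 'a assume b: "b \<in> Basis"
    have "cos (2 * pi * (t \<bullet> b)) = cos (2 * pi * (t' \<bullet> b))" "sin (2 * pi * (t \<bullet> b)) = sin (2 * pi * (t' \<bullet> b))"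
      using arg_cong[OF that, of "\<lambda>x. fst x \<bullet> b"] arg_cong[OF that, of "\<lambda>x. snd x \<bullet> b"] b
      by (simp_all add: T_def)
    then obtain n :: int where "2 * pi * (t' \<bullet> b) = 2 * pi * (t \<bullet> b) + 2 * pi * n"
      using sin_cos_eq_iff by metis
    hence "2 * pi * (t' \<bullet> b - t \<bullet> b) = 2 * pi * n" by (simp add: algebra_simps)
    hence "t' \<bullet> b - t \<bullet> b = of_int n" by simp
    thus "(t' - t) \<bullet> b \<in> \<int>" by (simp add: inner_diff_left)
  qed
  have welldef: "\<phi> t = \<phi> t'" if "T t = T t'" for t t'
    using torus_periodic_intvec[OF p eqT[OF that], of t] by simp
  have Tper: "T (t + k) = T t" if "intvec k" for t k
  proof -
    have "cos (2 * pi * ((t + k) \<bullet> b)) = cos (2 * pi * (t \<bullet> b)) \<and> sin (2 * pi * ((t + k) \<bullet> b)) = sin (2 * pi * (t \<bullet> b))"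
      if "b \<in> Basis" for b
      using character_simps(1)[of b t k] character_intvec[OF intvec_Basis[OF that] \<open>intvec k\<close>]
      by (simp add: character_def complex_eq_iff inner_commute)
    thus ?thesis by (simp add: T_def)
  qed
  have inS: "T t \<in> S" for t
    using intvec_reduce[of t] Tper unfolding S_def K_def by (metis imageI)
  define g where "g = (\<lambda>y. \<phi> (SOME t. t \<in> K \<and> T t = y))"
  have g: "g (T t) = \<phi> t" for t
  proof -
    have "\<exists>t'. t' \<in> K \<and> T t' = T t" using inS[of t] unfolding S_def by auto
    hence "T (SOME t'. t' \<in> K \<and> T t' = T t) = T t" by (rule someI2_ex) blast
    thus ?thesis unfolding g_def by (rule welldef)
  qed
  \<comment> \<open>A continuous surjection from a compact space onto a Hausdorff space is a
    quotient map; hence \<open>g\<close> is continuous in spite of the choice in its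
    definition.\<close>
  have "quotient_map (top_of_set K) (top_of_set S) T"
    by (rule T1_Spaces.continuous_imp_quotient_map)
      (auto simp: S_def K_def contT compact_space_subtopology intro!: Hausdorff_space_subtopology Hausdorff_space_euclidean)
  moreover have "continuous_map (top_of_set K) euclidean (g \<circ> T)"
    using continuous_on_subset[OF c] by (auto simp: g o_def)
  ultimately have "continuous_map (top_of_set S) euclidean g"
    by (rule continuous_compose_quotient_map)
  hence "continuous_on S g" by simp
  moreover have "compact S" unfolding S_def K_def by (intro compact_continuous_image contT compact_cbox)
  ultimately obtain q where q: "real_polynomial_function q" "\<And>y. y \<in> S \<Longrightarrow> \<bar>g y - q y\<bar> < e"
    using Stone_Weierstrass_real_polynomial_function e by blast
  have "trig (\<lambda>t. complex_of_real (q (T t)))" using q(1)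
  proof (induction rule: real_polynomial_function.induct)
    case (linear f)
    interpret bounded_linear f by fact
    have "f (T t) = (\<Sum>b\<in>Basis. cos (2 * pi * (t \<bullet> b)) * f (b, 0)) + (\<Sum>b\<in>Basis. sin (2 * pi * (t \<bullet> b)) * f (0, b))" for t
    proof -
      have "T t = (\<Sum>b\<in>Basis. cos (2 * pi * (t \<bullet> b)) *\<^sub>R (b, 0)) + (\<Sum>b\<in>Basis. sin (2 * pi * (t \<bullet> b)) *\<^sub>R (0, b))"
        by (simp add: T_def prod_eq_iff fst_sum snd_sum)
      thus ?thesis by (simp only: add sum scaleR real_scaleR_def)
    qed
    thus ?case
      by (simp, intro trig_add trig_sum)
        (subst mult.commute, rule trig_scale, erule trig_cos_sin)+
  qed (auto intro: trig_const trig_add trig_mult)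
  moreover have "norm (complex_of_real (\<phi> t) - of_real (q (T t))) < e" for t
    using q(2)[OF inS[of t]] by (simp add: g norm_of_real flip: of_real_diff)
  ultimately show ?thesis by blast
qed

lemma trig_dense:
  fixes \<phi> :: "'a::euclidean_space \<Rightarrow> complex"
  assumes c: "continuous_on UNIV \<phi>" and p: "torus_periodic \<phi>" and e: "e > 0"
  shows "\<exists>q. trig q \<and> (\<forall>t. norm (\<phi> t - q t) < e)"
proof -
  have "continuous_on UNIV (\<lambda>t. Re (\<phi> t))" "continuous_on UNIV (\<lambda>t. Im (\<phi> t))"
    "torus_periodic (\<lambda>t. Re (\<phi> t))" "torus_periodic (\<lambda>t. Im (\<phi> t))"
    using p by (auto intro!: continuous_intros c simp: torus_periodic_def)
  then obtain q r where q: "trig q" "\<And>t. norm (of_real (Re (\<phi> t)) - q t) < e / 2"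
    and r: "trig r" "\<And>t. norm (of_real (Im (\<phi> t)) - r t) < e / 2"
    using trig_dense_real[of "\<lambda>t. Re (\<phi> t)" "e/2"] trig_dense_real[of "\<lambda>t. Im (\<phi> t)" "e/2"] e by auto
  have "norm (\<phi> t - (1 * q t + \<i> * r t)) < e" for t
  proof -
    have "\<phi> t - (1 * q t + \<i> * r t) = (of_real (Re (\<phi> t)) - q t) + \<i> * (of_real (Im (\<phi> t)) - r t)"
      using complex_eq[of "\<phi> t"] by (simp add: algebra_simps)
    also have "norm \<dots> < e / 2 + e / 2"
      by (rule le_less_trans[OF norm_triangle_ineq], rule add_strict_mono[OF q(2)])
        (use r(2)[of t] in \<open>simp only: norm_mult norm_ii mult_1_left\<close>)
    finally show ?thesis by simp
  qed
  thus ?thesis using trig.lin[OF q(1) r(1), of 1 \<i>] by blast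
qed

text \<open>The mean is continuous under uniform limits, so by density its invariance under
  \<open>A\<close> has to be checked on characters only. This takes the place of a change of
  variables, for translations and for integer linear maps alike.\<close>

lemma torus_mean_compose:
  fixes \<phi> :: "'a::euclidean_space \<Rightarrow> complex"
  assumes c: "continuous_on UNIV \<phi>" and p: "torus_periodic \<phi>" and A: "continuous_on UNIV A"
    and character: "\<And>k. intvec k \<Longrightarrow> torus_mean (\<lambda>t. character k (A t)) = torus_mean (character k)"
  shows "torus_mean (\<lambda>t. \<phi> (A t)) = torus_mean \<phi>"
proof -
  have cA: "continuous_on UNIV (\<lambda>t. f (A t))" if "continuous_on UNIV f" for f :: "'a \<Rightarrow> complex"
    by (rule continuous_on_compose2[OF that A]) auto
  have "norm (torus_mean (\<lambda>t. \<phi> (A t)) - torus_mean \<phi>) \<le> 0 + e" if e: "e > 0" for e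
  proof -
    obtain q where q: "trig q" "\<And>t. norm (\<phi> t - q t) < e / 2"
      using trig_dense[OF c p, of "e/2"] e by auto
    have inv: "torus_mean (\<lambda>t. q (A t)) = torus_mean q" using q(1)
    proof (induction rule: trig.induct)
      case (lin p q a b)
      thus ?case by (simp add: torus_mean_lin trig_cont cA)
    qed (rule character)
    note cq = trig_cont[OF q(1)]
    have "torus_mean (\<lambda>t. \<phi> (A t)) - torus_mean \<phi> = torus_mean (\<lambda>t. \<phi> (A t) - q (A t)) - torus_mean (\<lambda>t. \<phi> t - q t)"
      by (simp add: torus_mean_diff cA c cq inv)
    also have "norm \<dots> \<le> e/2 + e/2"
      by (rule order_trans[OF norm_triangle_ineq4], rule add_mono; rule torus_mean_bound)
        (rule continuous_on_diff cA c cq less_imp_le[OF q(2)])+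
    finally show ?thesis by simp
  qed
  hence "norm (torus_mean (\<lambda>t. \<phi> (A t)) - torus_mean \<phi>) \<le> 0" by (rule field_le_epsilon)
  thus ?thesis by simp
qed

lemma torus_mean_translate:
  fixes \<phi> :: "'a::euclidean_space \<Rightarrow> complex"
  assumes "continuous_on UNIV \<phi>" "torus_periodic \<phi>"
  shows "torus_mean (\<lambda>t. \<phi> (t + s)) = torus_mean \<phi>"
proof (rule torus_mean_compose[OF assms])
  fix k :: 'a assume "intvec k"
  thus "torus_mean (\<lambda>t. character k (t + s)) = torus_mean (character k)"
    by (cases "k = 0") (simp_all add: character_0 character_simps torus_mean_scale_right torus_mean_character)
qed (intro continuous_intros)

text \<open>A character composed with \<open>A\<close> has the adjoint frequency. Integrality of
  \<open>A\<close> keeps that frequency integral, and surjectivity keeps it nonzero, so for k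
  \<noteq> 0 both means vanish.\<close>

lemma torus_mean_linear_image:
  fixes \<phi> :: "'a::euclidean_space \<Rightarrow> complex"
  assumes "continuous_on UNIV \<phi>" "torus_periodic \<phi>" and A: "linear A" "surj A"
    and int: "\<And>b. b \<in> Basis \<Longrightarrow> intvec (A b)"
  shows "torus_mean (\<lambda>t. \<phi> (A t)) = torus_mean \<phi>"
proof (rule torus_mean_compose[OF assms(1,2)])
  show "continuous_on UNIV A" using A(1) linear_continuous_on linear_conv_bounded_linear by blast
  fix k :: 'a assume k: "intvec k"
  have adj: "character k (A t) = character (adjoint A k) t" for t
    using adjoint_works[OF A(1), of t k] by (simp add: character_def inner_commute)
  show "torus_mean (\<lambda>t. character k (A t)) = torus_mean (character k)"
  proof (cases "k = 0")
    case False
    have "adjoint A k \<bullet> b = k \<bullet> A b" for b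
      using adjoint_works[OF A(1), of b k] by (simp add: inner_commute)
    hence 1: "intvec (adjoint A k)" using intvec_inner_Ints[OF k int] by (simp add: intvec_def)
    obtain t where "A t = k" using A(2) by (metis surjD)
    hence "adjoint A k \<bullet> t \<noteq> 0" using False \<open>\<And>b. adjoint A k \<bullet> b = k \<bullet> A b\<close> by simp
    hence "adjoint A k \<noteq> 0" by auto
    thus ?thesis using torus_mean_character[OF 1] torus_mean_character[OF k False] by (simp add: adj cong: if_cong)
  next
    case True thus ?thesis by (simp add: character_0 torus_mean_const)
  qed
qed

text \<open>After subtraction of the mean the function is orthogonal to all trigonometric
  polynomials. These approximate its conjugate uniformly, so its squared modulus has mean 0, and
  continuity makes it vanish.\<close>

lemma fourier_unique:
  fixes \<phi> :: "'a::euclidean_space \<Rightarrow> complex"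
  assumes c: "continuous_on UNIV \<phi>" and p: "torus_periodic \<phi>"
    and 0: "\<And>k. intvec k \<Longrightarrow> k \<noteq> 0 \<Longrightarrow> torus_mean (\<lambda>t. \<phi> t * character (- k) t) = 0"
  shows "\<phi> t = torus_mean \<phi>"
proof -
  define \<psi> where "\<psi> = (\<lambda>t. \<phi> t - torus_mean \<phi>)"
  have c\<psi>: "continuous_on UNIV \<psi>" and p\<psi>: "torus_periodic \<psi>"
    using p by (auto simp: \<psi>_def torus_periodic_def intro!: continuous_intros c)
  have k0: "torus_mean (\<lambda>t. \<psi> t * character k t) = 0" if k: "intvec k" for k
  proof -
    have "torus_mean (\<lambda>t. \<psi> t * character k t) = torus_mean (\<lambda>t. \<phi> t * character k t) - torus_mean \<phi> * torus_mean (character k)"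
      unfolding \<psi>_def left_diff_distrib
      by (subst torus_mean_diff) (auto intro!: continuous_intros c simp: torus_mean_scale)
    thus ?thesis using 0[of "- k"] k torus_mean_character[OF k]
      by (cases "k = 0") (auto simp: character_0 torus_mean_const intvec_simps)
  qed
  have q0: "torus_mean (\<lambda>t. \<psi> t * q t) = 0" if "trig q" for q
    using that
  proof (induction rule: trig.induct)
    case (lin p q a b)
    have "torus_mean (\<lambda>t. \<psi> t * (a * p t + b * q t)) = torus_mean (\<lambda>t. a * (\<psi> t * p t) + b * (\<psi> t * q t))"
      by (simp add: algebra_simps)
    also have "\<dots> = 0"
      by (subst torus_mean_lin)
        (auto intro!: continuous_on_mult c\<psi> trig_cont[OF lin.hyps(1)] trig_cont[OF lin.hyps(2)] simp: lin.IH)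
    finally show ?case .
  qed (rule k0)
  obtain B where B: "\<And>t. t \<in> cbox 0 One \<Longrightarrow> norm (\<psi> t) \<le> B"
    using compact_imp_bounded[OF compact_continuous_image[OF continuous_on_subset[OF c\<psi>] compact_cbox]]
    by (fastforce simp: bounded_iff)
  have B': "norm (\<psi> t) \<le> B" for t
    using intvec_reduce[of t] B torus_periodic_intvec[OF p\<psi>] by metis
  hence Bpos: "0 \<le> B" using norm_ge_zero order_trans by blast
  have "norm (torus_mean (\<lambda>t. \<psi> t * cnj (\<psi> t))) \<le> 0 + e" if e: "e > 0" for e
  proof -
    have "continuous_on UNIV (\<lambda>t. cnj (\<psi> t))" "torus_periodic (\<lambda>t. cnj (\<psi> t))"
      using p\<psi> by (auto intro!: continuous_intros c\<psi> simp: torus_periodic_def)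
    \<comment> \<open>B + 1 instead of B avoids a division by zero when \<psi> vanishes
      identically.\<close>
    then obtain q where q: "trig q" "\<And>t. norm (cnj (\<psi> t) - q t) < e / (B + 1)"
      using trig_dense[of "\<lambda>t. cnj (\<psi> t)" "e / (B + 1)"] e Bpos by auto
    have "torus_mean (\<lambda>t. \<psi> t * cnj (\<psi> t)) = torus_mean (\<lambda>t. \<psi> t * (cnj (\<psi> t) - q t))"
      unfolding right_diff_distrib
      by (subst torus_mean_diff) (auto intro!: continuous_intros c\<psi> trig_cont[OF q(1)] simp: q0[OF q(1)])
    also have "norm \<dots> \<le> e"
    proof (rule torus_mean_bound)
      fix t
      have "norm (\<psi> t * (cnj (\<psi> t) - q t)) \<le> B * (e / (B + 1))"
        unfolding norm_mult by (rule mult_mono) (auto intro!: B' less_imp_le[OF q(2)] Bpos)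
      also have "\<dots> \<le> e" using e Bpos by (simp add: field_simps)
      finally show "norm (\<psi> t * (cnj (\<psi> t) - q t)) \<le> e" .
    qed (auto intro!: continuous_intros c\<psi> trig_cont[OF q(1)])
    finally show ?thesis by simp
  qed
  hence "norm (torus_mean (\<lambda>t. \<psi> t * cnj (\<psi> t))) \<le> 0" by (rule field_le_epsilon)
  hence "integral (cbox 0 One) (\<lambda>t. complex_of_real ((norm (\<psi> t))\<^sup>2)) = 0"
    by (simp only: norm_le_zero_iff torus_mean_def complex_norm_square)
  moreover have "integral (cbox 0 One) (\<lambda>t. complex_of_real ((norm (\<psi> t))\<^sup>2)) =
     of_real (integral (cbox 0 One) (\<lambda>t. (norm (\<psi> t))\<^sup>2))"
    by (rule integral_unique, rule has_integral_of_real, rule integrable_integral, rule integrable_continuous)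
      (auto intro!: continuous_intros continuous_on_subset[OF c\<psi>])
  ultimately have "integral (cbox 0 One) (\<lambda>t. (norm (\<psi> t))\<^sup>2) = 0" by simp
  hence "\<forall>t\<in>cbox 0 One. (norm (\<psi> t))\<^sup>2 = 0"
    by (subst (asm) integral_cbox_eq_0_iff)
      (auto intro!: continuous_intros continuous_on_subset[OF c\<psi>] simp: box_ne_empty)
  hence "\<psi> t = 0"
    using intvec_reduce[of t] torus_periodic_intvec[OF p\<psi>] by (metis norm_eq_zero power_eq_0_iff)
  thus ?thesis by (simp add: \<psi>_def)
qed

section \<open>Differentiation under the mean\<close>

lemma torus_mean_has_derivative:
  fixes f :: "real \<Rightarrow> 'a::euclidean_space \<Rightarrow> complex"
  assumes d: "\<And>x t. ((\<lambda>x. f x t) has_vector_derivative f' x t) (at x)"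
    and c: "\<And>x. continuous_on UNIV (f x)" and c': "continuous_on UNIV (\<lambda>(x, t). f' x t)"
  shows "((\<lambda>x. torus_mean (f x)) has_vector_derivative torus_mean (f' x)) (at x)"
  unfolding torus_mean_def
  by (rule leibniz_rule_vector_derivative[where U = UNIV])
    (auto intro: d integrable_torus_mean c continuous_on_subset[OF c'])

text \<open>The mean of the translate by s u does not depend on s; differentiate it at s = 0. This
  is integration by parts on the torus.\<close>

lemma torus_mean_derivative_zero:
  fixes \<phi> :: "'a::euclidean_space \<Rightarrow> complex"
  assumes c: "continuous_on UNIV \<phi>" "torus_periodic \<phi>"
    and d: "\<And>t. ((\<lambda>s. \<phi> (t + s *\<^sub>R u)) has_vector_derivative \<phi>' t) (at 0)"
    and c': "continuous_on UNIV \<phi>'"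
  shows "torus_mean \<phi>' = 0"
proof -
  have d': "((\<lambda>s. \<phi> (t + s *\<^sub>R u)) has_vector_derivative \<phi>' (t + r *\<^sub>R u)) (at r)" for t r
  proof -
    have "((\<lambda>s. \<phi> (t + r *\<^sub>R u + s *\<^sub>R u)) \<circ> (\<lambda>s. s - r) has_vector_derivative 1 *\<^sub>R \<phi>' (t + r *\<^sub>R u)) (at r)"
      by (rule vector_diff_chain_at) (auto intro!: derivative_eq_intros d)
    thus ?thesis by (simp add: o_def algebra_simps)
  qed
  have "((\<lambda>s. torus_mean (\<lambda>t. \<phi> (t + s *\<^sub>R u))) has_vector_derivative torus_mean (\<lambda>t. \<phi>' (t + 0 *\<^sub>R u))) (at 0)"
    by (rule torus_mean_has_derivative[where f' = "\<lambda>r t. \<phi>' (t + r *\<^sub>R u)"])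
      (auto intro!: d' continuous_on_compose2[OF c(1)] continuous_on_compose2[OF c'] continuous_intros
        simp: case_prod_unfold)
  moreover have "torus_mean (\<lambda>t. \<phi> (t + s *\<^sub>R u)) = torus_mean \<phi>" for s by (rule torus_mean_translate[OF c])
  ultimately have "((\<lambda>s::real. torus_mean \<phi>) has_vector_derivative torus_mean \<phi>') (at 0)" by simp
  thus ?thesis using vector_derivative_unique_at has_vector_derivative_const by blast
qed

section \<open>The Nakamura manifold and its metric\<close>

locale nakamura =
  fixes M :: "int^('n::{finite,linorder})^('n::{finite,linorder})"
    and P :: "real^('n::{finite,linorder})^('n::{finite,linorder})"
    and lam :: "'n \<Rightarrow> real" and \<tau> :: real
  assumes det_M: "det M = 1" and inv_P: "invertible P"
    and conj_M: "P ** (\<chi> i j. real_of_int (M $ i $ j)) ** matrix_inv P =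
           (\<chi> i j. if i = j then exp (lam i) else 0)"
    and tau: "\<tau> \<noteq> 0"
begin

abbreviation "L \<equiv> nakamura_lattice P \<tau>"
abbreviation "pr \<equiv> nakamura_proj lam P \<tau>"
abbreviation "atl \<equiv> nakamura_atlas lam P \<tau>"

text \<open>Weight 0 for the coordinate w lets all coordinates be treated alike.\<close>

definition mu :: "'n option \<Rightarrow> real" where
  "mu k = (case k of None \<Rightarrow> 0 | Some i \<Rightarrow> lam i)"

text \<open>The differential of left translation by an element whose base coordinate has real part
  \<open>s\<close>.\<close>

definition scl :: "real \<Rightarrow> complex^('n option) \<Rightarrow> complex^('n option)" where
  "scl s v = (\<chi> k. of_real (exp (mu k * s)) * v $ k)"

definition act :: "complex^('n option) \<Rightarrow> complex^('n option) \<Rightarrow> complex^('n option)" where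
  "act g x = g + scl (Re (g $ None)) x"

definition cc :: "'n option set \<times> 'n option set \<Rightarrow> real" where
  "cc K = sum mu (fst K) + sum mu (snd K)"

lemma mu_simps [simp]: "mu None = 0" "mu (Some i) = lam i"
  by (simp_all add: mu_def)

lemma scl_nth: "scl s v $ k = of_real (exp (mu k * s)) * v $ k"
  by (simp add: scl_def)

lemma scl_0: "scl 0 = id"
  by (simp add: scl_def fun_eq_iff vec_eq_iff)

lemma linear_scl: "linear (scl s)"
  by (rule linearI) (simp_all add: scl_def vec_eq_iff distrib_left)

lemma act_nth: "act g x $ k = g $ k + of_real (exp (mu k * Re (g $ None))) * x $ k"
  by (simp add: act_def scl_nth)

lemma act_0: "act 0 x = x"
  by (simp add: act_def scl_0)

lemma group_mult_act: "g \<otimes>\<^bsub>nakamura_group lam\<^esub> x = act g x"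
  by (simp add: nak_mult wz_eq_iff vec_eq_iff)
    (simp add: w_coord_def z_coords_def act_nth rho_nth mult.commute)

lemma flow: "flow_preserves lam P"
  using diag_flow_real_lattice[OF det_M inv_P conj_M] by (simp add: flow_preserves_def)

lemma pr_eq_iff: "pr x = pr y \<longleftrightarrow> (\<exists>g\<in>L. y = act g x)"
  using proj_eq_iff[OF flow] by (simp add: group_mult_act)

lemma zero_in_L: "0 \<in> L"
  using subgroup.one_closed[OF subgroup_nakamura[OF flow]] by (simp add: nak_carrier)

lemma act_has_derivative: "(act g has_derivative scl (Re (g $ None))) (at x)"
proof -
  have "bounded_linear (scl (Re (g $ None)))"
    using linear_scl by (simp add: linear_conv_bounded_linear)
  thus ?thesis unfolding act_def
    by (auto intro!: derivative_eq_intros bounded_linear_imp_has_derivative)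
qed

lemma covec_scl: "covec t (scl s v) = of_real (exp (mu (index_of t) * s)) * covec t v"
  by (cases t) (simp_all add: scl_nth)

lemma cov_scl: "cov t (map (scl s) vs) = of_real (exp (mu (index_of t) * s)) * cov t vs"
  by (cases vs) (simp_all add: cov_def covec_scl)

lemma es_scl: "es ks (map (scl s) vs) = of_real (exp (s * (\<Sum>t\<leftarrow>ks. mu (index_of t)))) * es ks vs"
proof (induction ks arbitrary: vs)
  case (Cons k ks)
  show ?case
    by (simp add: wedge_map_app cov_scl Cons wedge_scale_left wedge_scale_right)
      (simp add: algebra_simps exp_add)
qed (simp add: ext_one_def)

lemma ee_scl: "ee K (map (scl s) vs) = of_real (exp (s * cc K)) * ee K vs"
proof -
  have "(\<Sum>t\<leftarrow>lst K. mu (index_of t)) = (\<Sum>t\<in>Inl ` fst K \<union> Inr ` snd K. mu (index_of t))"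
    by (simp add: sum_list_distinct_conv_sum_set lst_simps)
  also have "\<dots> = cc K"
    by (subst sum.union_disjoint) (auto simp: sum.reindex cc_def)
  finally show ?thesis by (simp add: ee_def es_scl)
qed

section \<open>Charts and transitions\<close>

lemma atl_cases:
  assumes "c \<in> atl"
  obtains V where "open V" "inj_on pr V" "c = (pr ` V, inv_into V pr)" "chart_image c = V"
proof -
  obtain V where V: "open V" "inj_on pr V" "c = (pr ` V, inv_into V pr)"
    using assms by (auto simp: nakamura_atlas_def)
  moreover have "chart_image c = V" using V by (simp add: chart_image_def)
  ultimately show ?thesis using that by blast
qed

lemma open_chart_image: "c \<in> atl \<Longrightarrow> open (chart_image c)"
  by (auto elim: atl_cases)

lemma ex_chart: "\<exists>c\<in>atl. x \<in> chart_image c"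
proof -
  obtain V where V: "open V" "x \<in> V" "inj_on pr V"
    using proj_locally_inj[OF flow inv_P tau] by blast
  hence "(pr ` V, inv_into V pr) \<in> atl" unfolding nakamura_atlas_def by blast
  moreover have "x \<in> chart_image (pr ` V, inv_into V pr)" using V by (simp add: chart_image_def)
  ultimately show ?thesis by blast
qed

text \<open>Two charts invert the same projection on different sheets of the cover, so near
  \<open>x\<close> the transition is left translation by a lattice element, whose differential
  \<open>scl\<close> is constant.\<close>

lemma transition_act:
  assumes c: "c \<in> atl" "c' \<in> atl" and x: "x \<in> chart_image c" and g: "g \<in> L" "act g x \<in> chart_image c'"
  shows "x \<in> snd c ` (fst c \<inter> fst c')" "transition c c' x = act g x"
    "frechet_derivative (transition c c') (at x) = scl (Re (g $ None))"
proof -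
  obtain V where V: "open V" "inj_on pr V" "c = (pr ` V, inv_into V pr)" "chart_image c = V"
    using c(1) by (rule atl_cases)
  obtain W where W: "open W" "inj_on pr W" "c' = (pr ` W, inv_into W pr)" "chart_image c' = W"
    using c(2) by (rule atl_cases)
  have eq: "pr y = pr (act g y)" for y using pr_eq_iff g by blast
  have tr: "transition c c' y = act g y" if "y \<in> V" "act g y \<in> W" for y
  proof -
    have "inv_into (pr ` V) (inv_into V pr) y = pr y"
      using that(1) V(2) by (metis inj_on_inv_into inv_into_f_f imageI order_refl)
    thus ?thesis using inv_into_f_f[OF W(2) that(2)] eq[of y] by (simp add: transition_def V(3) W(3))
  qed
  show "transition c c' x = act g x" using tr x g V W by simp
  have "pr x \<in> pr ` V \<inter> pr ` W" using x g eq[of x] V W by auto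
  moreover have "x = inv_into V pr (pr x)" using V x by simp
  ultimately show "x \<in> snd c ` (fst c \<inter> fst c')" by (auto simp: V(3) W(3))
  have "continuous_on UNIV (act g)"
    using has_derivative_continuous[OF act_has_derivative] by (simp add: continuous_at_imp_continuous_on)
  hence "open (V \<inter> act g -` W)" using V(1) W(1) by (intro open_Int open_vimage)
  hence "(transition c c' has_derivative scl (Re (g $ None))) (at x)"
    using has_derivative_transform_within_open[OF act_has_derivative, of "V \<inter> act g -` W" x g "transition c c'"]
      tr x g V(4) W(4) by auto
  thus "frechet_derivative (transition c c') (at x) = scl (Re (g $ None))"
    by (rule frechet_derivative_at[symmetric])
qed

lemma transition_exE:
  assumes c: "c \<in> atl" "c' \<in> atl" and x: "x \<in> snd c ` (fst c \<inter> fst c')"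
  obtains g where "g \<in> L" "x \<in> chart_image c" "act g x \<in> chart_image c'"
proof -
  obtain V where V: "open V" "inj_on pr V" "c = (pr ` V, inv_into V pr)" "chart_image c = V"
    using c(1) by (rule atl_cases)
  obtain W where W: "open W" "inj_on pr W" "c' = (pr ` W, inv_into W pr)" "chart_image c' = W"
    using c(2) by (rule atl_cases)
  from x obtain y z where y: "x = inv_into V pr (pr y)" "y \<in> V" "z \<in> W" "pr y = pr z"
    unfolding V(3) W(3) by auto
  hence "x = y" using inv_into_f_f[OF V(2) y(2)] by simp
  moreover obtain g where "g \<in> L" "z = act g y" using y(4) pr_eq_iff by blast
  ultimately show ?thesis using that y V W by auto
qed

section \<open>The left-invariant metric\<close>

definition wt :: "complex^('n option) \<Rightarrow> 'n option \<Rightarrow> real" where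
  "wt x k = exp (- 2 * mu k * Re (x $ None))"

definition nmetric :: "((complex^('n option)) set, 'n option) mmetric" where
  "nmetric c x = hdiag (wt x)"

lemma wt_pos: "wt x k > 0"
  by (simp add: wt_def)

text \<open>Translation by an element with real base part s scales dz_k by e^(mu k s) and shifts Re
  w by s; the weight changes by e^(-2 mu k s), which cancels the square of the scaling.\<close>

lemma hermitian_metric_nmetric: "hermitian_metric atl nmetric"
  unfolding hermitian_metric_def
proof (intro conjI ballI allI)
  fix c x show "hermitian_inner (nmetric c x)"
    by (simp add: nmetric_def hermitian_inner_hdiag wt_pos)
next
  fix c u v
  have "smooth (\<lambda>x. \<Sum>k\<in>UNIV. complex_of_real (exp ((- 2 * mu k) * Re (x $ None))) * (u $ k * cnj (v $ k)))"
    by (intro smooth_sum smooth_simps(2) smooth_simps(4) smooth_exp_Re)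
  from smooth_fun_on_smooth[OF this, of "chart_image c"]
  show "smooth_fun_on (chart_image c) (\<lambda>x. nmetric c x u v)"
    by (simp add: nmetric_def hdiag_def wt_def)
next
  fix c c' x u v assume c: "c \<in> atl" "c' \<in> atl" and x: "x \<in> snd c ` (fst c \<inter> fst c')"
  obtain g where g: "g \<in> L" "x \<in> chart_image c" "act g x \<in> chart_image c'"
    using transition_exE[OF c x] .
  have "wt x k * (exp (mu k * Re (g $ None)) * exp (mu k * Re (g $ None)) * wt (act g x) k) = wt x k * wt x k" for k
    by (simp add: wt_def act_nth flip: exp_add) (simp add: algebra_simps)
  hence *: "complex_of_real (exp (mu k * Re (g $ None)) * exp (mu k * Re (g $ None)) * wt (act g x) k) = of_real (wt x k)" for k
    using wt_pos[of x k] by (metis less_irrefl mult_cancel_left)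
  show "nmetric c x u v = nmetric c' (transition c c' x) (frechet_derivative (transition c c') (at x) u)
      (frechet_derivative (transition c c') (at x) v)"
    unfolding nmetric_def transition_act[OF c g(2,1,3)] hdiag_def
    by (rule sum.cong[OF refl]) (simp add: *[symmetric] scl_nth)
qed

text \<open>The transformation law of the coefficient of \<open>dz\<^sub>I \<and> d\<close>\<open>z\<close>-bar\<open>\<^sub>J\<close> (with \<open>s = c\<^sub>I\<^sub>J\<close>) in a form on the
  quotient, lifted to \<open>\<complex> \<times> \<complex>\<^sup>n\<close>.\<close>

definition automorphic :: "real \<Rightarrow> (complex^('n option) \<Rightarrow> complex) \<Rightarrow> bool" where
  "automorphic s G \<longleftrightarrow> smooth G \<and> (\<forall>g\<in>L. \<forall>x. G (act g x) = of_real (exp (- s * Re (g $ None))) * G x)"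

text \<open>Chart images are open sets of the cover. Transition by the unit of the lattice shows
  that all charts around a point give the same form there, so the local expressions glue to one form
  on the cover. Comparing its coefficients under a general lattice element yields the automorphy
  factor.\<close>

lemma pq_forms_lift:
  assumes \<omega>: "\<omega> \<in> pq_forms atl p q"
  obtains F where "\<And>K. K \<in> idx p q \<Longrightarrow> automorphic (cc K) (F K)"
    "\<And>c x. c \<in> atl \<Longrightarrow> x \<in> chart_image c \<Longrightarrow> \<omega> c x = (\<lambda>vs. \<Sum>K\<in>idx p q. F K x * ee K vs)"
proof -
  have sm: "smooth_pq_form_on p q (chart_image c) (\<omega> c)" if "c \<in> atl" for c
    using \<omega> that by (simp add: pq_forms_def)
  have tr: "\<omega> c x vs = \<omega> c' (act g x) (map (scl (Re (g $ None))) vs)"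
    if "c \<in> atl" "c' \<in> atl" "x \<in> chart_image c" "g \<in> L" "act g x \<in> chart_image c'" for c c' x g vs
  proof -
    have "\<forall>c\<in>atl. \<forall>c'\<in>atl. \<forall>x\<in>snd c ` (fst c \<inter> fst c'). \<forall>vs. \<omega> c x vs =
       \<omega> c' (transition c c' x) (map (frechet_derivative (transition c c') (at x)) vs)"
      using \<omega> unfolding pq_forms_def by (elim CollectE conjE)
    from this[rule_format, OF that(1,2) transition_act(1)[OF that], of vs]
    show ?thesis unfolding transition_act(2,3)[OF that] .
  qed
  define ch where "ch = (\<lambda>x. SOME c. c \<in> atl \<and> x \<in> chart_image c)"
  have ch: "ch x \<in> atl" "x \<in> chart_image (ch x)" for x
    using someI_ex[of "\<lambda>c. c \<in> atl \<and> x \<in> chart_image c"] ex_chart[of x] by (auto simp: ch_def)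
  define \<Omega> where "\<Omega> = (\<lambda>x. \<omega> (ch x) x)"
  have \<Omega>: "\<omega> c x = \<Omega> x" if "c \<in> atl" "x \<in> chart_image c" for c x
    using tr[OF that(1) ch(1) that(2) zero_in_L, of x] ch(2) by (simp add: \<Omega>_def act_0 scl_0 fun_eq_iff)
  have \<Omega>d: "\<omega> (ch x) x = \<Omega> x" for x by (simp add: \<Omega>_def)
  define F where "F = (\<lambda>K x. coef (lst K) (\<Omega> x))"
  have loc: "\<exists>f. (\<forall>K. smooth_fun_on (chart_image c) (f K)) \<and>
      (\<forall>x\<in>chart_image c. \<Omega> x = (\<lambda>vs. \<Sum>K\<in>idx p q. f K x * ee K vs) \<and> (\<forall>K\<in>idx p q. F K x = f K x))"
    if c: "c \<in> atl" for c
  proof -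
    obtain f where f: "\<And>I J. smooth_fun_on (chart_image c) (f I J)"
      "\<And>x. x \<in> chart_image c \<Longrightarrow> \<omega> c x = (\<lambda>vs. \<Sum>I\<in>{I. card I = p}. \<Sum>J\<in>{J. card J = q}. f I J x * dz_dzbar I J vs)"
      using sm[OF c] unfolding smooth_pq_form_on_def by blast
    have 1: "\<Omega> x = (\<lambda>vs. \<Sum>K\<in>idx p q. f (fst K) (snd K) x * ee K vs)" if "x \<in> chart_image c" for x
      using f(2)[OF that] \<Omega>[OF c that] by (simp only: sum_dz_dzbar)
    show ?thesis
      by (rule exI[of _ "\<lambda>K. f (fst K) (snd K)"]) (auto simp: f(1) F_def 1 coef_sum_ee)
  qed
  have exp: "\<Omega> x = (\<lambda>vs. \<Sum>K\<in>idx p q. F K x * ee K vs)" for x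
  proof -
    obtain f where "\<forall>x\<in>chart_image (ch x). \<Omega> x = (\<lambda>vs. \<Sum>K\<in>idx p q. f K x * ee K vs) \<and> (\<forall>K\<in>idx p q. F K x = f K x)"
      using loc[OF ch(1)] by blast
    hence "\<Omega> x = (\<lambda>vs. \<Sum>K\<in>idx p q. f K x * ee K vs)" "\<forall>K\<in>idx p q. F K x = f K x" using ch(2) by blast+
    thus ?thesis by simp
  qed
  have smooth: "smooth (F K)" if K: "K \<in> idx p q" for K
    unfolding smooth_def smooth_fun_on_def
  proof (intro allI Ck_on_local)
    fix k x
    obtain f where f: "smooth_fun_on (chart_image (ch x)) (f K)" "\<forall>y\<in>chart_image (ch x). F K y = f K y"
      using loc[OF ch(1), of x] K by blast
    have "Ck_on k (chart_image (ch x)) (F K)"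
      by (rule Ck_on_cong[OF open_chart_image[OF ch(1)]]) (use f in \<open>auto simp: smooth_fun_on_def\<close>)
    thus "\<exists>U. open U \<and> x \<in> U \<and> Ck_on k U (F K)" using open_chart_image[OF ch(1)] ch(2) by blast
  qed
  have aut: "automorphic (cc K) (F K)" if K: "K \<in> idx p q" for K
    unfolding automorphic_def
  proof (intro conjI ballI allI smooth K)
    fix g x assume g: "g \<in> L"
    let ?s = "Re (g $ None)"
    have "\<Omega> x vs = (\<Sum>K\<in>idx p q. (F K (act g x) * of_real (exp (?s * cc K))) * ee K vs)" for vs
      using tr[OF ch(1) ch(1) ch(2) g ch(2), of x vs] unfolding \<Omega>d exp[of "act g x"]
      by (simp add: ee_scl mult.assoc)
    hence "\<Omega> x = (\<lambda>vs. \<Sum>K\<in>idx p q. (F K (act g x) * of_real (exp (?s * cc K))) * ee K vs)" by blast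
    hence "F K x = F K (act g x) * of_real (exp (?s * cc K))"
      using K by (simp add: F_def[of] coef_sum_ee)
    thus "F K (act g x) = of_real (exp (- cc K * ?s)) * F K x"
      by (simp add: mult.assoc mult.commute[of ?s] flip: exp_add of_real_mult)
  qed
  show ?thesis by (rule that[of F]) (use aut \<Omega> exp in auto)
qed

lemma pq_forms_const:
  assumes "\<And>K. K \<in> idx p q \<Longrightarrow> cc K \<noteq> 0 \<Longrightarrow> a K = 0"
  shows "(\<lambda>c x vs. \<Sum>K\<in>idx p q. a K * ee K vs) \<in> pq_forms atl p q"
  unfolding pq_forms_def
proof (intro CollectI conjI ballI allI)
  fix c
  show "smooth_pq_form_on p q (chart_image c) (\<lambda>x vs. \<Sum>K\<in>idx p q. a K * ee K vs)"
    unfolding smooth_pq_form_on_def sum_dz_dzbar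
    by (rule exI[of _ "\<lambda>I J x. a (I, J)"]) (auto intro: smooth_fun_on_smooth smooth_simps(4))
next
  fix c c' x vs assume c: "c \<in> atl" "c' \<in> atl" and x: "x \<in> snd c ` (fst c \<inter> fst c')"
  obtain g where g: "g \<in> L" "x \<in> chart_image c" "act g x \<in> chart_image c'"
    using transition_exE[OF c x] .
  have "a K * ee K vs = a K * (of_real (exp (Re (g $ None) * cc K)) * ee K vs)" if "K \<in> idx p q" for K
    using assms[OF that] by (cases "cc K = 0") auto
  thus "(\<Sum>K\<in>idx p q. a K * ee K vs) =
      (\<Sum>K\<in>idx p q. a K * ee K (map (frechet_derivative (transition c c') (at x)) vs))"
    unfolding transition_act[OF c g(2,1,3)] ee_scl by (rule sum.cong[OF refl])
qed

end

section \<open>Fourier modes along the fibres\<close>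

text \<open>Otherwise \<xi> involves only directions with \<open>lam j\<close> \<ge> 0. Along the
  backward flow of a lattice vector the pairing with \<xi> then changes by amounts tending to 0.
  These lie in the discrete set 2 pi \<int>, hence vanish eventually for all generators of the
  lattice at once, which forces \<open>\<eta> m = 0\<close>; but its component \<open>i\<close> is
  not 0.\<close>

lemma lattice_frequency_sign:
  fixes P :: "real^'n^'n" and \<xi> :: "real^'n" and lam :: "'n \<Rightarrow> real"
  assumes flow: "flow_preserves lam P" and inv: "invertible P"
    and int: "\<And>u. u \<in> real_lattice P \<Longrightarrow> \<xi> \<bullet> u \<in> range (\<lambda>m::int. 2 * pi * of_int m)"
    and i: "\<xi> $ i \<noteq> 0" "lam i > 0"
  shows "\<exists>j. \<xi> $ j \<noteq> 0 \<and> lam j < 0"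
proof (rule ccontr)
  assume "\<not> ?thesis"
  hence nn: "lam j \<ge> 0 \<or> \<xi> $ j = 0" for j by (meson not_less)
  \<comment> \<open>Taking consecutive differences removes the neutral directions
    \<open>lam j = 0\<close>, which do not decay along the flow.\<close>
  define \<eta> where "\<eta> = (\<lambda>m::nat. (\<chi> j. \<xi> $ j * (exp (- real m * lam j) - exp (- real (Suc m) * lam j))) :: real^'n)"
  have \<eta>0: "\<eta> \<longlonglongrightarrow> 0"
  proof (rule vec_tendstoI)
    fix j
    have "(\<lambda>m. \<xi> $ j * (exp (- real m * lam j) - exp (- real (Suc m) * lam j))) \<longlonglongrightarrow> 0"
    proof (cases "\<xi> $ j = 0 \<or> lam j = 0")
      case False
      hence l: "lam j > 0" using nn[of j] by auto
      have p: "exp (- real m * lam j) = exp (- lam j) ^ m" for m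
        by (simp add: exp_of_nat_mult[symmetric] mult.commute)
      have "(\<lambda>m. exp (- lam j) ^ m) \<longlonglongrightarrow> 0" by (rule LIMSEQ_power_zero) (use l in simp)
      from tendsto_mult_right_zero[OF tendsto_diff[OF this LIMSEQ_Suc[OF this], simplified], of "\<xi> $ j"]
      show ?thesis unfolding p by simp
    qed auto
    thus "(\<lambda>m. \<eta> m $ j) \<longlonglongrightarrow> 0 $ j" by (simp add: \<eta>_def)
  qed
  have ev: "\<forall>\<^sub>F m in sequentially. \<eta> m \<bullet> (P *v axis l 1) = 0" for l
  proof -
    have "(\<lambda>m. \<eta> m \<bullet> (P *v axis l 1)) \<longlonglongrightarrow> 0 \<bullet> (P *v axis l 1)"
      by (intro tendsto_inner \<eta>0 tendsto_const)
    hence "\<forall>\<^sub>F m in sequentially. \<bar>\<eta> m \<bullet> (P *v axis l 1)\<bar> < 2 * pi"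
      using pi_gt_zero by (auto dest!: tendstoD[of _ _ _ "2 * pi"] simp: dist_real_def)
    thus ?thesis
    proof eventually_elim
      case (elim m)
      define u where "u = (\<lambda>k::nat. diag_flow lam (of_int (- int k)) *v (P *v axis l 1))"
      have "P *v axis l 1 = P *v (\<chi> j. of_int ((axis l 1 :: int^'n) $ j))"
        by (rule arg_cong[of _ _ "(*v) P"]) (simp add: vec_eq_iff axis_def)
      hence "P *v axis l 1 \<in> real_lattice P" unfolding real_lattice_def by blast
      hence uL: "u k \<in> real_lattice P" for k
        using flow unfolding u_def flow_preserves_def by blast
      hence d: "u m - u (Suc m) \<in> real_lattice P" by (intro real_lattice_diff)
      have "\<eta> m \<bullet> (P *v axis l 1) = \<xi> \<bullet> (u m - u (Suc m))"
        unfolding inner_vec_def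
        by (intro sum.cong refl) (simp add: \<eta>_def u_def diag_flow_nth algebra_simps)
      also obtain n :: int where "\<xi> \<bullet> (u m - u (Suc m)) = 2 * pi * of_int n" using int[OF d] by auto
      finally have n: "\<eta> m \<bullet> (P *v axis l 1) = 2 * pi * of_int n" .
      hence "2 * pi * \<bar>real_of_int n\<bar> < 2 * pi * 1" using elim by (simp add: abs_mult)
      hence "\<bar>real_of_int n\<bar> < 1" by (subst (asm) mult_less_cancel_left_pos) simp_all
      thus ?case using n by simp
    qed
  qed
  hence "\<forall>\<^sub>F m in sequentially. \<forall>l. \<eta> m \<bullet> (P *v axis l 1) = 0" by (simp add: eventually_all_finite)
  then obtain m where m: "\<And>l. \<eta> m \<bullet> (P *v axis l 1) = 0" by (auto simp: eventually_sequentially)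
  have PP: "P ** matrix_inv P = mat 1"
    using inv unfolding invertible_def matrix_inv_def by (rule someI2_ex) blast
  have all0: "\<eta> m \<bullet> (P *v v) = 0" for v
  proof -
    have "linear (\<lambda>v. \<eta> m \<bullet> (P *v v))"
      by (rule linearI) (simp_all add: matrix_vector_right_distrib inner_add_right matrix_vector_mult_scaleR)
    moreover have "\<eta> m \<bullet> (P *v b) = 0" if "b \<in> Basis" for b
      using that m by (auto simp: Basis_vec_def)
    ultimately show ?thesis
      using linear_eq_on_span[of "\<lambda>v. \<eta> m \<bullet> (P *v v)" "\<lambda>v. 0" Basis v] linear_zero by (simp add: span_Basis)
  qed
  have "\<eta> m = P *v (matrix_inv P *v \<eta> m)" by (simp add: matrix_vector_mul_assoc PP)
  hence "\<eta> m \<bullet> \<eta> m = 0" using all0 by metis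
  hence "\<eta> m $ i = 0" by simp
  hence "exp (- real m * lam i) = exp (- real (Suc m) * lam i)" using i by (simp add: \<eta>_def)
  thus False using i(2) by (simp add: algebra_simps)
qed

lemma flow_preserves_uminus:
  assumes "flow_preserves lam P" shows "flow_preserves (\<lambda>i. - lam i) P"
  unfolding flow_preserves_def
proof (intro allI ballI)
  fix k :: int and x assume x: "x \<in> real_lattice P"
  have "diag_flow (\<lambda>i. - lam i) (of_int k) *v x = diag_flow lam (of_int (- k)) *v x"
    by (simp add: vec_eq_iff diag_flow_nth)
  thus "diag_flow (\<lambda>i. - lam i) (of_int k) *v x \<in> real_lattice P"
    using assms x unfolding flow_preserves_def by metis
qed

type_synonym 'n torus = "real \<times> (real, 'n) vec \<times> (real, 'n) vec"

lemma intvec_torus: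
  "intvec (t :: 'n::finite torus) \<longleftrightarrow> fst t \<in> \<int> \<and> (\<forall>j. fst (snd t) $ j \<in> \<int>) \<and> (\<forall>j. snd (snd t) $ j \<in> \<int>)"
  by (cases t) (auto simp: intvec_def Basis_prod_def Basis_vec_def inner_axis ball_Un)

context nakamura
begin

text \<open>\<open>Lf\<close> parametrises the purely imaginary part of \<open>\<complex>\<close> together with \<open>\<complex>\<^sup>n\<close> so that the lattice of
  integer vectors maps onto the elements of \<open>L\<close> with real base part zero.\<close>

definition Lf :: "'n torus \<Rightarrow> complex^('n option)" where
  "Lf t = (\<chi> k. case k of None \<Rightarrow> Complex 0 (\<tau> * fst t)
     | Some i \<Rightarrow> Complex ((P *v fst (snd t)) $ i) ((P *v snd (snd t)) $ i))"

definition Linv :: "complex^('n option) \<Rightarrow> 'n torus" where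
  "Linv v = (Im (v $ None) / \<tau>, matrix_inv P *v (\<chi> i. Re (v $ Some i)), matrix_inv P *v (\<chi> i. Im (v $ Some i)))"

definition zpt :: "real \<Rightarrow> 'n torus \<Rightarrow> complex^('n option)" where
  "zpt x t = x *\<^sub>R axis None 1 + Lf t"

lemma Lf_simps: "Lf t $ None = Complex 0 (\<tau> * fst t)"
  "Lf t $ Some i = Complex ((P *v fst (snd t)) $ i) ((P *v snd (snd t)) $ i)"
  by (simp_all add: Lf_def)

lemma P_inv: "P ** matrix_inv P = mat 1" "matrix_inv P ** P = mat 1"
  using inv_P unfolding invertible_def matrix_inv_def by (metis (mono_tags, lifting) someI_ex)+

lemma linear_Lf: "linear Lf"
  by (rule linearI)
    (simp_all add: vec_eq_iff split_option_all Lf_simps complex_eq_iff matrix_vector_right_distrib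
      distrib_left matrix_vector_mult_scaleR)

lemma linear_Linv: "linear Linv"
proof (rule linearI)
  have e: "(\<chi> i. Re ((u + v) $ Some i)) = (\<chi> i. Re (u $ Some i)) + (\<chi> i. Re (v $ Some i))"
    "(\<chi> i. Im ((u + v) $ Some i)) = (\<chi> i. Im (u $ Some i)) + (\<chi> i. Im (v $ Some i))"
    "(\<chi> i. Re ((r *\<^sub>R v) $ Some i)) = r *\<^sub>R (\<chi> i. Re (v $ Some i))"
    "(\<chi> i. Im ((r *\<^sub>R v) $ Some i)) = r *\<^sub>R (\<chi> i. Im (v $ Some i))" for u v :: "complex^('n option)" and r
    by (simp_all add: vec_eq_iff)
  show "Linv (u + v) = Linv u + Linv v" for u v
    unfolding Linv_def e by (simp add: matrix_vector_right_distrib add_divide_distrib)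
  show "Linv (r *\<^sub>R v) = r *\<^sub>R Linv v" for r v
    unfolding Linv_def e by (simp add: matrix_vector_mult_scaleR)
qed

lemma Lf_Linv: "Re (v $ None) = 0 \<Longrightarrow> Lf (Linv v) = v"
  using tau by (simp add: vec_eq_iff split_option_all Lf_simps complex_eq_iff Linv_def matrix_vector_mul_assoc P_inv)

lemma Linv_Lf: "Linv (Lf t) = t"
proof -
  have "(\<chi> i. Re (Lf t $ Some i)) = P *v fst (snd t)" "(\<chi> i. Im (Lf t $ Some i)) = P *v snd (snd t)"
    by (simp_all add: Lf_simps vec_eq_iff)
  thus ?thesis using tau by (simp add: Linv_def Lf_simps matrix_vector_mul_assoc P_inv prod_eq_iff)
qed

lemma continuous_Lf: "continuous_on A Lf"
  using linear_Lf by (simp add: linear_continuous_on linear_conv_bounded_linear)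

lemma continuous_zpt: "continuous_on UNIV (\<lambda>t. zpt x t)" "continuous_on UNIV (\<lambda>(x, t). zpt x t)"
proof -
  have "continuous_on A (\<lambda>x. Lf (f x))" if "continuous_on A f" for A and f :: "'b::topological_space \<Rightarrow> 'n torus"
    by (rule continuous_on_compose2[OF continuous_Lf[of UNIV] that]) auto
  thus "continuous_on UNIV (\<lambda>t. zpt x t)" "continuous_on UNIV (\<lambda>(x, t). zpt x t)"
    unfolding zpt_def case_prod_unfold by (intro continuous_intros, blast intro: continuous_intros)+
qed

lemma zpt_None: "Re (zpt x t $ None) = x"
  by (simp add: zpt_def Lf_simps axis_def)

lemma zpt_Linv: "zpt (Re (y $ None)) (Linv y) = y"
  using tau by (simp add: vec_eq_iff split_option_all zpt_def Lf_simps complex_eq_iff Linv_def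
      matrix_vector_mul_assoc P_inv axis_def)

lemma real_lattice_int: "(\<And>j. a $ j \<in> \<int>) \<Longrightarrow> P *v a \<in> real_lattice P"
proof -
  assume a: "\<And>j. a $ j \<in> \<int>"
  have "a = (\<chi> j. of_int ((\<chi> j. \<lfloor>a $ j\<rfloor>) $ j))" using a by (simp add: vec_eq_iff)
  thus ?thesis unfolding real_lattice_def by (metis rangeI)
qed

lemma Lf_in_L: "intvec t \<Longrightarrow> Lf t \<in> L"
proof -
  assume t: "intvec t"
  have "re_vec (z_coords (Lf t)) = P *v fst (snd t)" "im_vec (z_coords (Lf t)) = P *v snd (snd t)"
    by (simp_all add: re_vec_def im_vec_def z_coords_def Lf_simps vec_eq_iff)
  moreover obtain b :: int where "fst t = of_int b" using t unfolding intvec_torus by (metis Ints_cases)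
  ultimately show ?thesis using t
    by (auto simp: nakamura_lattice_def lattice_fibre_iff lattice_base_iff w_coord_def Lf_simps
        real_lattice_int intvec_torus intro!: exI[of _ 0] exI[of _ b])
qed

lemma axis_in_L: "axis None (of_int n) \<in> L"
proof -
  have "re_vec (z_coords (axis None (of_int n) :: complex^('n option))) = 0"
    "im_vec (z_coords (axis None (of_int n) :: complex^('n option))) = 0"
    by (simp_all add: re_vec_def im_vec_def z_coords_def vec_eq_iff axis_def)
  thus ?thesis
    by (auto simp: nakamura_lattice_def lattice_fibre_iff lattice_base_iff w_coord_def axis_def
        real_lattice_0 intro!: exI[of _ n] exI[of _ 0])
qed

lemma act_Lf: "act (Lf s) (zpt x t) = zpt x (t + s)"
  by (simp add: act_def Lf_simps scl_0 zpt_def linear_add[OF linear_Lf])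

section \<open>Growth and derivatives of automorphic functions\<close>

lemma automorphicD:
  assumes "automorphic s G"
  shows "smooth G" "g \<in> L \<Longrightarrow> G (act g x) = of_real (exp (- s * Re (g $ None))) * G x"
  using assms by (simp_all add: automorphic_def)

lemma torus_periodic_automorphic: "automorphic s G \<Longrightarrow> torus_periodic (\<lambda>t. G (zpt x t))"
  unfolding torus_periodic_def
  using automorphicD(2)[of s G "Lf _" "zpt x _"] Lf_in_L[OF intvec_Basis]
  by (simp add: act_Lf Lf_simps)

text \<open>A lattice translation brings any point into a compact fundamental domain. The integer
  part of Re w contributes the exponential, and \<open>exp \<bar>s\<bar>\<close> absorbs the
  fractional part.\<close>

lemma automorphic_bound:
  assumes G: "automorphic s G"
  obtains C where "\<And>y. norm (G y) \<le> C * exp (- s * Re (y $ None))"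
proof -
  define S where "S = (\<lambda>(x, t). zpt x t) ` ({0..1} \<times> cbox 0 One)"
  have "compact S" unfolding S_def
    by (intro compact_continuous_image continuous_on_subset[OF continuous_zpt(2)] compact_Times) auto
  hence "compact (G ` S)" by (intro compact_continuous_image smooth_continuous automorphicD(1)[OF G])
  then obtain B where B: "\<And>y. y \<in> S \<Longrightarrow> norm (G y) \<le> B"
    using compact_imp_bounded[of "G ` S"] unfolding bounded_iff by blast
  have B0: "B \<ge> 0"
  proof -
    have "zpt 0 0 \<in> S" unfolding S_def by (intro image_eqI[of _ _ "(0, 0)"]) (auto simp: mem_box)
    thus ?thesis using B norm_ge_zero order_trans by blast
  qed
  show ?thesis
  proof (rule that)
    fix y :: "complex^('n option)"
    define n where "n = \<lfloor>Re (y $ None)\<rfloor>"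
    define y' where "y' = act (axis None (of_int (- n))) y"
    have Re': "Re (y' $ None) = Re (y $ None) - of_int n" by (simp add: y'_def act_nth axis_def)
    have y': "G y' = of_real (exp (s * of_int n)) * G y"
      unfolding y'_def using automorphicD(2)[OF G axis_in_L[of "- n"], of y] by (simp add: axis_def)
    obtain k where k: "intvec k" "Linv y' + k \<in> cbox 0 One" using intvec_reduce by blast
    have "G y' = G (zpt (Re (y' $ None)) (Linv y' + k))"
      using torus_periodic_intvec[OF torus_periodic_automorphic[OF G] k(1)] zpt_Linv by metis
    moreover have "zpt (Re (y' $ None)) (Linv y' + k) \<in> S"
      unfolding S_def by (rule image_eqI[of _ _ "(Re (y' $ None), Linv y' + k)"])
        (use k(2) in \<open>auto simp: Re' n_def, linarith+\<close>)
    ultimately have "norm (G y') \<le> B" using B by metis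
    hence "exp (s * of_int n) * norm (G y) \<le> B" by (simp add: y' norm_mult)
    hence "norm (G y) \<le> B * exp (- s * of_int n)" by (simp add: exp_minus field_simps)
    also have "\<dots> = B * (exp (s * (Re (y $ None) - of_int n)) * exp (- s * Re (y $ None)))"
      by (simp add: algebra_simps flip: exp_add)
    also have "\<dots> \<le> B * (exp \<bar>s\<bar> * exp (- s * Re (y $ None)))"
    proof -
      have "\<bar>Re (y $ None) - of_int n\<bar> \<le> 1" unfolding n_def by linarith
      hence "\<bar>s\<bar> * \<bar>Re (y $ None) - of_int n\<bar> \<le> \<bar>s\<bar>" by (simp add: mult_left_le)
      hence "s * (Re (y $ None) - of_int n) \<le> \<bar>s\<bar>" by (metis abs_ge_self abs_mult order_trans)
      thus ?thesis using B0 by (intro mult_left_mono mult_right_mono) auto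
    qed
    finally show "norm (G y) \<le> (B * exp \<bar>s\<bar>) * exp (- s * Re (y $ None))" by (simp add: mult.assoc)
  qed
qed

text \<open>A lattice translation stretches \<open>v\<close> by e^(m r), so differentiating the
  transformation law along \<open>v\<close> raises the weight by \<open>m\<close>. This gain per
  derivative is the source of the decay estimates.\<close>

lemma automorphic_dir_deriv:
  assumes G: "automorphic s G" and v: "\<And>r. scl r v = exp (m * r) *\<^sub>R v"
  shows "automorphic (s + m) (dir_deriv v G)"
  unfolding automorphic_def
proof (intro conjI ballI allI)
  show "smooth (dir_deriv v G)" by (rule smooth_dir_deriv[OF automorphicD(1)[OF G]])
  fix g x assume g: "g \<in> L"
  let ?r = "Re (g $ None)"
  note d = smooth_has_derivative[OF automorphicD(1)[OF G]]
  have "((\<lambda>x. G (act g x)) has_derivative (\<lambda>v. dir_deriv (scl ?r v) G (act g x))) (at x)"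
    by (rule has_derivative_compose[OF act_has_derivative d])
  moreover have "((\<lambda>x. G (act g x)) has_derivative (\<lambda>v. of_real (exp (- s * ?r)) * dir_deriv v G x)) (at x)"
    unfolding automorphicD(2)[OF G g] by (intro has_derivative_mult_right d)
  ultimately have "dir_deriv (scl ?r v) G (act g x) = of_real (exp (- s * ?r)) * dir_deriv v G x"
    by (metis has_derivative_unique)
  moreover have "dir_deriv (scl ?r v) G (act g x) = exp (m * ?r) *\<^sub>R dir_deriv v G (act g x)"
    unfolding v by (rule linear_scale[OF dir_deriv_linear]) (rule smooth_differentiable[OF automorphicD(1)[OF G]])
  ultimately have "of_real (exp (m * ?r)) * dir_deriv v G (act g x) = of_real (exp (- s * ?r)) * dir_deriv v G x"
    by (simp add: scaleR_conv_of_real)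
  hence "of_real (exp (- m * ?r)) * (of_real (exp (m * ?r)) * dir_deriv v G (act g x)) =
     of_real (exp (- m * ?r)) * (of_real (exp (- s * ?r)) * dir_deriv v G x)" by simp
  thus "dir_deriv v G (act g x) = of_real (exp (- (s + m) * ?r)) * dir_deriv v G x"
    by (simp add: algebra_simps flip: mult.assoc of_real_mult exp_add)
qed

lemma scl_axis: "scl r (axis k c) = exp (mu k * r) *\<^sub>R axis k c"
  by (simp add: vec_eq_iff scl_nth axis_def) (simp add: scaleR_conv_of_real)

lemma automorphic_lin:
  "automorphic s F \<Longrightarrow> automorphic s G \<Longrightarrow> automorphic s (\<lambda>x. a * F x + b * G x)"
  by (auto simp: automorphic_def smooth_simps algebra_simps)

lemma wirtinger_deriv_eq: "wirtinger_deriv t f = (\<lambda>x. (1/2) * dir_deriv (axis (index_of t) 1) f x +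
    (case t of Inl k \<Rightarrow> -\<i>/2 | Inr k \<Rightarrow> \<i>/2) * dir_deriv (axis (index_of t) \<i>) f x)"
  by (auto simp: wirtinger_deriv_def index_of_def fun_eq_iff field_simps split: sum.splits)

lemma automorphic_wirtinger_deriv: "automorphic s G \<Longrightarrow> automorphic (s + mu (index_of t)) (wirtinger_deriv t G)"
  unfolding wirtinger_deriv_eq by (intro automorphic_lin automorphic_dir_deriv scl_axis)

lemma automorphic_cnj: "automorphic s G \<Longrightarrow> automorphic s (\<lambda>x. cnj (G x))"
  by (auto simp: automorphic_def smooth_simps)

lemma automorphic_exp:
  "automorphic s G \<Longrightarrow> automorphic (s - c) (\<lambda>x. of_real (exp (c * Re (x $ None))) * G x)"
  by (auto simp: automorphic_def smooth_simps smooth_exp_Re act_nth algebra_simps simp flip: exp_add of_real_mult)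

section \<open>Fourier coefficients along the fibres\<close>

definition fourier_coeff :: "'n torus \<Rightarrow> (complex^('n option) \<Rightarrow> complex) \<Rightarrow> real \<Rightarrow> complex" where
  "fourier_coeff k G x = torus_mean (\<lambda>t. G (zpt x t) * character (- k) t)"

text \<open>The angular frequency of the character \<open>k\<close> in direction \<open>v\<close>;
  \<open>Linv\<close> discards the real part of the base coordinate, so the direction of x has
  frequency 0.\<close>

definition freq :: "'n torus \<Rightarrow> complex^('n option) \<Rightarrow> real" where
  "freq k v = 2 * pi * (k \<bullet> Linv v)"

lemma cont_smooth_zpt: "smooth G \<Longrightarrow> continuous_on UNIV (\<lambda>t. G (zpt x t))"
  by (rule continuous_on_compose2[OF smooth_continuous continuous_zpt(1)]) auto

lemma fourier_coeff_lin: "smooth F \<Longrightarrow> smooth G \<Longrightarrow> fourier_coeff k (\<lambda>x. a * F x + b * G x) x = a * fourier_coeff k F x + b * fourier_coeff k G x"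
  unfolding fourier_coeff_def
  by (subst torus_mean_lin[symmetric])
    (auto intro!: continuous_on_mult cont_smooth_zpt continuous_character continuous_on_id simp: algebra_simps)

lemma fourier_coeff_zero: "fourier_coeff k (\<lambda>x. 0) x = 0"
  by (simp add: fourier_coeff_def torus_mean_zero)

lemma fourier_coeff_sum: "(\<And>i. i \<in> A \<Longrightarrow> smooth (F i)) \<Longrightarrow>
    fourier_coeff k (\<lambda>x. \<Sum>i\<in>A. F i x * c i) x = (\<Sum>i\<in>A. fourier_coeff k (F i) x * c i)"
proof (induction A rule: infinite_finite_induct)
  case (insert i A)
  have "smooth (\<lambda>x. \<Sum>i\<in>A. F i x * c i)"
    using insert.prems by (intro smooth_sum smooth_simps(2) smooth_simps(4)) auto
  from fourier_coeff_lin[OF insert.prems[OF insertI1] this, of k "c i" 1]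
  show ?case using insert by (simp add: mult.commute)
qed (simp_all add: fourier_coeff_zero)

lemma fourier_coeff_has_derivative:
  assumes G: "smooth G"
  shows "(fourier_coeff k G has_vector_derivative fourier_coeff k (dir_deriv (axis None 1) G) x) (at x)"
proof -
  have 1: "((\<lambda>x. G (zpt x t)) has_vector_derivative dir_deriv (axis None 1) G (zpt x t)) (at x)" for x t
  proof -
    have "((\<lambda>x. zpt x t) has_vector_derivative axis None 1) (at x)"
      unfolding zpt_def by (auto intro!: derivative_eq_intros)
    from vector_derivative_diff_chain_within[OF this has_derivative_at_withinI[OF smooth_has_derivative[OF G]]]
    show ?thesis by (simp add: o_def)
  qed
  show ?thesis unfolding fourier_coeff_def
  proof (rule torus_mean_has_derivative)
    show "((\<lambda>x. G (zpt x t) * character (- k) t) has_vector_derivative dir_deriv (axis None 1) G (zpt x t) * character (- k) t) (at x)" for x t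
      by (intro has_vector_derivative_mult_left 1)
    have "continuous_on UNIV (\<lambda>p. dir_deriv (axis None 1) G (case p of (x, t) \<Rightarrow> zpt x t))"
      by (rule continuous_on_compose2[OF smooth_continuous[OF smooth_dir_deriv[OF G]] continuous_zpt(2)]) auto
    thus "continuous_on UNIV (\<lambda>(x, t). dir_deriv (axis None 1) G (zpt x t) * character (- k) t)"
      unfolding case_prod_unfold by (intro continuous_on_mult continuous_character continuous_on_snd continuous_on_id)
  qed (intro continuous_on_mult cont_smooth_zpt continuous_character continuous_on_id G)
qed

text \<open>Integration by parts on the fibre torus: the derivative of G times
  \<open>character (- k)\<close> has mean 0, and the part in which the character is differentiated
  produces the frequency.\<close>

lemma fourier_coeff_fibre_derivative:
  assumes G: "automorphic s G" and k: "intvec k" and v: "Re (v $ None) = 0"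
  shows "fourier_coeff k (dir_deriv v G) x = \<i> * of_real (freq k v) * fourier_coeff k G x"
proof -
  define u where "u = Linv v"
  have Lu: "Lf u = v" using Lf_Linv[OF v] by (simp add: u_def)
  note sG = automorphicD(1)[OF G]
  define c where "c = - \<i> * of_real (freq k v)"
  define \<phi>' where "\<phi>' = (\<lambda>t. dir_deriv v G (zpt x t) * character (- k) t + c * (G (zpt x t) * character (- k) t))"
  have "torus_mean \<phi>' = 0"
  proof (rule torus_mean_derivative_zero[where \<phi> = "\<lambda>t. G (zpt x t) * character (- k) t" and u = u])
    show "torus_periodic (\<lambda>t. G (zpt x t) * character (- k) t)"
      using torus_periodic_automorphic[OF G] torus_periodic_character[OF intvec_simps(3)[OF k]] by (simp add: torus_periodic_def)
    fix t
    have "((\<lambda>r. zpt x (t + r *\<^sub>R u)) has_vector_derivative v) (at 0)"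
      unfolding zpt_def linear_add[OF linear_Lf] linear_scale[OF linear_Lf] Lu
      by (auto intro!: derivative_eq_intros)
    from vector_derivative_diff_chain_within[OF this has_derivative_at_withinI[OF smooth_has_derivative[OF sG]]]
    have 1: "((\<lambda>r. G (zpt x (t + r *\<^sub>R u))) has_vector_derivative dir_deriv v G (zpt x t)) (at 0)"
      by (simp add: o_def)
    have 2: "((\<lambda>r. character (- k) (t + r *\<^sub>R u)) has_vector_derivative - \<i> * of_real (freq k v) * character (- k) t) (at 0)"
    proof -
      have eq: "character (- k) (t + r *\<^sub>R u) = character (- k) t * exp (of_real r * (- \<i> * of_real (freq k v)))" for r
        unfolding character_simps(1) by (simp add: character_def cis_conv_exp freq_def u_def algebra_simps)
      have "((\<lambda>r. exp (of_real r * (- \<i> * of_real (freq k v)))) has_vector_derivative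
         exp (of_real 0 * (- \<i> * of_real (freq k v))) * (- \<i> * of_real (freq k v))) (at 0)"
        by (rule has_vector_derivative_real_field) (auto intro!: derivative_eq_intros)
      from has_vector_derivative_mult_right[OF this, of "character (- k) t"]
      show ?thesis unfolding eq by (simp add: mult_ac)
    qed
    show "((\<lambda>r. G (zpt x (t + r *\<^sub>R u)) * character (- k) (t + r *\<^sub>R u)) has_vector_derivative \<phi>' t) (at 0)"
      using has_vector_derivative_mult[OF 1 2] by (simp add: \<phi>'_def c_def algebra_simps)
  qed (auto simp: \<phi>'_def intro!: continuous_on_add continuous_on_mult continuous_on_const cont_smooth_zpt continuous_character continuous_on_id sG smooth_dir_deriv)
  moreover have "torus_mean \<phi>' = fourier_coeff k (dir_deriv v G) x + c * fourier_coeff k G x"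
    unfolding \<phi>'_def fourier_coeff_def
    by (subst torus_mean_add)
      (auto simp: torus_mean_scale intro!: continuous_on_mult continuous_on_const cont_smooth_zpt continuous_character continuous_on_id sG smooth_dir_deriv)
  ultimately show ?thesis by (simp add: c_def add_eq_0_iff2)
qed

text \<open>On the mode of frequency \<open>k\<close> the Wirtinger derivative in direction \<open>t\<close> acts as \<open>av t \<cdot> d/dx + bv k t\<close>.\<close>

definition av :: "'n option + 'n option \<Rightarrow> complex" where
  "av t = (if index_of t = None then 1/2 else 0)"

definition bv :: "'n torus \<Rightarrow> 'n option + 'n option \<Rightarrow> complex" where
  "bv k t = \<i> / 2 * of_real (freq k (axis (index_of t) 1)) +
     (case t of Inl _ \<Rightarrow> 1/2 | Inr _ \<Rightarrow> -1/2) * of_real (freq k (axis (index_of t) \<i>))"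

lemma linear_freq: "linear (freq k)" unfolding freq_def
  by (rule linearI) (simp_all add: linear_add[OF linear_Linv] linear_scale[OF linear_Linv] inner_add_right algebra_simps)

lemma freq_uminus: "freq (- k) v = - freq k v"
  by (simp add: freq_def)

lemma bv_uminus: "bv (- k) t = - bv k t"
  by (simp add: bv_def freq_uminus)

lemma freq_axis_None: "freq k (axis None 1) = 0"
proof -
  have "(\<chi> i. Re (axis None 1 $ Some i)) = (0 :: (real, 'n) vec)" "(\<chi> i. Im (axis None 1 $ Some i)) = (0 :: (real, 'n) vec)"
    by (simp_all add: vec_eq_iff axis_def)
  hence "Linv (axis None 1) = 0" by (simp add: Linv_def axis_def zero_prod_def)
  thus ?thesis by (simp add: freq_def)
qed

lemma fourier_coeff_wirtinger_deriv:
  assumes G: "automorphic s G" and k: "intvec k"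
  shows "fourier_coeff k (wirtinger_deriv t G) x = av t * fourier_coeff k (dir_deriv (axis None 1) G) x + bv k t * fourier_coeff k G x"
proof -
  note sG = automorphicD(1)[OF G]
  have *: "fourier_coeff k (wirtinger_deriv t G) x = (1/2) * fourier_coeff k (dir_deriv (axis (index_of t) 1) G) x +
    (case t of Inl k \<Rightarrow> -\<i>/2 | Inr k \<Rightarrow> \<i>/2) * fourier_coeff k (dir_deriv (axis (index_of t) \<i>) G) x"
    unfolding wirtinger_deriv_eq by (intro fourier_coeff_lin smooth_dir_deriv sG)
  have i: "fourier_coeff k (dir_deriv (axis (index_of t) \<i>) G) x = \<i> * of_real (freq k (axis (index_of t) \<i>)) * fourier_coeff k G x"
    by (rule fourier_coeff_fibre_derivative[OF G k]) (simp add: axis_def)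
  show ?thesis
  proof (cases "index_of t = None")
    case True
    show ?thesis unfolding * i unfolding bv_def av_def True
      by (simp add: freq_axis_None split: sum.splits)
  next
    case False
    have 1: "fourier_coeff k (dir_deriv (axis (index_of t) 1) G) x = \<i> * of_real (freq k (axis (index_of t) 1)) * fourier_coeff k G x"
      by (rule fourier_coeff_fibre_derivative[OF G k]) (use False in \<open>cases "index_of t"; simp add: axis_def\<close>)
    show ?thesis unfolding * i 1 using False by (auto simp: bv_def av_def algebra_simps split: sum.splits)
  qed
qed

lemma fourier_coeff_bound:
  assumes G: "automorphic s G"
  obtains C where "\<And>x. norm (fourier_coeff k G x) \<le> C * exp (- s * x)"
proof -
  obtain C where C: "\<And>y. norm (G y) \<le> C * exp (- s * Re (y $ None))"
    using automorphic_bound[OF G] by blast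
  have "norm (fourier_coeff k G x) \<le> C * exp (- s * x)" for x
    unfolding fourier_coeff_def
  proof (rule torus_mean_bound)
    show "norm (G (zpt x t) * character (- k) t) \<le> C * exp (- s * x)" for t
      using C[of "zpt x t"] by (simp add: norm_mult zpt_None)
  qed (intro continuous_on_mult cont_smooth_zpt continuous_character continuous_on_id automorphicD(1)[OF G])
  thus ?thesis using that by blast
qed

text \<open>Each derivative along \<open>v\<close> multiplies the mode by the nonzero constant \<i>
  \<open>freq k v\<close>, yet raises the weight by \<open>lam i\<close>; so the exponential bound
  gains a factor e^(- lam i x) at the price of a constant.\<close>

lemma fourier_coeff_bound_iterated:
  assumes G: "automorphic s G" and k: "intvec k" and v: "v = axis (Some i) c" "freq k v \<noteq> 0"
  obtains C where "\<And>x. norm (fourier_coeff k G x) \<le> C * exp (- (s + real N * lam i) * x)"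
proof -
  have aut: "automorphic (s + real N * lam i) ((dir_deriv v ^^ N) G)" for N
  proof (induction N)
    case (Suc N)
    from automorphic_dir_deriv[OF Suc scl_axis[of _ "Some i" c]] v(1) show ?case by (simp add: algebra_simps)
  qed (simp add: G)
  have "fourier_coeff k ((dir_deriv v ^^ N) G) x = (\<i> * of_real (freq k v)) ^ N * fourier_coeff k G x" for x
  proof (induction N)
    case (Suc N)
    have "fourier_coeff k (dir_deriv v ((dir_deriv v ^^ N) G)) x = \<i> * of_real (freq k v) * fourier_coeff k ((dir_deriv v ^^ N) G) x"
      by (rule fourier_coeff_fibre_derivative[OF aut k]) (simp add: v(1) axis_def)
    thus ?case using Suc by simp
  qed simp
  hence n: "norm (fourier_coeff k ((dir_deriv v ^^ N) G) x) = \<bar>freq k v\<bar> ^ N * norm (fourier_coeff k G x)" for x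
    by (simp add: norm_mult norm_power)
  obtain C where C: "\<And>x. norm (fourier_coeff k ((dir_deriv v ^^ N) G) x) \<le> C * exp (- (s + real N * lam i) * x)"
    using fourier_coeff_bound[OF aut] by blast
  show ?thesis
  proof (rule that)
    fix x
    show "norm (fourier_coeff k G x) \<le> (C / \<bar>freq k v\<bar> ^ N) * exp (- (s + real N * lam i) * x)"
      using C[of x] v(2) unfolding n by (simp add: field_simps)
  qed
qed

section \<open>Decay and periodicity of the modes\<close>

definition superdecay :: "(real \<Rightarrow> complex) \<Rightarrow> bool" where
  "superdecay f \<longleftrightarrow> (\<forall>N::nat. \<exists>C. \<forall>x. norm (f x) \<le> C * exp (- real N * \<bar>x\<bar>))"

lemma fourier_coeff_superdecay:
  assumes G: "automorphic s G" and k: "intvec k"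
    and i: "freq k (axis (Some i) c) \<noteq> 0" "lam i > 0" and j: "freq k (axis (Some j) d) \<noteq> 0" "lam j < 0"
  shows "superdecay (fourier_coeff k G)"
  unfolding superdecay_def
proof
  fix N :: nat
  \<comment> \<open>Enough derivatives in the expanding direction control x \<ge> 0, enough in the
    contracting direction control x < 0.\<close>
  obtain n where n: "real n > (real N - s) / lam i" using reals_Archimedean2 by blast
  obtain m where m: "real m > (real N + s) / (- lam j)" using reals_Archimedean2 by blast
  have n': "s + real n * lam i \<ge> real N" using n i(2) by (simp add: field_simps)
  have m': "s + real m * lam j \<le> - real N"
  proof -
    have "real N + s < real m * (- lam j)" using m j(2) by (subst (asm) pos_divide_less_eq) auto
    thus ?thesis by simp
  qed
  obtain C1 where C1: "\<And>x. norm (fourier_coeff k G x) \<le> C1 * exp (- (s + real n * lam i) * x)"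
    using fourier_coeff_bound_iterated[OF G k refl i(1)] by blast
  obtain C2 where C2: "\<And>x. norm (fourier_coeff k G x) \<le> C2 * exp (- (s + real m * lam j) * x)"
    using fourier_coeff_bound_iterated[OF G k refl j(1)] by blast
  have pos: "C1 \<ge> 0" "C2 \<ge> 0" using order_trans[OF norm_ge_zero C1[of 0]] order_trans[OF norm_ge_zero C2[of 0]] by simp_all
  have "norm (fourier_coeff k G x) \<le> (C1 + C2) * exp (- real N * \<bar>x\<bar>)" for x
  proof (cases "x \<ge> 0")
    case True
    have "- (s + real n * lam i) * x \<le> - real N * x"
      using mult_right_mono[OF n' True] by (simp add: algebra_simps)
    hence "norm (fourier_coeff k G x) \<le> C1 * exp (- real N * x)"
      using pos by (intro order_trans[OF C1] mult_left_mono) auto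
    also have "\<dots> \<le> (C1 + C2) * exp (- real N * \<bar>x\<bar>)" using True pos by (simp add: mult_right_mono)
    finally show ?thesis .
  next
    case False
    have "- (s + real m * lam j) * x \<le> real N * x"
      using mult_right_mono_neg[of "real N" "- (s + real m * lam j)" x] m' False by simp
    hence "norm (fourier_coeff k G x) \<le> C2 * exp (real N * x)"
      using pos by (intro order_trans[OF C2] mult_left_mono) auto
    also have "\<dots> \<le> (C1 + C2) * exp (- real N * \<bar>x\<bar>)" using False pos by (simp add: mult_right_mono)
    finally show ?thesis .
  qed
  thus "\<exists>C. \<forall>x. norm (fourier_coeff k G x) \<le> C * exp (- real N * \<bar>x\<bar>)" by blast
qed

text \<open>The frequencies in the directions \<open>axis (Some j) c\<close> form a covector with
  values in 2 pi \<int> on the lattice; \<open>c\<close> selects the real or the imaginary copy of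
  the lattice. \<open>lattice_frequency_sign\<close> then applies to the flow or to its inverse,
  according to the sign of \<open>lam i\<close>.\<close>

lemma freq_sign:
  assumes k: "intvec k" and c: "c \<in> {1, \<i>}" and i: "freq k (axis (Some i) c) \<noteq> 0" "lam i \<noteq> 0"
  obtains i' j' where "freq k (axis (Some i') c) \<noteq> 0" "lam i' > 0" "freq k (axis (Some j') c) \<noteq> 0" "lam j' < 0"
proof -
  define \<xi> :: "(real, 'n) vec" where "\<xi> = (\<chi> j. freq k (axis (Some j) c))"
  note lin = linear_freq[of k]
  have int: "\<xi> \<bullet> u \<in> range (\<lambda>m::int. 2 * pi * of_int m)" if u: "u \<in> real_lattice P" for u
  proof -
    obtain a :: "(int, 'n) vec" where a: "u = P *v (\<chi> j. of_int (a $ j))"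
      using u unfolding real_lattice_def by (elim rangeE)
    define t :: "'n torus" where "t = (if c = 1 then (0, (\<chi> j. of_int (a $ j)), 0) else (0, 0, (\<chi> j. of_int (a $ j))))"
    have "intvec t" by (simp add: intvec_torus t_def)
    then obtain m :: int where m: "k \<bullet> t = of_int m" using intvec_inner_Ints[OF k] by (metis Ints_cases)
    have "(\<Sum>j\<in>UNIV. u $ j *\<^sub>R axis (Some j) c) $ l = Lf t $ l" for l
    proof (cases l)
      case None thus ?thesis by (simp add: Lf_simps t_def sum_component axis_def complex_eq_iff)
    next
      case (Some l')
      have "(\<Sum>j\<in>UNIV. (u $ j *\<^sub>R axis (Some j) c) $ Some l') = (\<Sum>j\<in>UNIV. if j = l' then u $ j *\<^sub>R c else 0)"
        by (rule sum.cong) (auto simp: axis_def)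
      thus ?thesis using c Some by (auto simp: Lf_simps t_def sum_component a[symmetric] complex_eq_iff)
    qed
    hence "Lf t = (\<Sum>j\<in>UNIV. u $ j *\<^sub>R axis (Some j) c)" by (simp add: vec_eq_iff)
    hence "freq k (Lf t) = (\<Sum>j\<in>UNIV. u $ j * \<xi> $ j)"
      by (simp add: linear_sum[OF lin] linear_scale[OF lin] \<xi>_def)
    hence "\<xi> \<bullet> u = freq k (Lf t)" by (simp add: inner_vec_def mult.commute)
    thus ?thesis by (simp add: freq_def Linv_Lf m)
  qed
  show ?thesis
  proof (cases "lam i > 0")
    case True
    have "\<exists>j. \<xi> $ j \<noteq> 0 \<and> lam j < 0"
      by (rule lattice_frequency_sign[OF flow inv_P int _ True]) (use i in \<open>simp_all add: \<xi>_def\<close>)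
    thus ?thesis using that i True by (auto simp: \<xi>_def)
  next
    case False
    have "\<exists>j. \<xi> $ j \<noteq> 0 \<and> - lam j < 0"
      by (rule lattice_frequency_sign[OF flow_preserves_uminus[OF flow] inv_P int, of i]) (use i False in \<open>simp_all add: \<xi>_def\<close>)
    thus ?thesis using that i False by (auto simp: \<xi>_def)
  qed
qed

text \<open>The shift by 1 acts on the fibre torus through \<open>M\<close>. If \<open>k\<close>
  sees only neutral directions, its character is invariant under this action, so the integer change
  of variables returns the same mode times the automorphy factor.\<close>

lemma fourier_coeff_shift:
  assumes G: "automorphic s G" and k: "intvec k"
    and fixd: "\<And>i c. c \<in> {1, \<i>} \<Longrightarrow> freq k (axis (Some i) c) \<noteq> 0 \<Longrightarrow> lam i = 0"
  shows "fourier_coeff k G (x + 1) = of_real (exp (- s)) * fourier_coeff k G x"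
proof -
  let ?R = "\<chi> i j. real_of_int (M $ i $ j)"
  define A :: "'n torus \<Rightarrow> 'n torus" where "A = (\<lambda>t. (fst t, ?R *v fst (snd t), ?R *v snd (snd t)))"
  have linA: "linear A" by (rule linearI)
      (simp_all add: A_def matrix_vector_right_distrib matrix_vector_mult_scaleR)
  have "surj A"
  proof -
    obtain M' :: "((int, 'n) vec, 'n) vec" where M': "?R ** (\<chi> i j. real_of_int (M' $ i $ j)) = mat 1"
      using int_matrix_right_inverse[OF det_M] .
    let ?R' = "\<chi> i j. real_of_int (M' $ i $ j)"
    have "A (fst t, ?R' *v fst (snd t), ?R' *v snd (snd t)) = t" for t
      by (simp add: A_def matrix_vector_mul_assoc M')
    thus ?thesis by (rule surjI)
  qed
  have intA: "intvec (A t)" if "intvec t" for t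
    using that by (auto simp: intvec_torus A_def matrix_vector_mult_def intro!: Ints_sum Ints_mult)
  have PR: "(P *v (?R *v y)) $ i = exp (lam i) * (P *v y) $ i" for y i
  proof -
    have e1: "diag_flow lam 1 = P ** ?R ** matrix_inv P" unfolding conj_M by (simp add: vec_eq_iff diag_flow_def)
    have "diag_flow lam 1 ** P = P ** ?R" unfolding e1 matrix_mul_assoc[symmetric] P_inv by simp
    hence "diag_flow lam 1 *v (P *v y) = P *v (?R *v y)" by (simp only: matrix_vector_mul_assoc)
    thus ?thesis using diag_flow_nth[of lam 1 "P *v y" i] by simp
  qed
  have LA: "Lf (A t) = scl 1 (Lf t)" for t
    by (simp add: vec_eq_iff split_option_all Lf_simps A_def PR scl_nth complex_eq_iff del: of_real_exp)
  have zA: "zpt (x + 1) (A t) = act (axis None (of_int 1)) (zpt x t)" for t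
    by (simp add: vec_eq_iff split_option_all zpt_def LA act_nth scl_nth axis_def scaleR_conv_of_real)
  have kA: "character (- k) (A t) = character (- k) t" for t
  proof -
    have lin: "linear (\<lambda>v. complex_of_real (freq k v))"
      by (rule linear_compose[OF linear_freq bounded_linear.linear[OF bounded_linear_of_real], unfolded o_def])
    have "complex_of_real (freq k (scl 1 (Lf t))) = of_real (freq k (Lf t))"
      unfolding real_linear_expand[OF lin, of "scl 1 (Lf t)"] real_linear_expand[OF lin, of "Lf t"]
    proof (rule sum.cong[OF refl])
      fix l
      show "of_real (Re (scl 1 (Lf t) $ l)) * complex_of_real (freq k (axis l 1)) +
          of_real (Im (scl 1 (Lf t) $ l)) * complex_of_real (freq k (axis l \<i>)) =
          of_real (Re (Lf t $ l)) * of_real (freq k (axis l 1)) + of_real (Im (Lf t $ l)) * of_real (freq k (axis l \<i>))"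
      proof (cases l)
        case (Some i)
        have "freq k (axis (Some i) 1) = 0" "freq k (axis (Some i) \<i>) = 0" if "lam i \<noteq> 0"
          using fixd that by blast+
        thus ?thesis using Some by (cases "lam i = 0") (simp_all add: scl_nth)
      qed (simp add: scl_nth)
    qed
    hence "freq k (Lf (A t)) = freq k (Lf t)" by (simp add: LA)
    hence "k \<bullet> A t = k \<bullet> t" by (simp add: freq_def Linv_Lf)
    thus ?thesis by (simp add: character_def)
  qed
  have "fourier_coeff k G (x + 1) = torus_mean (\<lambda>t. G (zpt (x + 1) (A t)) * character (- k) (A t))"
    unfolding fourier_coeff_def
  proof (rule torus_mean_linear_image[symmetric])
    show "torus_periodic (\<lambda>t. G (zpt (x + 1) t) * character (- k) t)"
      using torus_periodic_automorphic[OF G] torus_periodic_character[OF intvec_simps(3)[OF k]] by (simp add: torus_periodic_def)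
  qed (auto intro!: continuous_on_mult cont_smooth_zpt continuous_character continuous_on_id automorphicD(1)[OF G]
      linA \<open>surj A\<close> intA[OF intvec_Basis])
  also have "\<dots> = torus_mean (\<lambda>t. of_real (exp (- s)) * (G (zpt x t) * character (- k) t))"
    unfolding zA kA automorphicD(2)[OF G axis_in_L] by (simp add: axis_def mult.assoc)
  finally show ?thesis by (simp add: torus_mean_scale fourier_coeff_def)
qed

lemma fourier_coeff_unique:
  assumes G: "automorphic s G" and 0: "\<And>k. intvec k \<Longrightarrow> k \<noteq> 0 \<Longrightarrow> fourier_coeff k G x = 0"
  shows "G (zpt x t) = fourier_coeff 0 G x"
  using fourier_unique[OF cont_smooth_zpt[OF automorphicD(1)[OF G]] torus_periodic_automorphic[OF G], of x t] 0
  by (simp add: fourier_coeff_def character_0)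

end

section \<open>The energy identity\<close>

lemma has_vector_derivative_wedge:
  assumes "\<And>us. ((\<lambda>x. \<alpha> x us) has_vector_derivative \<alpha>1 us) (at x)"
    "\<And>us. ((\<lambda>x. \<beta> x us) has_vector_derivative \<beta>1 us) (at x)"
  shows "((\<lambda>x. wedge (\<alpha> x) (\<beta> x) vs) has_vector_derivative
    (wedge \<alpha>1 (\<beta> x) vs + wedge (\<alpha> x) \<beta>1 vs)) (at x)"
proof -
  have "((\<lambda>x. wedge (\<alpha> x) (\<beta> x) vs) has_vector_derivative (\<Sum>S\<in>Pow {..<length vs}.
      (-1) ^ card {(i, j). i < j \<and> i \<in> {..<length vs} - S \<and> j \<in> S} *
      (\<alpha> x (nths vs S) * \<beta>1 (nths vs (- S)) + \<alpha>1 (nths vs S) * \<beta> x (nths vs (- S))))) (at x)"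
    unfolding wedge_def mult.assoc
    by (intro has_vector_derivative_sum has_vector_derivative_mult_right has_vector_derivative_mult assms)
  thus ?thesis
    by (simp add: wedge_def sum.distrib[symmetric] algebra_simps)
qed

lemma has_vector_derivative_wedge_const:
  assumes "\<And>us. ((\<lambda>x. \<beta> x us) has_vector_derivative \<beta>1 us) (at x)"
  shows "((\<lambda>x. wedge \<alpha> (\<beta> x) vs) has_vector_derivative wedge \<alpha> \<beta>1 vs) (at x)"
  using has_vector_derivative_wedge[of "\<lambda>_. \<alpha>" "\<lambda>_. 0" x \<beta> \<beta>1 vs] assms by simp

lemma has_vector_derivative_iota:
  assumes "\<And>us. ((\<lambda>x. \<beta> x us) has_vector_derivative \<beta>1 us) (at x)"
  shows "((\<lambda>x. iota t (\<beta> x) vs) has_vector_derivative iota t \<beta>1 vs) (at x)"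
  unfolding iota_def
  by (cases t) (auto intro!: has_vector_derivative_divide has_vector_derivative_diff has_vector_derivative_add
      has_vector_derivative_mult_right assms)

text \<open>The action of \<partial> (\<open>u = Inl\<close>) or \<partial>bar
  (\<open>u = Inr\<close>) on one mode, where each Wirtinger derivative is a d/dx + b;
  \<open>\<beta>1\<close> stands for the x-derivative of \<open>\<beta>\<close>.\<close>

definition dop :: "('m \<Rightarrow> 'm + 'm) \<Rightarrow> ('m + 'm \<Rightarrow> complex) \<Rightarrow> ('m + 'm \<Rightarrow> complex) \<Rightarrow> 'm ext \<Rightarrow> 'm ext \<Rightarrow> 'm::finite ext" where
  "dop u a b \<beta>1 \<beta> = (\<lambda>vs. \<Sum>k\<in>UNIV. wedge (cov (u k)) (\<lambda>us. a (u k) * \<beta>1 us + b (u k) * \<beta> us) vs)"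

text \<open>An algebraic Cartan formula: contraction anticommutes with \<open>dop\<close> up to the
  symbol of the contracted direction.\<close>

lemma iota_dop:
  assumes "inj u"
  shows "iota t (dop u a b \<beta>1 \<beta>) vs = (if t \<in> range u then a t * \<beta>1 vs + b t * \<beta> vs else 0)
    - dop u a b (iota t \<beta>1) (iota t \<beta>) vs"
proof -
  have "iota t (dop u a b \<beta>1 \<beta>) vs = (\<Sum>k\<in>UNIV. iota t (wedge (cov (u k)) (\<lambda>us. a (u k) * \<beta>1 us + b (u k) * \<beta> us)) vs)"
    unfolding dop_def by (simp add: iota_sum[of _ "\<lambda>_. 1", simplified])
  also have "\<dots> = (\<Sum>k\<in>UNIV. if u k = t then a t * \<beta>1 vs + b t * \<beta> vs else 0) - dop u a b (iota t \<beta>1) (iota t \<beta>) vs"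
    unfolding iota_wedge_cov dop_def iota_linear sum_subtractf by (intro arg_cong2[of _ _ _ _ minus] sum.cong) auto
  also have "(\<Sum>k\<in>UNIV. if u k = t then a t * \<beta>1 vs + b t * \<beta> vs else 0) =
      (if t \<in> range u then a t * \<beta>1 vs + b t * \<beta> vs else 0)"
  proof (cases "t \<in> range u")
    case True
    then obtain j where j: "t = u j" by blast
    have "u k = t \<longleftrightarrow> k = j" for k using assms j by (auto dest: injD)
    thus ?thesis using True by simp
  next
    case False
    hence "u k \<noteq> t" for k by blast
    thus ?thesis using False by simp
  qed
  finally show ?thesis .
qed

lemma dop_scale: "dop u a b (\<lambda>vs. c * \<beta>1 vs) (\<lambda>vs. c * \<beta> vs) vs = c * dop u a b \<beta>1 \<beta> vs"
proof -
  have "wedge (cov (u k)) (\<lambda>us. a (u k) * (c * \<beta>1 us) + b (u k) * (c * \<beta> us)) vs =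
     c * wedge (cov (u k)) (\<lambda>us. a (u k) * \<beta>1 us + b (u k) * \<beta> us) vs" for k
    unfolding wedge_scale_right[symmetric] by (simp add: algebra_simps)
  thus ?thesis by (simp add: dop_def sum_distrib_left)
qed

lemma has_vector_derivative_dop:
  assumes "\<And>us. ((\<lambda>x. \<beta> x us) has_vector_derivative \<beta>1 x us) (at x)"
    "\<And>us. ((\<lambda>x. \<beta>1 x us) has_vector_derivative \<beta>2 x us) (at x)"
  shows "((\<lambda>x. dop u a b (\<beta>1 x) (\<beta> x) vs) has_vector_derivative dop u a b (\<beta>2 x) (\<beta>1 x) vs) (at x)"
  unfolding dop_def
  by (intro has_vector_derivative_sum has_vector_derivative_wedge_const has_vector_derivative_add
      has_vector_derivative_mult_right assms)

text \<open>A product of two covectors is even, so it passes \<gamma> without a sign.\<close>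

lemma wedge_cov_cov_left:
  "wedge (wedge (cov k) (wedge (cov l) \<gamma>)) \<theta> = wedge \<gamma> (wedge (cov k) (wedge (cov l) \<theta>))"
  by (simp only: wedge_assoc wedge_cov_commute[of \<gamma> k] wedge_cov_commute[of "grade_inv \<gamma>" l] grade_inv_grade_inv)

text \<open>What remains when the x-derivatives in \<partial>\<partial>bar are shifted from \<gamma>
  to \<theta>: a Wronskian for the second-order symbol and a plain product for the first-order
  one.\<close>

definition bdry :: "('m + 'm \<Rightarrow> complex) \<Rightarrow> ('m + 'm \<Rightarrow> complex) \<Rightarrow> 'm ext \<Rightarrow> 'm ext \<Rightarrow> 'm ext \<Rightarrow> 'm ext \<Rightarrow> 'm::finite ext" where
  "bdry a b \<gamma> \<gamma>1 \<theta> \<theta>1 = (\<lambda>vs. \<Sum>k\<in>UNIV. \<Sum>l\<in>UNIV.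
     a (Inl k) * a (Inr l) * (wedge (wedge (cov (Inl k)) (wedge (cov (Inr l)) \<gamma>1)) \<theta> vs -
        wedge (wedge (cov (Inl k)) (wedge (cov (Inr l)) \<gamma>)) \<theta>1 vs) +
     (a (Inl k) * b (Inr l) + b (Inl k) * a (Inr l)) *
        wedge (wedge (cov (Inl k)) (wedge (cov (Inr l)) \<gamma>)) \<theta> vs)"

text \<open>Integration by parts for \<open>\<partial>\<close>\<open>\<partial>\<close>-bar on a single Fourier mode. If the mode \<open>\<beta>\<close> is \<open>\<partial>\<close>- and
  \<open>\<partial>\<close>-bar-closed, then contracting it with two constant vector fields on which the symbols \<open>b\<close> do not
  vanish gives an explicit \<open>\<partial>\<close>\<open>\<partial>\<close>-bar-primitive.\<close>

lemma energy_identity: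
  fixes \<beta> \<beta>1 \<beta>2 \<theta> \<theta>1 \<theta>2 :: "real \<Rightarrow> 'm::finite ext" and a b :: "'m + 'm \<Rightarrow> complex"
  assumes d\<beta>: "\<And>x vs. ((\<lambda>x. \<beta> x vs) has_vector_derivative \<beta>1 x vs) (at x)"
    and d\<beta>1: "\<And>x vs. ((\<lambda>x. \<beta>1 x vs) has_vector_derivative \<beta>2 x vs) (at x)"
    and d\<theta>: "\<And>x vs. ((\<lambda>x. \<theta> x vs) has_vector_derivative \<theta>1 x vs) (at x)"
    and d\<theta>1: "\<And>x vs. ((\<lambda>x. \<theta>1 x vs) has_vector_derivative \<theta>2 x vs) (at x)"
    and D: "\<And>x vs. dop Inl a b (\<beta>1 x) (\<beta> x) vs = 0"
    and Db: "\<And>x vs. dop Inr a b (\<beta>1 x) (\<beta> x) vs = 0"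
    and DD: "\<And>x vs. (\<Sum>k\<in>UNIV. \<Sum>l\<in>UNIV. wedge (cov (Inl k)) (wedge (cov (Inr l))
        (\<lambda>us. a (Inl k) * a (Inr l) * \<theta>2 x us - (a (Inl k) * b (Inr l) + b (Inl k) * a (Inr l)) * \<theta>1 x us
          + b (Inl k) * b (Inr l) * \<theta> x us)) vs) = 0"
    and a0: "a (Inl i) = 0" "a (Inr j) = 0"
  defines "\<gamma> \<equiv> \<lambda>x. iota (Inr j) (iota (Inl i) (\<beta> x))" and "\<gamma>1 \<equiv> \<lambda>x. iota (Inr j) (iota (Inl i) (\<beta>1 x))"
  shows "((\<lambda>x. bdry a b (\<gamma> x) (\<gamma>1 x) (\<theta> x) (\<theta>1 x) vs) has_vector_derivative
    b (Inl i) * b (Inr j) * wedge (\<beta> x) (\<theta> x) vs) (at x)"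
proof -
  \<comment> \<open>The primitive is differentiated twice, so closedness is used for the
    x-derivative of the mode as well.\<close>
  have Db1: "dop Inr a b (\<beta>2 x) (\<beta>1 x) vs = 0" for x vs
  proof -
    have "((\<lambda>x. dop Inr a b (\<beta>1 x) (\<beta> x) vs) has_vector_derivative dop Inr a b (\<beta>2 x) (\<beta>1 x) vs) (at x)"
      by (intro has_vector_derivative_dop d\<beta> d\<beta>1)
    hence "((\<lambda>x. 0) has_vector_derivative dop Inr a b (\<beta>2 x) (\<beta>1 x) vs) (at x)" unfolding Db .
    thus ?thesis using vector_derivative_unique_at has_vector_derivative_const by blast
  qed
  define \<gamma>2 where "\<gamma>2 = (\<lambda>x. iota (Inr j) (iota (Inl i) (\<beta>2 x)))"
  have d\<gamma>: "((\<lambda>x. \<gamma> x vs) has_vector_derivative \<gamma>1 x vs) (at x)"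
    and d\<gamma>1: "((\<lambda>x. \<gamma>1 x vs) has_vector_derivative \<gamma>2 x vs) (at x)" for x vs
    unfolding \<gamma>_def \<gamma>1_def \<gamma>2_def by (intro has_vector_derivative_iota d\<beta> d\<beta>1)+
  have ni: "Inl i \<notin> range (Inr :: 'm \<Rightarrow> 'm + 'm)" by auto
  have Dz: "dop Inl a b (\<beta>1 x) (\<beta> x) = (\<lambda>vs. 0)" and Dbz: "dop Inr a b (\<beta>1 x) (\<beta> x) = (\<lambda>vs. 0)"
    and Db1z: "dop Inr a b (\<beta>2 x) (\<beta>1 x) = (\<lambda>vs. 0)" for x
    by (rule ext, rule D Db Db1)+
  have z: "iota t (\<lambda>vs. 0) = (\<lambda>vs. 0)" for t :: "'m + 'm" by (rule iota_linear)
  \<comment> \<open>Since \<open>a\<close> vanishes in direction \<open>i\<close>, contracting the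
    closedness equation leaves only multiplication by the symbol: contraction is inverse to
    \<partial> up to the factor b.\<close>
  have h0: "dop Inl a b (iota (Inl i) (\<beta>1 x)) (iota (Inl i) (\<beta> x)) vs = b (Inl i) * \<beta> x vs" for x vs
    using iota_dop[of Inl "Inl i" a b "\<beta>1 x" "\<beta> x" vs] a0 by (simp add: z Dz)
  have c0: "dop Inr a b (iota (Inl i) (\<beta>1 x)) (iota (Inl i) (\<beta> x)) vs = 0"
    and c1: "dop Inr a b (iota (Inl i) (\<beta>2 x)) (iota (Inl i) (\<beta>1 x)) vs = 0" for x vs
    using iota_dop[of Inr "Inl i" a b "\<beta>1 x" "\<beta> x" vs]
      iota_dop[of Inr "Inl i" a b "\<beta>2 x" "\<beta>1 x" vs] ni by (simp_all add: z Dbz Db1z)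
  have c0z: "dop Inr a b (iota (Inl i) (\<beta>1 x)) (iota (Inl i) (\<beta> x)) = (\<lambda>vs. 0)"
    and c1z: "dop Inr a b (iota (Inl i) (\<beta>2 x)) (iota (Inl i) (\<beta>1 x)) = (\<lambda>vs. 0)" for x
    by (rule ext, rule c0 c1)+
  have h1: "dop Inr a b (\<gamma>1 x) (\<gamma> x) = (\<lambda>vs. b (Inr j) * iota (Inl i) (\<beta> x) vs)" for x
    using iota_dop[of Inr "Inr j" a b "iota (Inl i) (\<beta>1 x)" "iota (Inl i) (\<beta> x)"] a0
    unfolding c0z z \<gamma>_def \<gamma>1_def by (auto simp: fun_eq_iff)
  have h2: "dop Inr a b (\<gamma>2 x) (\<gamma>1 x) = (\<lambda>vs. b (Inr j) * iota (Inl i) (\<beta>1 x) vs)" for x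
    using iota_dop[of Inr "Inr j" a b "iota (Inl i) (\<beta>2 x)" "iota (Inl i) (\<beta>1 x)"] a0
    unfolding c1z z \<gamma>1_def \<gamma>2_def by (auto simp: fun_eq_iff)
  let ?W = "\<lambda>k l \<gamma>. wedge (cov (Inl k)) (wedge (cov (Inr l)) \<gamma>)"
  let ?aa = "\<lambda>k l. a (Inl k) * a (Inr l)" and ?bb = "\<lambda>k l. b (Inl k) * b (Inr l)"
  let ?c = "\<lambda>k l. a (Inl k) * b (Inr l) + b (Inl k) * a (Inr l)"
  have W3: "?W k l (\<lambda>us. r * \<alpha> us + s * \<alpha>' us + t * \<alpha>'' us) vs = r * ?W k l \<alpha> vs + s * ?W k l \<alpha>' vs + t * ?W k l \<alpha>'' vs"
    for k l r s t \<alpha> \<alpha>' \<alpha>'' and vs :: "'m cvec list"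
    unfolding wedge_assoc[symmetric, of "cov (Inl k)"] by (simp only: wedge_add_right wedge_scale_right)
  have W3m: "?W k l (\<lambda>us. r * \<alpha> us - s * \<alpha>' us + t * \<alpha>'' us) vs = r * ?W k l \<alpha> vs - s * ?W k l \<alpha>' vs + t * ?W k l \<alpha>'' vs"
    for k l r s t \<alpha> \<alpha>' \<alpha>'' and vs :: "'m cvec list"
    unfolding wedge_assoc[symmetric, of "cov (Inl k)"]
    by (simp only: wedge_add_right wedge_diff_right wedge_scale_right)
  \<comment> \<open>This says \<partial>\<partial>bar \<gamma> = b_i b_j \<beta>, so \<gamma> is the
    primitive up to the two symbols.\<close>
  have prim: "(\<Sum>k\<in>UNIV. \<Sum>l\<in>UNIV. ?W k l (\<lambda>us. ?aa k l * \<gamma>2 x us + ?c k l * \<gamma>1 x us + ?bb k l * \<gamma> x us) vs)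
      = b (Inl i) * b (Inr j) * \<beta> x vs" for x vs
  proof -
    have "dop Inl a b (dop Inr a b (\<gamma>2 x) (\<gamma>1 x)) (dop Inr a b (\<gamma>1 x) (\<gamma> x)) vs = b (Inr j) * (b (Inl i) * \<beta> x vs)"
      unfolding h1 h2 dop_scale h0 ..
    moreover have "dop Inl a b (dop Inr a b (\<gamma>2 x) (\<gamma>1 x)) (dop Inr a b (\<gamma>1 x) (\<gamma> x)) vs =
      (\<Sum>k\<in>UNIV. \<Sum>l\<in>UNIV. ?W k l (\<lambda>us. ?aa k l * \<gamma>2 x us + ?c k l * \<gamma>1 x us + ?bb k l * \<gamma> x us) vs)"
    proof -
      have "wedge (cov (Inl k)) (\<lambda>us. a (Inl k) * dop Inr a b (\<gamma>2 x) (\<gamma>1 x) us + b (Inl k) * dop Inr a b (\<gamma>1 x) (\<gamma> x) us) vs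
        = (\<Sum>l\<in>UNIV. ?W k l (\<lambda>us. ?aa k l * \<gamma>2 x us + ?c k l * \<gamma>1 x us + ?bb k l * \<gamma> x us) vs)" for k
      proof -
        have eqk: "(\<lambda>us. a (Inl k) * dop Inr a b (\<gamma>2 x) (\<gamma>1 x) us + b (Inl k) * dop Inr a b (\<gamma>1 x) (\<gamma> x) us) =
           (\<lambda>us. \<Sum>l\<in>UNIV. 1 * wedge (cov (Inr l)) (\<lambda>us. ?aa k l * \<gamma>2 x us + ?c k l * \<gamma>1 x us + ?bb k l * \<gamma> x us) us)"
          unfolding dop_def sum_distrib_left sum.distrib[symmetric]
          by (intro ext sum.cong refl, simp only: wedge_add_right wedge_scale_right, simp add: algebra_simps)
        show ?thesis unfolding eqk wedge_sum_right by simp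
      qed
      thus ?thesis unfolding dop_def[of Inl] by simp
    qed
    ultimately show ?thesis by simp
  qed
  have dW: "((\<lambda>x. ?W k l (\<gamma> x) vs) has_vector_derivative ?W k l (\<gamma>1 x) vs) (at x)"
    and dW1: "((\<lambda>x. ?W k l (\<gamma>1 x) vs) has_vector_derivative ?W k l (\<gamma>2 x) vs) (at x)" for k l x vs
    by (intro has_vector_derivative_wedge_const d\<gamma> d\<gamma>1)+
  have "((\<lambda>x. bdry a b (\<gamma> x) (\<gamma>1 x) (\<theta> x) (\<theta>1 x) vs) has_vector_derivative
     (\<Sum>k\<in>UNIV. \<Sum>l\<in>UNIV. ?aa k l * ((wedge (?W k l (\<gamma>2 x)) (\<theta> x) vs + wedge (?W k l (\<gamma>1 x)) (\<theta>1 x) vs) -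
       (wedge (?W k l (\<gamma>1 x)) (\<theta>1 x) vs + wedge (?W k l (\<gamma> x)) (\<theta>2 x) vs)) +
      ?c k l * (wedge (?W k l (\<gamma>1 x)) (\<theta> x) vs + wedge (?W k l (\<gamma> x)) (\<theta>1 x) vs))) (at x)"
    unfolding bdry_def
    by (intro has_vector_derivative_sum has_vector_derivative_add has_vector_derivative_mult_right
        has_vector_derivative_diff has_vector_derivative_wedge dW dW1 d\<theta> d\<theta>1)
  also have "(\<Sum>k\<in>UNIV. \<Sum>l\<in>UNIV. ?aa k l * ((wedge (?W k l (\<gamma>2 x)) (\<theta> x) vs + wedge (?W k l (\<gamma>1 x)) (\<theta>1 x) vs) -
       (wedge (?W k l (\<gamma>1 x)) (\<theta>1 x) vs + wedge (?W k l (\<gamma> x)) (\<theta>2 x) vs)) +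
      ?c k l * (wedge (?W k l (\<gamma>1 x)) (\<theta> x) vs + wedge (?W k l (\<gamma> x)) (\<theta>1 x) vs)) =
    (\<Sum>k\<in>UNIV. \<Sum>l\<in>UNIV. wedge (?W k l (\<lambda>us. ?aa k l * \<gamma>2 x us + ?c k l * \<gamma>1 x us + ?bb k l * \<gamma> x us)) (\<theta> x) vs) -
    (\<Sum>k\<in>UNIV. \<Sum>l\<in>UNIV. wedge (\<gamma> x) (?W k l (\<lambda>us. ?aa k l * \<theta>2 x us - ?c k l * \<theta>1 x us + ?bb k l * \<theta> x us)) vs)"
  proof -
    have "?aa k l * ((wedge (?W k l (\<gamma>2 x)) (\<theta> x) vs + wedge (?W k l (\<gamma>1 x)) (\<theta>1 x) vs) -
       (wedge (?W k l (\<gamma>1 x)) (\<theta>1 x) vs + wedge (?W k l (\<gamma> x)) (\<theta>2 x) vs)) +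
      ?c k l * (wedge (?W k l (\<gamma>1 x)) (\<theta> x) vs + wedge (?W k l (\<gamma> x)) (\<theta>1 x) vs) =
     wedge (?W k l (\<lambda>us. ?aa k l * \<gamma>2 x us + ?c k l * \<gamma>1 x us + ?bb k l * \<gamma> x us)) (\<theta> x) vs -
     wedge (\<gamma> x) (?W k l (\<lambda>us. ?aa k l * \<theta>2 x us - ?c k l * \<theta>1 x us + ?bb k l * \<theta> x us)) vs" for k l
    proof -
      have "?W k l (\<lambda>us. ?aa k l * \<gamma>2 x us + ?c k l * \<gamma>1 x us + ?bb k l * \<gamma> x us) =
          (\<lambda>us. ?aa k l * ?W k l (\<gamma>2 x) us + ?c k l * ?W k l (\<gamma>1 x) us + ?bb k l * ?W k l (\<gamma> x) us)"
        by (intro ext W3)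
      moreover have "?W k l (\<lambda>us. ?aa k l * \<theta>2 x us - ?c k l * \<theta>1 x us + ?bb k l * \<theta> x us) =
          (\<lambda>us. ?aa k l * ?W k l (\<theta>2 x) us - ?c k l * ?W k l (\<theta>1 x) us + ?bb k l * ?W k l (\<theta> x) us)"
        by (intro ext W3m)
      ultimately show ?thesis
        by (simp only: wedge_add_left wedge_scale_left wedge_add_right wedge_diff_right wedge_scale_right
            wedge_cov_cov_left) (simp add: algebra_simps)
    qed
    thus ?thesis by (simp only: sum_subtractf)
  qed
  also have "(\<Sum>k\<in>UNIV. \<Sum>l\<in>UNIV. wedge (?W k l (\<lambda>us. ?aa k l * \<gamma>2 x us + ?c k l * \<gamma>1 x us + ?bb k l * \<gamma> x us)) (\<theta> x) vs)
     = b (Inl i) * b (Inr j) * wedge (\<beta> x) (\<theta> x) vs"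
  proof -
    let ?X = "\<lambda>k l. ?W k l (\<lambda>us. ?aa k l * \<gamma>2 x us + ?c k l * \<gamma>1 x us + ?bb k l * \<gamma> x us)"
    have "(\<lambda>us. \<Sum>k\<in>UNIV. 1 * (\<Sum>l\<in>UNIV. 1 * ?X k l us)) = (\<lambda>us. b (Inl i) * b (Inr j) * \<beta> x us)"
      using prim[of x] by simp
    hence "wedge (\<lambda>us. \<Sum>k\<in>UNIV. 1 * (\<Sum>l\<in>UNIV. 1 * ?X k l us)) (\<theta> x) vs = b (Inl i) * b (Inr j) * wedge (\<beta> x) (\<theta> x) vs"
      by (simp only: wedge_scale_left)
    thus ?thesis unfolding wedge_sum_left by simp
  qed
  also have "(\<Sum>k\<in>UNIV. \<Sum>l\<in>UNIV. wedge (\<gamma> x) (?W k l (\<lambda>us. ?aa k l * \<theta>2 x us - ?c k l * \<theta>1 x us + ?bb k l * \<theta> x us)) vs) = 0"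
  proof -
    let ?X = "\<lambda>k l. ?W k l (\<lambda>us. ?aa k l * \<theta>2 x us - ?c k l * \<theta>1 x us + ?bb k l * \<theta> x us)"
    have "(\<lambda>us. \<Sum>k\<in>UNIV. 1 * (\<Sum>l\<in>UNIV. 1 * ?X k l us)) = (\<lambda>us. 0)"
      using DD[of x] by simp
    hence "wedge (\<gamma> x) (\<lambda>us. \<Sum>k\<in>UNIV. 1 * (\<Sum>l\<in>UNIV. 1 * ?X k l us)) vs = 0"
      by simp
    thus ?thesis unfolding wedge_sum_right by simp
  qed
  finally show ?thesis by simp
qed

text \<open>A monotone function that tends to 0 at both ends is squeezed between its limits, and a
  monotone periodic function cannot increase. In the application \<open>E\<close> is the energy of a
  mode and \<phi> its boundary term.\<close>

lemma nondecreasing_constant: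
  fixes \<phi> E :: "real \<Rightarrow> real"
  assumes d: "\<And>x. (\<phi> has_real_derivative E x) (at x)" and E: "\<And>x. E x \<ge> 0"
    and AB: "(\<exists>C. \<forall>x. \<bar>\<phi> x\<bar> \<le> C * exp (- \<bar>x\<bar>)) \<or> (\<forall>x. \<phi> (x + 1) = \<phi> x)"
  shows "E x = 0"
proof -
  have mono: "\<phi> x \<le> \<phi> y" if "x \<le> y" for x y
    by (rule DERIV_nonneg_imp_nondecreasing[OF that]) (use d E in blast)
  have const: "\<phi> x = \<phi> y" if "x \<le> y" for x y
    using AB
  proof
    assume "\<exists>C. \<forall>x. \<bar>\<phi> x\<bar> \<le> C * exp (- \<bar>x\<bar>)"
    then obtain C where C: "\<And>x. \<bar>\<phi> x\<bar> \<le> C * exp (- \<bar>x\<bar>)" by blast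
    have lim: "((\<lambda>x::real. C * exp (- x)) \<longlongrightarrow> C * 0) at_top"
      by (intro tendsto_mult tendsto_const filterlim_compose[OF exp_at_bot] filterlim_uminus_at_bot_at_top)
    have up: "\<phi> z \<le> 0" for z
    proof (rule tendsto_lowerbound[OF lim[simplified]])
      show "\<forall>\<^sub>F x in at_top. \<phi> z \<le> C * exp (- x)"
        using eventually_ge_at_top[of "max z 0"]
      proof eventually_elim
        case (elim x)
        thus ?case using mono[of z x] C[of x] by simp
      qed
    qed simp
    have lo: "- \<phi> z \<le> 0" for z
    proof (rule tendsto_lowerbound[OF lim[simplified]])
      show "\<forall>\<^sub>F x in at_top. - \<phi> z \<le> C * exp (- x)"
        using eventually_ge_at_top[of "max (- z) 0"]
      proof eventually_elim
        case (elim x)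
        thus ?case using mono[of "- x" z] C[of "- x"] by simp
      qed
    qed simp
    show ?thesis using up[of x] up[of y] lo[of x] lo[of y] by simp
  next
    assume per: "\<forall>x. \<phi> (x + 1) = \<phi> x"
    have pn: "\<phi> (x + real n) = \<phi> x" for n
    proof (induction n)
      case (Suc n)
      have "\<phi> (x + real (Suc n)) = \<phi> ((x + real n) + 1)" by (simp add: algebra_simps)
      thus ?case using per Suc by simp
    qed simp
    obtain n where "real n \<ge> y - x" using real_arch_simple by blast
    hence "\<phi> y \<le> \<phi> (x + real n)" by (intro mono) simp
    thus ?thesis using mono[OF that] pn[of n] by simp
  qed
  have eq: "\<phi> y = \<phi> x" for y
  proof (cases "x \<le> y")
    case True
    from const[OF this] show ?thesis by (rule sym)
  next
    case False
    hence "y \<le> x" by simp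
    from const[OF this] show ?thesis .
  qed
  have "((\<lambda>_. \<phi> x) has_real_derivative E x) (at x)"
    by (rule has_field_derivative_transform_within_open[OF d open_UNIV UNIV_I]) (rule eq)
  thus ?thesis by (rule DERIV_unique[OF _ DERIV_const])
qed

section \<open>Low degrees, coefficient extraction and scalar equations\<close>

lemma homog_0_iota: "homog 0 \<beta> \<Longrightarrow> iota t \<beta> = (\<lambda>vs. 0)"
  by (induction "0::nat" \<beta> rule: homog.induct) (auto simp: iota_one iota_linear)

text \<open>Settles the types with p + q < 2, where a double contraction has no degree left.\<close>

lemma homog_less_2_iota: "homog j \<beta> \<Longrightarrow> j < 2 \<Longrightarrow> iota s (iota t \<beta>) = (\<lambda>vs. 0)"
  using homog_0_iota[of \<beta> t] homog_0_iota[OF homog_iota[of 0 \<beta> t], of s]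
  by (cases "j = 0") (auto simp: iota_linear less_2_cases_iff)

text \<open>Multiplication by \<open>cov t\<close> kills the monomials that contain \<open>t\<close>
  and keeps the others independent, so a linear relation among the products splits into one scalar
  equation for each multi-index without \<open>t\<close>.\<close>

lemma coef_wedge_cov:
  assumes "t \<notin> set (lst K0)"
  shows "coef (t # lst K0) (wedge (cov t) (ee K)) = (if K = K0 then 1 else 0)"
proof (cases "t \<in> set (lst K)")
  case True
  hence "\<not> distinct (t # lst K)" by simp
  from es_not_distinct[OF this] have "wedge (cov t) (ee K) = (\<lambda>vs. 0)" by (simp add: ee_def)
  thus ?thesis using True assms by (auto simp: iota_linear coef_linear)
next
  case False
  thus ?thesis by (simp add: iota_wedge_cov ee_def[of K] iota_es_notin wedge_fun_simps)
      (simp add: ee_def[symmetric] coef_ee)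
qed

lemma coef_wedge_cov_cov:
  assumes "t \<notin> set (lst K0)" "s \<notin> set (lst K0)" "t \<noteq> s"
  shows "coef (t # s # lst K0) (wedge (cov t) (wedge (cov s) (ee K))) = (if K = K0 then 1 else 0)"
proof (cases "t \<in> set (lst K)")
  case True
  hence "\<not> distinct (t # s # lst K)" by simp
  from es_not_distinct[OF this] have "wedge (cov t) (wedge (cov s) (ee K)) = (\<lambda>vs. 0)" by (simp add: ee_def)
  thus ?thesis using True assms by (auto simp: iota_linear coef_linear)
next
  case False
  have "iota t (wedge (cov s) (ee K)) = (\<lambda>vs. 0)"
    using False assms(3) by (simp add: iota_wedge_cov ee_def iota_es_notin wedge_fun_simps)
  hence "coef (t # s # lst K0) (wedge (cov t) (wedge (cov s) (ee K))) = coef (s # lst K0) (wedge (cov s) (ee K))"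
    by (simp add: iota_wedge_cov[of t t] wedge_fun_simps)
  thus ?thesis using coef_wedge_cov[OF assms(2)] by metis
qed

text \<open>The solution is C e^(\<mu> x), so the shift compares e^\<mu> with e^c, and for real
  exponents this decides equality.\<close>

lemma exponential_solution:
  fixes g :: "real \<Rightarrow> complex"
  assumes d: "\<And>x. (g has_vector_derivative of_real \<mu> * g x) (at x)"
    and s: "\<And>x. g (x + 1) = of_real (exp c) * g x"
  shows "(\<forall>x. g x = 0) \<or> \<mu> = c"
proof -
  define f where "f = (\<lambda>x. of_real (exp (- \<mu> * x)) * g x)"
  have "(f has_vector_derivative 0) (at x)" for x
  proof -
    have "((\<lambda>x. complex_of_real (exp (- \<mu> * x))) has_vector_derivative of_real (exp (- \<mu> * x) * (- \<mu>))) (at x)"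
      by (rule has_vector_derivative_of_real) (auto intro!: derivative_eq_intros)
    from has_vector_derivative_mult[OF this d]
    show ?thesis by (simp add: f_def algebra_simps)
  qed
  then obtain C where C: "\<And>x. f x = C"
    using has_vector_derivative_zero_constant[of UNIV f] by auto
  have g: "g x = of_real (exp (\<mu> * x)) * C" for x
    using C[of x, symmetric] by (simp add: f_def exp_minus field_simps flip: of_real_mult mult.assoc)
  have "of_real (exp \<mu>) * C = of_real (exp c) * C"
    using s[of 0] unfolding g by simp
  hence "C = 0 \<or> exp \<mu> = exp c" by (metis mult_right_cancel of_real_eq_iff)
  thus ?thesis using g by auto
qed

context nakamura
begin

section \<open>Closure properties of superexponential decay\<close>

lemma superdecay_bound: "superdecay f \<Longrightarrow> \<exists>C\<ge>0. \<forall>x. norm (f x) \<le> C * exp (- real N * \<bar>x\<bar>)"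
proof -
  assume "superdecay f"
  then obtain C where C: "\<And>x. norm (f x) \<le> C * exp (- real N * \<bar>x\<bar>)" unfolding superdecay_def by blast
  moreover have "C \<ge> 0" using order_trans[OF norm_ge_zero C[of 0]] by simp
  ultimately show ?thesis by blast
qed

lemma superdecay_add:
  assumes "superdecay f" "superdecay g" shows "superdecay (\<lambda>x. f x + g x)"
  unfolding superdecay_def
proof
  fix N
  obtain C D where CD: "\<And>x. norm (f x) \<le> C * exp (- real N * \<bar>x\<bar>)" "\<And>x. norm (g x) \<le> D * exp (- real N * \<bar>x\<bar>)"
    using superdecay_bound[OF assms(1), of N] superdecay_bound[OF assms(2), of N] by blast
  have "norm (f x + g x) \<le> (C + D) * exp (- real N * \<bar>x\<bar>)" for x
    using norm_triangle_ineq[of "f x" "g x"] CD[of x] by (simp add: distrib_right)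
  thus "\<exists>C. \<forall>x. norm (f x + g x) \<le> C * exp (- real N * \<bar>x\<bar>)" by blast
qed

lemma superdecay_mult:
  assumes "superdecay f" "superdecay g" shows "superdecay (\<lambda>x. f x * g x)"
  unfolding superdecay_def
proof
  fix N
  \<comment> \<open>One factor carries the decay; the case N = 0 bounds the other.\<close>
  obtain C D where CD: "C \<ge> 0" "D \<ge> 0" "\<And>x. norm (f x) \<le> C * exp (- real N * \<bar>x\<bar>)"
    "\<And>x. norm (g x) \<le> D * exp (- real 0 * \<bar>x\<bar>)"
    using superdecay_bound[OF assms(1), of N] superdecay_bound[OF assms(2), of 0] by blast
  have "norm (f x * g x) \<le> (C * exp (- real N * \<bar>x\<bar>)) * D" for x
    unfolding norm_mult using CD(1) CD(3,4)[of x] by (intro mult_mono) auto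
  hence "norm (f x * g x) \<le> (C * D) * exp (- real N * \<bar>x\<bar>)" for x by (simp add: mult_ac)
  thus "\<exists>C. \<forall>x. norm (f x * g x) \<le> C * exp (- real N * \<bar>x\<bar>)" by blast
qed

lemma superdecay_zero: "superdecay (\<lambda>x. 0)"
  unfolding superdecay_def by (auto intro: exI[of _ 0])

lemma superdecay_scale: "superdecay f \<Longrightarrow> superdecay (\<lambda>x. c * f x)"
  unfolding superdecay_def
proof
  fix N assume "\<forall>N::nat. \<exists>C. \<forall>x. norm (f x) \<le> C * exp (- real N * \<bar>x\<bar>)"
  then obtain C where "\<And>x. norm (f x) \<le> C * exp (- real N * \<bar>x\<bar>)" by blast
  hence "norm (c * f x) \<le> (norm c * C) * exp (- real N * \<bar>x\<bar>)" for x
    using mult_left_mono[of _ _ "norm c"] by (simp add: norm_mult mult.assoc)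
  thus "\<exists>C. \<forall>x. norm (c * f x) \<le> C * exp (- real N * \<bar>x\<bar>)" by blast
qed

lemma superdecay_sum: "(\<And>i. i \<in> A \<Longrightarrow> superdecay (f i)) \<Longrightarrow> superdecay (\<lambda>x. \<Sum>i\<in>A. f i x)"
  by (induction A rule: infinite_finite_induct) (auto intro: superdecay_zero superdecay_add)

lemma superdecay_wedge:
  assumes "\<And>us. superdecay (\<lambda>x. \<alpha> x us)" "\<And>us. superdecay (\<lambda>x. \<beta> x us)"
  shows "superdecay (\<lambda>x. wedge (\<alpha> x) (\<beta> x) vs)"
  unfolding wedge_def mult.assoc by (intro superdecay_sum superdecay_scale superdecay_mult assms)

lemma superdecay_wedge_const:
  assumes "\<And>us. superdecay (\<lambda>x. \<beta> x us)"
  shows "superdecay (\<lambda>x. wedge \<alpha> (\<beta> x) vs)"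
  unfolding wedge_def by (intro superdecay_sum superdecay_scale assms)

lemma superdecay_iota:
  assumes "\<And>us. superdecay (\<lambda>x. \<beta> x us)"
  shows "superdecay (\<lambda>x. iota t (\<beta> x) vs)"
proof -
  have "(\<lambda>x. iota t (\<beta> x) vs) = (\<lambda>x. (1/2) * \<beta> x (axis (index_of t) 1 # vs) +
     (case t of Inl _ \<Rightarrow> -\<i>/2 | Inr _ \<Rightarrow> \<i>/2) * \<beta> x (axis (index_of t) \<i> # vs))"
    by (auto simp: iota_def index_of_def fun_eq_iff field_simps split: sum.splits)
  thus ?thesis by (simp only:) (intro superdecay_add superdecay_scale assms)
qed

section \<open>Consequences of unimodularity for weights, norms and volume\<close>

lemma sum_lam: "(\<Sum>i\<in>UNIV. lam i) = 0"
proof -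
  let ?R = "\<chi> i j. real_of_int (M $ i $ j)"
  have "det ?R = real_of_int (det M)" by (simp add: det_def)
  hence R: "det ?R = 1" by (simp add: det_M)
  have "det P * det (matrix_inv P) = 1" by (metis P_inv(1) det_I det_mul)
  hence "det (P ** ?R ** matrix_inv P) = 1" by (simp add: det_mul R)
  hence "(\<Prod>i\<in>UNIV. exp (lam i)) = 1" unfolding conj_M by (subst (asm) det_diagonal) auto
  hence "exp (\<Sum>i\<in>UNIV. lam i) = 1" by (simp add: exp_sum)
  thus ?thesis by simp
qed

lemma sum_mu: "sum mu UNIV = 0"
proof -
  have "sum mu UNIV = mu None + (\<Sum>i\<in>UNIV. mu (Some i))"
    by (simp add: UNIV_option_conv sum.reindex)
  thus ?thesis by (simp add: sum_lam)
qed

text \<open>The weights of all coordinates sum to 0, so passing to complementary monomials reverses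
  the weight.\<close>

lemma cc_cpl: "cc (cpl K) = - cc K"
proof -
  have "sum mu (- A) = - sum mu A" for A :: "'n option set"
    using sum.subset_diff[of A UNIV mu] by (simp add: sum_mu Compl_eq_Diff_UNIV)
  thus ?thesis by (simp add: cc_def cpl_def)
qed

lemma cc_full: "cc full = 0"
  by (simp add: cc_def full_def sum_mu)

lemma pnorm_wt: "K \<in> idx p q \<Longrightarrow> pnorm (wt x) K = 2 ^ (p + q) * exp (2 * cc K * Re (x $ None))"
proof -
  assume K: "K \<in> idx p q"
  have "pnorm (wt x) K = (\<Prod>t\<in>Inl ` fst K \<union> Inr ` snd K. 2 * exp (2 * mu (index_of t) * Re (x $ None)))"
    by (simp add: pnorm_def prod.distinct_set_conv_list[symmetric] lst_simps hnorm_def wt_def exp_minus divide_inverse)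
  also have "\<dots> = (\<Prod>k\<in>fst K. 2 * exp (2 * mu k * Re (x $ None))) * (\<Prod>k\<in>snd K. 2 * exp (2 * mu k * Re (x $ None)))"
    by (subst prod.union_disjoint) (auto simp: prod.reindex)
  also have "\<dots> = 2 ^ (p + q) * (exp (\<Sum>k\<in>fst K. 2 * mu k * Re (x $ None)) * exp (\<Sum>k\<in>snd K. 2 * mu k * Re (x $ None)))"
    using K by (simp add: prod.distrib exp_sum idx_def mem_Times_iff power_add)
  also have "\<dots> = 2 ^ (p + q) * exp (2 * cc K * Re (x $ None))"
    by (simp add: cc_def sum_distrib_left sum_distrib_right algebra_simps flip: exp_add)
  finally show ?thesis .
qed

lemma prod_wt: "(\<Prod>k\<in>UNIV. wt x k) = 1"
proof -
  have "(\<Prod>k\<in>UNIV. wt x k) = exp (\<Sum>k\<in>UNIV. - 2 * mu k * Re (x $ None))"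
    by (simp add: wt_def exp_sum)
  also have "(\<Sum>k\<in>UNIV. - 2 * mu k * Re (x $ None)) = (- 2 * Re (x $ None)) * sum mu UNIV"
    unfolding sum_distrib_left by (rule sum.cong) simp_all
  finally show ?thesis by (simp add: sum_mu)
qed

lemma freq_zero_imp: "(\<And>i c. c \<in> {1, \<i>} \<Longrightarrow> freq k (axis i c) = 0) \<Longrightarrow> k = 0"
proof -
  assume a: "\<And>i c. c \<in> {1, \<i>} \<Longrightarrow> freq k (axis i c) = 0"
  have lin: "linear (\<lambda>v. complex_of_real (freq k v))"
    by (rule linear_compose[OF linear_freq bounded_linear.linear[OF bounded_linear_of_real], unfolded o_def])
  have "complex_of_real (freq k (Lf k)) = 0" using a by (subst real_linear_expand[OF lin]) simp
  thus "k = 0" by (simp add: freq_def Linv_Lf)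
qed

end

section \<open>Coefficients of Bott-Chern harmonic forms\<close>

text \<open>Harmonicity of one form of type (p, q), lifted to the cover and freed of charts:
  \<open>star0\<close> has the explicit Hodge star substituted, with \<open>V\<close> the constant
  of the volume form, and \<open>nonres\<close> is the hypothesis on \<tau>.\<close>

locale nakamura_bc_form = nakamura M P lam \<tau>
  for M :: "int^('n::{finite,linorder})^('n::{finite,linorder})"
    and P :: "real^('n::{finite,linorder})^('n::{finite,linorder})"
    and lam :: "'n \<Rightarrow> real" and \<tau> :: real +
  fixes p q :: nat and F :: "'n option set \<times> 'n option set \<Rightarrow> complex^('n option) \<Rightarrow> complex" and V :: complex
  assumes pq: "p \<le> CARD('n option)" "q \<le> CARD('n option)"
    and aut: "\<And>K. K \<in> idx p q \<Longrightarrow> automorphic (cc K) (F K)"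
    and V: "V \<noteq> 0"
    and del0: "\<And>x vs. (\<Sum>k\<in>UNIV. \<Sum>K\<in>idx p q. wirtinger_deriv (Inl k) (F K) x * wedge (cov (Inl k)) (ee K) vs) = 0"
    and delbar0: "\<And>x vs. (\<Sum>k\<in>UNIV. \<Sum>K\<in>idx p q. wirtinger_deriv (Inr k) (F K) x * wedge (cov (Inr k)) (ee K) vs) = 0"
    and star0: "\<And>x vs. (\<Sum>k\<in>UNIV. \<Sum>l\<in>UNIV. \<Sum>K\<in>idx p q. wirtinger_deriv (Inl k) (wirtinger_deriv (Inr l)
      (\<lambda>y. (2 ^ (p + q) * cpl_sign K * V) * (of_real (exp (2 * cc K * Re (y $ None))) * cnj (F K y)))) x *
        wedge (cov (Inl k)) (wedge (cov (Inr l)) (ee (cpl K))) vs) = 0"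
    and nonres: "\<And>I J. (\<exists>k::int. \<tau> * c_IJ lam I J = 2 * pi * of_int k) \<longleftrightarrow> c_IJ lam I J = 0"
begin

text \<open>The coefficient of the Hodge star at the complementary monomial
  \<open>ee (cpl K)\<close>.\<close>

definition Q :: "'n option set \<times> 'n option set \<Rightarrow> complex^('n option) \<Rightarrow> complex" where
  "Q K = (\<lambda>y. (2 ^ (p + q) * cpl_sign K * V) * (of_real (exp (2 * cc K * Re (y $ None))) * cnj (F K y)))"

abbreviation "e0 \<equiv> axis None 1 :: complex^('n option)"

definition fform :: "('n option set \<times> 'n option set \<Rightarrow> real \<Rightarrow> complex) \<Rightarrow> real \<Rightarrow> 'n option ext" where
  "fform g x = (\<lambda>vs. \<Sum>K\<in>idx p q. g K x * ee K vs)"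

definition sform :: "('n option set \<times> 'n option set \<Rightarrow> real \<Rightarrow> complex) \<Rightarrow> real \<Rightarrow> 'n option ext" where
  "sform r x = (\<lambda>vs. \<Sum>K\<in>idx p q. r K x * ee (cpl K) vs)"

text \<open>Conjugation keeps the weight and the exponential factor lowers it by
  \<open>2 * cc K\<close>; what is left is the weight of the complementary monomial.\<close>

lemma aut_Q: "K \<in> idx p q \<Longrightarrow> automorphic (- cc K) (Q K)"
proof -
  assume K: "K \<in> idx p q"
  have "automorphic (cc K - 2 * cc K) (\<lambda>y. of_real (exp (2 * cc K * Re (y $ None))) * cnj (F K y))"
    by (intro automorphic_exp automorphic_cnj aut K)
  from automorphic_lin[OF this this, of "2 ^ (p + q) * cpl_sign K * V" 0] show ?thesis by (simp add: Q_def)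
qed

lemma automorphic_e0: "automorphic s G \<Longrightarrow> automorphic s (dir_deriv e0 G)"
  using automorphic_dir_deriv[OF _ scl_axis[of _ None 1], of s G] by simp

lemma smooth_FQ: "K \<in> idx p q \<Longrightarrow> smooth (F K)" "K \<in> idx p q \<Longrightarrow> smooth (Q K)"
  using aut aut_Q automorphicD(1) by blast+

text \<open>Conjugation turns frequency \<open>k\<close> into \<open>- k\<close>, and the
  exponential factor is constant on the fibre over \<open>x\<close>.\<close>

lemma fourier_coeff_Q: "K \<in> idx p q \<Longrightarrow> fourier_coeff (- k) (Q K) x =
   (2 ^ (p + q) * cpl_sign K * V) * (of_real (exp (2 * cc K * x)) * cnj (fourier_coeff k (F K) x))"
proof -
  assume K: "K \<in> idx p q"
  have "cnj (fourier_coeff k (F K) x) = torus_mean (\<lambda>t. cnj (F K (zpt x t) * character (- k) t))"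
    unfolding fourier_coeff_def
    by (rule torus_mean_cnj[symmetric]) (intro continuous_on_mult cont_smooth_zpt continuous_character continuous_on_id smooth_FQ K)
  thus ?thesis
    by (simp add: fourier_coeff_def Q_def zpt_None torus_mean_scale[symmetric] character_simps(4) mult_ac)
qed

context
  fixes k :: "'n torus"
  assumes k: "intvec k"
begin

abbreviation "g \<equiv> \<lambda>K. fourier_coeff k (F K)"
abbreviation "g1 \<equiv> \<lambda>K. fourier_coeff k (dir_deriv e0 (F K))"
abbreviation "g2 \<equiv> \<lambda>K. fourier_coeff k (dir_deriv e0 (dir_deriv e0 (F K)))"
abbreviation "r \<equiv> \<lambda>K. fourier_coeff (- k) (Q K)"
abbreviation "r1 \<equiv> \<lambda>K. fourier_coeff (- k) (dir_deriv e0 (Q K))"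
abbreviation "r2 \<equiv> \<lambda>K. fourier_coeff (- k) (dir_deriv e0 (dir_deriv e0 (Q K)))"

section \<open>The equations for a single mode\<close>

lemma mode_derivatives:
  assumes K: "K \<in> idx p q"
  shows "(g K has_vector_derivative g1 K x) (at x)" "(g1 K has_vector_derivative g2 K x) (at x)"
    "(r K has_vector_derivative r1 K x) (at x)" "(r1 K has_vector_derivative r2 K x) (at x)"
  by (intro fourier_coeff_has_derivative smooth_dir_deriv smooth_FQ K)+

lemma form_derivatives:
  "((\<lambda>x. fform g x vs) has_vector_derivative fform g1 x vs) (at x)"
  "((\<lambda>x. fform g1 x vs) has_vector_derivative fform g2 x vs) (at x)"
  "((\<lambda>x. sform r x vs) has_vector_derivative sform r1 x vs) (at x)"
  "((\<lambda>x. sform r1 x vs) has_vector_derivative sform r2 x vs) (at x)"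
  unfolding fform_def sform_def
  by (intro has_vector_derivative_sum has_vector_derivative_mult_left mode_derivatives; assumption)+

lemma wedge_fform:
  "wedge \<alpha> (\<lambda>us. a * fform f x us + b * fform f' x us) vs = (\<Sum>K\<in>idx p q. (a * f K x + b * f' K x) * wedge \<alpha> (ee K) vs)"
proof -
  have "wedge \<alpha> (\<lambda>us. a * fform f x us + b * fform f' x us) vs =
      a * (\<Sum>K\<in>idx p q. f K x * wedge \<alpha> (ee K) vs) + b * (\<Sum>K\<in>idx p q. f' K x * wedge \<alpha> (ee K) vs)"
    unfolding wedge_add_right wedge_scale_right unfolding fform_def wedge_sum_right ..
  thus ?thesis by (simp add: sum_distrib_left sum.distrib distrib_right mult.assoc)
qed

lemma wedge_sform:
  "wedge \<alpha> (\<lambda>us. a * sform f x us + b * sform f' x us) vs = (\<Sum>K\<in>idx p q. (a * f K x + b * f' K x) * wedge \<alpha> (ee (cpl K)) vs)"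
proof -
  have "wedge \<alpha> (\<lambda>us. a * sform f x us + b * sform f' x us) vs =
      a * (\<Sum>K\<in>idx p q. f K x * wedge \<alpha> (ee (cpl K)) vs) + b * (\<Sum>K\<in>idx p q. f' K x * wedge \<alpha> (ee (cpl K)) vs)"
    unfolding wedge_add_right wedge_scale_right unfolding sform_def wedge_sum_right ..
  thus ?thesis by (simp add: sum_distrib_left sum.distrib distrib_right mult.assoc)
qed

lemma fourier_coeff_equation:
  assumes u: "\<And>x. (\<Sum>j\<in>UNIV. \<Sum>K\<in>idx p q. wirtinger_deriv (u j) (F K) x * wedge (cov (u j)) (ee K) vs) = 0"
  shows "dop u av (bv k) (fform g1 x) (fform g x) vs = 0"
proof -
  have "0 = fourier_coeff k (\<lambda>x. \<Sum>(j, K)\<in>UNIV \<times> idx p q. wirtinger_deriv (u j) (F K) x * wedge (cov (u j)) (ee K) vs) x"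
    unfolding sum.cartesian_product[symmetric] u by (simp add: fourier_coeff_zero)
  also have "\<dots> = (\<Sum>(j, K)\<in>UNIV \<times> idx p q. fourier_coeff k (wirtinger_deriv (u j) (F K)) x * wedge (cov (u j)) (ee K) vs)"
    unfolding case_prod_unfold by (rule fourier_coeff_sum) (auto intro!: smooth_wirtinger_deriv smooth_FQ)
  also have "\<dots> = (\<Sum>j\<in>UNIV. \<Sum>K\<in>idx p q. (av (u j) * g1 K x + bv k (u j) * g K x) * wedge (cov (u j)) (ee K) vs)"
    unfolding sum.cartesian_product[symmetric] by (intro sum.cong refl) (simp add: fourier_coeff_wirtinger_deriv[OF aut k])
  also have "\<dots> = dop u av (bv k) (fform g1 x) (fform g x) vs"
    unfolding dop_def wedge_fform ..
  finally show ?thesis by simp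
qed

text \<open>The starred form is expanded at frequency \<open>- k\<close>, where the symbol is
  \<open>- bv k\<close>: the mixed terms change sign and the product of two symbols does not. These
  are the signs that integration by parts demands.\<close>

lemma fourier_coeff_equation2:
  "(\<Sum>j\<in>UNIV. \<Sum>l\<in>UNIV. wedge (cov (Inl j)) (wedge (cov (Inr l))
        (\<lambda>us. av (Inl j) * av (Inr l) * sform r2 x us -
           (av (Inl j) * bv k (Inr l) + bv k (Inl j) * av (Inr l)) * sform r1 x us
          + bv k (Inl j) * bv k (Inr l) * sform r x us)) vs) = 0"
proof -
  have mk: "intvec (- k)" by (rule intvec_simps(3)[OF k])
  let ?w = "\<lambda>j l K. wedge (cov (Inl j)) (wedge (cov (Inr l)) (ee (cpl K))) vs"
  have h: "fourier_coeff (- k) (wirtinger_deriv (Inl j) (wirtinger_deriv (Inr l) (Q K))) x = av (Inl j) * av (Inr l) * r2 K x -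
           (av (Inl j) * bv k (Inr l) + bv k (Inl j) * av (Inr l)) * r1 K x
          + bv k (Inl j) * bv k (Inr l) * r K x" if K: "K \<in> idx p q" for j l K
  proof -
    note sQ = smooth_FQ(2)[OF K]
    have "(fourier_coeff (- k) (wirtinger_deriv (Inr l) (Q K)) has_vector_derivative fourier_coeff (- k) (dir_deriv e0 (wirtinger_deriv (Inr l) (Q K))) x) (at x)"
      by (intro fourier_coeff_has_derivative smooth_wirtinger_deriv sQ)
    moreover have "((\<lambda>x. av (Inr l) * r1 K x + bv (- k) (Inr l) * r K x) has_vector_derivative
        (av (Inr l) * r2 K x + bv (- k) (Inr l) * r1 K x)) (at x)"
      by (intro has_vector_derivative_add has_vector_derivative_mult_right mode_derivatives K)
    ultimately have e: "fourier_coeff (- k) (dir_deriv e0 (wirtinger_deriv (Inr l) (Q K))) x = av (Inr l) * r2 K x + bv (- k) (Inr l) * r1 K x"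
      unfolding fourier_coeff_wirtinger_deriv[OF aut_Q[OF K] mk, abs_def] by (rule vector_derivative_unique_at)
    show ?thesis
      unfolding fourier_coeff_wirtinger_deriv[OF automorphic_wirtinger_deriv[OF aut_Q[OF K]] mk] e fourier_coeff_wirtinger_deriv[OF aut_Q[OF K] mk] bv_uminus
      by (simp add: algebra_simps)
  qed
  have "0 = fourier_coeff (- k) (\<lambda>x. \<Sum>jlK\<in>UNIV \<times> UNIV \<times> idx p q.
      wirtinger_deriv (Inl (fst jlK)) (wirtinger_deriv (Inr (fst (snd jlK))) (Q (snd (snd jlK)))) x * ?w (fst jlK) (fst (snd jlK)) (snd (snd jlK))) x"
  proof -
    have "(\<Sum>jlK\<in>UNIV \<times> UNIV \<times> idx p q. wirtinger_deriv (Inl (fst jlK)) (wirtinger_deriv (Inr (fst (snd jlK))) (Q (snd (snd jlK)))) x *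
        ?w (fst jlK) (fst (snd jlK)) (snd (snd jlK))) = 0" for x
      using star0[of x vs] unfolding Q_def[symmetric] by (simp add: sum.cartesian_product case_prod_unfold)
    thus ?thesis by (simp add: fourier_coeff_zero)
  qed
  also have "\<dots> = (\<Sum>jlK\<in>UNIV \<times> UNIV \<times> idx p q. fourier_coeff (- k) (wirtinger_deriv (Inl (fst jlK)) (wirtinger_deriv (Inr (fst (snd jlK))) (Q (snd (snd jlK))))) x *
      ?w (fst jlK) (fst (snd jlK)) (snd (snd jlK)))"
    by (rule fourier_coeff_sum) (auto intro!: smooth_wirtinger_deriv smooth_FQ)
  also have "\<dots> = (\<Sum>j\<in>UNIV. \<Sum>l\<in>UNIV. \<Sum>K\<in>idx p q. fourier_coeff (- k) (wirtinger_deriv (Inl j) (wirtinger_deriv (Inr l) (Q K))) x * ?w j l K)"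
    by (simp add: sum.cartesian_product case_prod_unfold)
  also have "\<dots> = (\<Sum>j\<in>UNIV. \<Sum>l\<in>UNIV. wedge (cov (Inl j)) (wedge (cov (Inr l))
        (\<lambda>us. av (Inl j) * av (Inr l) * sform r2 x us -
           (av (Inl j) * bv k (Inr l) + bv k (Inl j) * av (Inr l)) * sform r1 x us
          + bv k (Inl j) * bv k (Inr l) * sform r x us)) vs)"
  proof (intro sum.cong refl)
    fix j l
    have s: "wedge (wedge (cov (Inl j)) (cov (Inr l))) (sform f x) vs = (\<Sum>K\<in>idx p q. f K x * ?w j l K)" for f
      unfolding sform_def wedge_sum_right wedge_assoc ..
    show "(\<Sum>K\<in>idx p q. fourier_coeff (- k) (wirtinger_deriv (Inl j) (wirtinger_deriv (Inr l) (Q K))) x * ?w j l K) =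
      wedge (cov (Inl j)) (wedge (cov (Inr l))
        (\<lambda>us. av (Inl j) * av (Inr l) * sform r2 x us -
           (av (Inl j) * bv k (Inr l) + bv k (Inl j) * av (Inr l)) * sform r1 x us
          + bv k (Inl j) * bv k (Inr l) * sform r x us)) vs"
      unfolding wedge_assoc[symmetric] wedge_add_right wedge_diff_right wedge_scale_right s
        sum_distrib_left sum_subtractf[symmetric] sum.distrib[symmetric]
      by (intro sum.cong refl) (simp add: h wedge_assoc algebra_simps)
  qed
  finally show ?thesis by simp
qed

text \<open>Up to the constants and a positive exponential, \<open>r K\<close> is the conjugate of
  \<open>g K\<close> times \<open>cpl_sign K\<close>, and the sign squares away against the one from
  the wedge product.\<close>

lemma pairing:
  "wedge (fform g x) (sform r x) vs =
    2 ^ (p + q) * V * of_real (\<Sum>K\<in>idx p q. exp (2 * cc K * x) * (norm (g K x))\<^sup>2) * ee full vs"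
proof -
  have "g K x * r K x * cpl_sign K = 2 ^ (p + q) * V * of_real (exp (2 * cc K * x) * (norm (g K x))\<^sup>2)"
    if K: "K \<in> idx p q" for K
  proof -
    have "g K x * r K x * cpl_sign K = (cpl_sign K * cpl_sign K) * (2 ^ (p + q) * V * of_real (exp (2 * cc K * x)) * (g K x * cnj (g K x)))"
      unfolding fourier_coeff_Q[OF K] by (simp add: algebra_simps)
    thus ?thesis by (simp only: cpl_sign_square complex_norm_square[symmetric] of_real_mult mult_1_left mult.assoc)
  qed
  thus ?thesis unfolding fform_def sform_def wedge_sum_ee_cpl by (simp add: sum_distrib_left)
qed

section \<open>The boundary term of a mode\<close>

lemma homog_forms: "homog (p + q) (fform f x)"
  "homog ((CARD('n option) - p) + (CARD('n option) - q)) (sform f x)"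
proof -
  show "homog (p + q) (fform f x)" unfolding fform_def by (intro homog_sum homog_scale homog_ee)
  have "cpl K \<in> idx (CARD('n option) - p) (CARD('n option) - q)" if "K \<in> idx p q" for K :: "'n option set \<times> 'n option set"
    using bij_betw_apply[OF bij_cpl[OF pq] that] .
  thus "homog ((CARD('n option) - p) + (CARD('n option) - q)) (sform f x)"
    unfolding sform_def by (intro homog_sum homog_scale homog_ee)
qed

text \<open>Two contractions and two covectors balance, so the boundary form has the degree of a
  form wedged with its star, which is the top degree. For p + q < 2 the contractions already
  vanish.\<close>

lemma bdry_top:
  "\<exists>c. bdry a b (iota s (iota t (fform f x))) (iota s (iota t (fform f' x))) (sform h x) (sform h' x) = (\<lambda>vs. c * ee full vs)"
proof (cases "p + q < 2")
  case True
  hence "bdry a b (iota s (iota t (fform f x))) (iota s (iota t (fform f' x))) (sform h x) (sform h' x) = (\<lambda>vs. 0 * ee full vs)"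
    by (simp add: homog_less_2_iota[OF homog_forms(1)] bdry_def wedge_fun_simps)
  thus ?thesis by blast
next
  case False
  define j where "j = p + q - 2"
  have j: "p + q = Suc (Suc j)" using False by (simp add: j_def)
  have h: "homog j (iota s (iota t (fform f x)))" for f
    using homog_forms(1)[of f x] unfolding j by (intro homog_iota)
  have deg: "Suc (Suc j) + ((CARD('n option) - p) + (CARD('n option) - q)) = 2 * CARD('n option)"
    using pq j by linarith
  have w: "homog (2 * CARD('n option)) (wedge (wedge (cov k) (wedge (cov l) (iota s (iota t (fform f x))))) (sform h x))"
    for k l f h
    unfolding deg[symmetric] by (intro homog_wedge homog_cov h homog_forms(2))
  have wirtinger_deriv: "homog (2 * CARD('n option)) (\<lambda>vs. wedge (wedge (cov k) (wedge (cov l) (iota s (iota t (fform f x))))) (sform h x) vs -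
      wedge (wedge (cov k) (wedge (cov l) (iota s (iota t (fform f' x))))) (sform h' x) vs)" for k l f h f' h'
    using homog.lin[OF w[of k l f h] w[of k l f' h'], of 1 "-1"] by simp
  have "homog (2 * CARD('n option)) (bdry a b (iota s (iota t (fform f x))) (iota s (iota t (fform f' x))) (sform h x) (sform h' x))"
    unfolding bdry_def by (intro homog_sum homog_add homog_scale w wirtinger_deriv)
  thus ?thesis unfolding ee_def
    by (intro homog_top) (simp_all add: lst_simps(1) set_lst_full)
qed

text \<open>Pullback by \<open>scl 1\<close> multiplies a covector of weight m by e^m. By hypothesis
  the symbols vanish wherever m \<noteq> 0, so no such factor survives.\<close>

lemma bdry_scl:
  assumes ab: "\<And>t. mu (index_of t) \<noteq> 0 \<Longrightarrow> a t = 0 \<and> b t = 0"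
  shows "bdry a b \<gamma> \<gamma>1 \<theta> \<theta>1 (map (scl 1) vs) = bdry a b (\<lambda>us. \<gamma> (map (scl 1) us)) (\<lambda>us. \<gamma>1 (map (scl 1) us))
    (\<lambda>us. \<theta> (map (scl 1) us)) (\<lambda>us. \<theta>1 (map (scl 1) us)) vs"
proof -
  have w: "wedge (wedge (cov k) (wedge (cov l) \<gamma>)) \<theta> (map (scl 1) vs) = of_real (exp (mu (index_of k)) * exp (mu (index_of l))) *
     wedge (wedge (cov k) (wedge (cov l) (\<lambda>us. \<gamma> (map (scl 1) us)))) (\<lambda>us. \<theta> (map (scl 1) us)) vs" for k l \<gamma> \<theta>
    by (simp add: wedge_map_app cov_scl wedge_fun_simps mult.assoc)
  show ?thesis unfolding bdry_def w
  proof (intro sum.cong refl)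
    fix k l
    let ?w = "\<lambda>\<gamma> \<theta>. wedge (wedge (cov (Inl k)) (wedge (cov (Inr l)) (\<lambda>us. \<gamma> (map (scl 1) us)))) (\<lambda>us. \<theta> (map (scl 1) us)) vs"
    let ?e = "complex_of_real (exp (mu (index_of (Inl k))) * exp (mu (index_of (Inr l))))"
    have "mu (index_of (Inl k)) = 0 \<and> mu (index_of (Inr l)) = 0 \<or>
        a (Inl k) * a (Inr l) = 0 \<and> a (Inl k) * b (Inr l) + b (Inl k) * a (Inr l) = 0"
      using ab[of "Inl k"] ab[of "Inr l"]
      by (cases "mu (index_of (Inl k)) = 0"; cases "mu (index_of (Inr l)) = 0") simp_all
    thus "a (Inl k) * a (Inr l) * (?e * ?w \<gamma>1 \<theta> - ?e * ?w \<gamma> \<theta>1) + (a (Inl k) * b (Inr l) + b (Inl k) * a (Inr l)) * (?e * ?w \<gamma> \<theta>) =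
      a (Inl k) * a (Inr l) * (?w \<gamma>1 \<theta> - ?w \<gamma> \<theta>1) + (a (Inl k) * b (Inr l) + b (Inl k) * a (Inr l)) * ?w \<gamma> \<theta>"
      by (elim disjE conjE) (simp_all only: exp_zero mult_1_left of_real_1 mult_zero_left)
  qed
qed

lemma iota_scl: "mu (index_of t) = 0 \<Longrightarrow> iota t \<beta> (map (scl 1) vs) = iota t (\<lambda>us. \<beta> (map (scl 1) us)) vs"
  by (cases t) (simp_all add: iota_def scl_axis)

lemma nonzero_fibre_mode:
  assumes i: "c \<in> {1, \<i>}" "freq k (axis (Some i) c) \<noteq> 0" and K: "K \<in> idx p q"
  shows "g K x = 0"
proof -
  obtain vs0 :: "(complex, 'n option) vec list" where vs0: "ee full vs0 \<noteq> 0" using ee_full_nonzero by blast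
  let ?\<gamma> = "\<lambda>x. iota (Inr (Some i)) (iota (Inl (Some i)) (fform g x))"
  let ?\<gamma>1 = "\<lambda>x. iota (Inr (Some i)) (iota (Inl (Some i)) (fform g1 x))"
  define B where "B = (\<lambda>x. bdry av (bv k) (?\<gamma> x) (?\<gamma>1 x) (sform r x) (sform r1 x))"
  define E where "E = (\<lambda>x. \<Sum>K\<in>idx p q. exp (2 * cc K * x) * (norm (g K x))\<^sup>2)"
  define \<kappa> where "\<kappa> = bv k (Inl (Some i)) * bv k (Inr (Some i)) * (2 ^ (p + q) * V * ee full vs0)"
  have freq: "freq k (axis (Some i) 1) \<noteq> 0 \<or> freq k (axis (Some i) \<i>) \<noteq> 0" using i by blast
  \<comment> \<open>With real frequencies \<xi> and \<eta> in the directions 1 and \<i>, the two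
    symbols are (\<i> \<xi> + \<eta>)/2 and (\<i> \<xi> - \<eta>)/2; each of them vanishes only if
    both frequencies do.\<close>
  have "bv k (Inl (Some i)) \<noteq> 0" "bv k (Inr (Some i)) \<noteq> 0"
    using freq by (auto simp: bv_def complex_eq_iff)
  hence \<kappa>: "\<kappa> \<noteq> 0" using vs0 V by (simp add: \<kappa>_def)
  have dB: "((\<lambda>x. B x vs0) has_vector_derivative of_real (E x) * \<kappa>) (at x)" for x
  proof -
    have "((\<lambda>x. B x vs0) has_vector_derivative bv k (Inl (Some i)) * bv k (Inr (Some i)) *
        wedge (fform g x) (sform r x) vs0) (at x)"
      unfolding B_def
      by (rule energy_identity[OF form_derivatives fourier_coeff_equation[OF del0] fourier_coeff_equation[OF delbar0] fourier_coeff_equation2])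
        (simp_all add: av_def)
    thus ?thesis by (simp add: pairing E_def \<kappa>_def mult_ac)
  qed
  \<comment> \<open>Division by \<kappa> turns the derivative of the boundary term into the real
    energy \<open>E\<close>, so its real part is monotone.\<close>
  define \<phi> where "\<phi> = (\<lambda>x. Re (B x vs0 / \<kappa>))"
  have d\<phi>: "(\<phi> has_real_derivative E x) (at x)" for x
  proof -
    have "((\<lambda>x. B x vs0 / \<kappa>) has_vector_derivative of_real (E x) * \<kappa> / \<kappa>) (at x)"
      by (intro has_vector_derivative_divide dB)
    from bounded_linear.has_vector_derivative[OF bounded_linear_Re this]
    show ?thesis using \<kappa> by (simp add: \<phi>_def has_real_derivative_iff_has_vector_derivative)
  qed
  have AB: "(\<exists>C. \<forall>x. \<bar>\<phi> x\<bar> \<le> C * exp (- \<bar>x\<bar>)) \<or> (\<forall>x. \<phi> (x + 1) = \<phi> x)"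
  proof (cases "\<exists>i c. c \<in> {1, \<i>} \<and> freq k (axis (Some i) c) \<noteq> 0 \<and> lam i \<noteq> 0")
    case True
    then obtain i0 c0 where "c0 \<in> {1, \<i>}" "freq k (axis (Some i0) c0) \<noteq> 0" "lam i0 \<noteq> 0" by blast
    from freq_sign[OF k this] obtain i1 j1 where ij: "freq k (axis (Some i1) c0) \<noteq> 0" "lam i1 > 0"
      "freq k (axis (Some j1) c0) \<noteq> 0" "lam j1 < 0" .
    have sd: "superdecay (fourier_coeff k G)" if "automorphic s G" for s G
      by (rule fourier_coeff_superdecay[OF that k ij])
    have sd': "superdecay (fourier_coeff (- k) G)" if "automorphic s G" for s G
      by (rule fourier_coeff_superdecay[OF that intvec_simps(3)[OF k], of i1 c0 j1 c0]) (use ij in \<open>simp_all add: freq_uminus\<close>)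
    have f: "superdecay (\<lambda>x. fform f x us)" if "\<And>K. K \<in> idx p q \<Longrightarrow> superdecay (f K)" for f us
      unfolding fform_def mult.commute[of _ "ee _ _"] by (intro superdecay_sum superdecay_scale that)
    have s: "superdecay (\<lambda>x. sform f x us)" if "\<And>K. K \<in> idx p q \<Longrightarrow> superdecay (f K)" for f us
      unfolding sform_def mult.commute[of _ "ee _ _"] by (intro superdecay_sum superdecay_scale that)
    have fs: "superdecay (\<lambda>x. fform g x us)" "superdecay (\<lambda>x. fform g1 x us)"
      "superdecay (\<lambda>x. sform r x us)" "superdecay (\<lambda>x. sform r1 x us)" for us
      by (intro f s, (rule sd sd', (intro automorphic_e0)?, erule aut aut_Q))+
    have diff: "superdecay (\<lambda>x. f x - h x)" if "superdecay f" "superdecay h" for f h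
      using superdecay_add[OF that(1) superdecay_scale[OF that(2), of "-1"]] by simp
    have "superdecay (\<lambda>x. B x vs0)"
      unfolding B_def bdry_def
      by (intro superdecay_sum superdecay_add superdecay_scale diff superdecay_wedge superdecay_wedge_const superdecay_iota fs)
    then obtain C where C: "\<And>x. norm (B x vs0) \<le> C * exp (- real 1 * \<bar>x\<bar>)"
      unfolding superdecay_def by blast
    have "\<bar>\<phi> x\<bar> \<le> (C / norm \<kappa>) * exp (- \<bar>x\<bar>)" for x
    proof -
      have "\<bar>\<phi> x\<bar> \<le> norm (B x vs0) / norm \<kappa>"
        unfolding \<phi>_def using abs_Re_le_cmod[of "B x vs0 / \<kappa>"] by (simp add: norm_divide)
      also have "\<dots> \<le> (C * exp (- \<bar>x\<bar>)) / norm \<kappa>" using C[of x] by (intro divide_right_mono) simp_all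
      finally show ?thesis by simp
    qed
    thus ?thesis by blast
  next
    case False
    hence fixd: "lam i = 0" if "c \<in> {1, \<i>}" "freq k (axis (Some i) c) \<noteq> 0" for i c using that by blast
    have fixd': "lam i = 0" if "c \<in> {1, \<i>}" "freq (- k) (axis (Some i) c) \<noteq> 0" for i c
      using fixd[OF that(1)] that(2) by (simp add: freq_uminus)
    have ab: "av t = 0 \<and> bv k t = 0" if nz: "mu (index_of t) \<noteq> 0" for t
    proof -
      obtain j where j: "index_of t = Some j" "lam j \<noteq> 0" using nz by (cases "index_of t") auto
      hence "freq k (axis (Some j) 1) = 0" "freq k (axis (Some j) \<i>) = 0" using fixd by blast+
      thus ?thesis using j by (simp add: av_def bv_def)
    qed
    have sh: "fourier_coeff k G (x + 1) = of_real (exp (- s)) * fourier_coeff k G x" if "automorphic s G" for s G x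
      by (rule fourier_coeff_shift[OF that k fixd])
    have sh': "fourier_coeff (- k) G (x + 1) = of_real (exp (- s)) * fourier_coeff (- k) G x" if "automorphic s G" for s G x
      by (rule fourier_coeff_shift[OF that intvec_simps(3)[OF k] fixd'])
    have ex: "complex_of_real (exp (- c)) * z * (of_real (exp c) * e) = z * e" for c z e
    proof -
      have "complex_of_real (exp (- c)) * of_real (exp c) = 1" by (simp flip: of_real_mult exp_add)
      thus ?thesis by (metis (no_types, lifting) mult.assoc mult.left_commute mult_1_left)
    qed
    have f: "fform f (x + 1) (map (scl 1) us) = fform f x us"
      if "\<And>K x. K \<in> idx p q \<Longrightarrow> f K (x + 1) = of_real (exp (- cc K)) * f K x" for f x us
      unfolding fform_def
      by (intro sum.cong refl) (simp only: that ee_scl mult_1_left ex)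
    have s: "sform f (x + 1) (map (scl 1) us) = sform f x us"
      if "\<And>K x. K \<in> idx p q \<Longrightarrow> f K (x + 1) = of_real (exp (- (- cc K))) * f K x" for f x us
      unfolding sform_def
      by (intro sum.cong refl) (simp only: that ee_scl cc_cpl mult_1_left ex)
    have fs: "fform g (x + 1) (map (scl 1) us) = fform g x us" "fform g1 (x + 1) (map (scl 1) us) = fform g1 x us"
      "sform r (x + 1) (map (scl 1) us) = sform r x us" "sform r1 (x + 1) (map (scl 1) us) = sform r1 x us" for x us
      by (rule f s, rule sh sh', (intro automorphic_e0)?, erule aut aut_Q)+
    have mi: "mu (index_of (Inl (Some i))) = 0" "mu (index_of (Inr (Some i))) = 0"
      using fixd[OF i] by simp_all
    \<comment> \<open>As a top-degree form of weight 0, \<open>B (x + 1)\<close> is invariant under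
      \<open>scl 1\<close>; pulling back its ingredients instead turns their values at x + 1 into
      those at x.\<close>
    have "B (x + 1) vs0 = B x vs0" for x
    proof -
      obtain c where c: "B (x + 1) = (\<lambda>vs. c * ee full vs)"
        unfolding B_def using bdry_top by blast
      have "B (x + 1) (map (scl 1) vs0) = B (x + 1) vs0" unfolding c by (simp add: ee_scl cc_full)
      moreover have "B (x + 1) (map (scl 1) vs0) = bdry av (bv k) (\<lambda>us. ?\<gamma> (x + 1) (map (scl 1) us))
          (\<lambda>us. ?\<gamma>1 (x + 1) (map (scl 1) us)) (\<lambda>us. sform r (x + 1) (map (scl 1) us)) (\<lambda>us. sform r1 (x + 1) (map (scl 1) us)) vs0"
        unfolding B_def by (rule bdry_scl) (rule ab)
      moreover have "\<dots> = B x vs0"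
        unfolding B_def iota_scl[OF mi(2)] iota_scl[OF mi(1)] fs ..
      ultimately show ?thesis by simp
    qed
    thus ?thesis by (simp add: \<phi>_def)
  qed
  have "E x = 0"
    by (rule nondecreasing_constant[OF d\<phi> _ AB]) (auto simp: E_def intro!: sum_nonneg)
  hence "exp (2 * cc K * x) * (norm (g K x))\<^sup>2 = 0"
    unfolding E_def by (subst (asm) sum_nonneg_eq_0_iff) (use K in auto)
  thus ?thesis by simp
qed

section \<open>Modes constant along the fibre directions z_i\<close>

lemma cc_c_IJ: "cc K = c_IJ lam (Some -` fst K) (Some -` snd K)"
proof -
  have "sum mu A = sum lam (Some -` A)" for A :: "'n option set"
  proof -
    have "sum mu A = sum mu (Some ` (Some -` A))"
    proof (rule sum.mono_neutral_right)
      show "\<forall>k\<in>A - Some ` (Some -` A). mu k = 0"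
      proof
        fix k assume "k \<in> A - Some ` (Some -` A)" thus "mu k = 0" by (cases k) auto
      qed
    qed auto
    also have "\<dots> = sum lam (Some -` A)" by (subst sum.reindex) auto
    finally show ?thesis .
  qed
  thus ?thesis by (simp add: cc_def c_IJ_def)
qed

text \<open>The frequency in the direction of Im w is 2 pi n / \<tau> with n an integer, so its
  equality with \<plusminus>\<open>cc K\<close> places \<tau> \<open>cc K\<close> in 2 pi
  \<int>.\<close>

lemma resonance:
  assumes "freq k (axis None \<i>) = s * cc K" "s \<in> {1, -1}"
  shows "cc K = 0"
proof -
  obtain n :: int where n: "fst k = of_int n" using k unfolding intvec_torus by (metis Ints_cases)
  have z: "(\<chi> i. Re (axis None \<i> $ Some i)) = (0 :: (real, 'n) vec)" "(\<chi> i. Im (axis None \<i> $ Some i)) = (0 :: (real, 'n) vec)"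
    by (simp_all add: vec_eq_iff axis_def)
  have "freq k (axis None \<i>) = 2 * pi * n / \<tau>"
    unfolding freq_def Linv_def z using n by (cases k) (simp add: axis_def)
  hence "\<tau> * cc K = 2 * pi * of_int n \<or> \<tau> * cc K = 2 * pi * of_int (- n)"
    using assms tau by (auto simp: field_simps)
  hence "\<exists>m::int. \<tau> * cc K = 2 * pi * of_int m" by blast
  thus ?thesis unfolding cc_c_IJ nonres .
qed

text \<open>Only dw and dwbar remain in the equations. \<partial>-closedness governs the
  coefficients without dw, \<partial>bar-closedness those without dwbar, and the equation for the
  star those with both, whose complements contain neither. The exponents are \<plusminus>\<kappa>,
  with \<kappa> the frequency in Im w; the shift by 1 equates them with
  \<plusminus>\<open>cc K\<close>, which \<open>resonance\<close> allows only when both are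
  0.\<close>

lemma zero_fibre_mode:
  assumes z: "\<And>i c. c \<in> {1, \<i>} \<Longrightarrow> freq k (axis (Some i) c) = 0" and K: "K \<in> idx p q"
  shows "(\<forall>x. g K x = 0) \<or> (k = 0 \<and> cc K = 0 \<and> (\<exists>C. \<forall>x. g K x = C))"
proof -
  define \<kappa> where "\<kappa> = freq k (axis None \<i>)"
  have k0: "k = 0" if "\<kappa> = 0"
  proof (rule freq_zero_imp)
    fix i and c :: complex assume "c \<in> {1, \<i>}"
    thus "freq k (axis i c) = 0" using z that by (cases i) (auto simp: \<kappa>_def freq_axis_None)
  qed
  have bN: "bv k (Inl None) = of_real \<kappa> / 2" "bv k (Inr None) = - of_real \<kappa> / 2"
    by (simp_all add: bv_def freq_axis_None \<kappa>_def)
  have bS: "bv k (Inl (Some i)) = 0" "bv k (Inr (Some i)) = 0" for i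
    using z by (simp_all add: bv_def)
  have aS: "av (Inl (Some i)) = 0" "av (Inr (Some i)) = 0" "av (Inl None) = 1/2" "av (Inr None) = 1/2" for i
    by (simp_all add: av_def)
  have opt: "(\<Sum>j\<in>UNIV. f j) = f None" if "\<And>i. f (Some i) = 0" for f :: "'n option \<Rightarrow> complex"
    using that by (simp add: UNIV_option_conv sum.reindex)
  have resK: "\<kappa> = cc K \<Longrightarrow> \<kappa> = 0" "\<kappa> = - cc K \<Longrightarrow> \<kappa> = 0"
    using resonance[of 1 K] resonance[of "-1" K] by (auto simp: \<kappa>_def)
  have dL: "g1 K x = of_real (- \<kappa>) * g K x" if "None \<notin> fst K" for x
  proof -
    have "wedge (cov (Inl None)) (\<lambda>us. 1/2 * fform g1 x us + of_real \<kappa> / 2 * fform g x us) vs = 0" for vs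
      using fourier_coeff_equation[OF del0, of x vs] unfolding dop_def by (subst (asm) opt) (simp_all add: bS aS bN)
    hence "(\<lambda>vs. \<Sum>L\<in>idx p q. (1/2 * g1 L x + of_real \<kappa> / 2 * g L x) * wedge (cov (Inl None)) (ee L) vs) = (\<lambda>vs. 0)"
      unfolding wedge_fform by (intro ext)
    hence "coef (Inl None # lst K) (\<lambda>vs. \<Sum>L\<in>idx p q. (1/2 * g1 L x + of_real \<kappa> / 2 * g L x) * wedge (cov (Inl None)) (ee L) vs) = 0"
      by (simp only: coef_linear)
    moreover have ni: "Inl None \<notin> set (lst K)" using that by (auto simp: lst_simps)
    ultimately have "(\<Sum>L\<in>idx p q. (1/2 * g1 L x + of_real \<kappa> / 2 * g L x) * (if L = K then 1 else 0)) = 0"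
      unfolding coef_sum coef_wedge_cov[OF ni] by blast
    hence "1/2 * g1 K x + of_real \<kappa> / 2 * g K x = 0"
      using K by (simp add: if_distrib[of "\<lambda>x. _ * x"] cong: if_cong)
    thus ?thesis by (simp add: field_simps add_eq_0_iff2)
  qed
  have dR: "g1 K x = of_real \<kappa> * g K x" if "None \<notin> snd K" for x
  proof -
    have "wedge (cov (Inr None)) (\<lambda>us. 1/2 * fform g1 x us + - of_real \<kappa> / 2 * fform g x us) vs = 0" for vs
      using fourier_coeff_equation[OF delbar0, of x vs] unfolding dop_def by (subst (asm) opt) (simp_all add: bS aS bN)
    hence "(\<lambda>vs. \<Sum>L\<in>idx p q. (1/2 * g1 L x + - of_real \<kappa> / 2 * g L x) * wedge (cov (Inr None)) (ee L) vs) = (\<lambda>vs. 0)"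
      unfolding wedge_fform by (intro ext)
    hence "coef (Inr None # lst K) (\<lambda>vs. \<Sum>L\<in>idx p q. (1/2 * g1 L x + - of_real \<kappa> / 2 * g L x) * wedge (cov (Inr None)) (ee L) vs) = 0"
      by (simp only: coef_linear)
    moreover have ni: "Inr None \<notin> set (lst K)" using that by (auto simp: lst_simps)
    ultimately have "(\<Sum>L\<in>idx p q. (1/2 * g1 L x + - of_real \<kappa> / 2 * g L x) * (if L = K then 1 else 0)) = 0"
      unfolding coef_sum coef_wedge_cov[OF ni] by blast
    hence "1/2 * g1 K x + - of_real \<kappa> / 2 * g K x = 0"
      using K by (simp add: if_distrib[of "\<lambda>x. _ * x"] cong: if_cong)
    thus ?thesis by (simp add: field_simps)
  qed
  have dLR: "r2 K x = of_real \<kappa> * of_real \<kappa> * r K x" if "None \<in> fst K" "None \<in> snd K" for x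
  proof -
    have "wedge (cov (Inl None)) (wedge (cov (Inr None))
       (\<lambda>us. 1/4 * sform r2 x us + - (of_real \<kappa> * of_real \<kappa>) / 4 * sform r x us)) vs = 0" for vs
    proof -
      have "(\<Sum>l\<in>UNIV. wedge (cov (Inl None)) (wedge (cov (Inr l))
        (\<lambda>us. av (Inl None) * av (Inr l) * sform r2 x us -
           (av (Inl None) * bv k (Inr l) + bv k (Inl None) * av (Inr l)) * sform r1 x us
          + bv k (Inl None) * bv k (Inr l) * sform r x us)) vs) = 0"
        using fourier_coeff_equation2[of x vs] by (subst (asm) opt) (simp_all add: bS aS wedge_fun_simps)
      thus ?thesis by (subst (asm) opt) (simp_all add: bS aS bN wedge_fun_simps)
    qed
    hence "(\<lambda>vs. \<Sum>L\<in>idx p q. (1/4 * r2 L x + - (of_real \<kappa> * of_real \<kappa>) / 4 * r L x) *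
        wedge (cov (Inl None)) (wedge (cov (Inr None)) (ee (cpl L))) vs) = (\<lambda>vs. 0)"
      unfolding wedge_assoc[symmetric] wedge_sform by (intro ext)
    hence "coef (Inl None # Inr None # lst (cpl K)) (\<lambda>vs. \<Sum>L\<in>idx p q. (1/4 * r2 L x + - (of_real \<kappa> * of_real \<kappa>) / 4 * r L x) *
        wedge (cov (Inl None)) (wedge (cov (Inr None)) (ee (cpl L))) vs) = 0"
      by (simp only: coef_linear)
    moreover have ni: "Inl None \<notin> set (lst (cpl K))" "Inr None \<notin> set (lst (cpl K))"
      using that by (auto simp: lst_simps cpl_def)
    have "cpl L = cpl K \<longleftrightarrow> L = K" for L by (auto simp: cpl_def prod_eq_iff)
    note cpl = coef_wedge_cov_cov[OF ni, of "cpl _", simplified this, OF Inl_not_Inr]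
    ultimately have "(\<Sum>L\<in>idx p q. (1/4 * r2 L x + - (of_real \<kappa> * of_real \<kappa>) / 4 * r L x) * (if L = K then 1 else 0)) = 0"
      unfolding coef_sum cpl by blast
    hence "1/4 * r2 K x + - (of_real \<kappa> * of_real \<kappa>) / 4 * r K x = 0"
      using K by (simp add: if_distrib[of "\<lambda>x. _ * x"] cong: if_cong)
    thus ?thesis by (simp add: field_simps)
  qed
  have shg: "g K (x + 1) = of_real (exp (- cc K)) * g K x" for x
    by (rule fourier_coeff_shift[OF aut[OF K] k]) (use z in blast)
  have shr: "r K (x + 1) = of_real (exp (cc K)) * r K x" "r1 K (x + 1) = of_real (exp (cc K)) * r1 K x" for x
    using fourier_coeff_shift[OF aut_Q[OF K] intvec_simps(3)[OF k], of x]
      fourier_coeff_shift[OF automorphic_e0[OF aut_Q[OF K]] intvec_simps(3)[OF k], of x] z by (simp_all add: freq_uminus)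
  note dg = mode_derivatives[OF K]
  have zconst: "\<exists>C. \<forall>x. f x = C" if z: "\<And>x. (f has_vector_derivative 0) (at x)" for f :: "real \<Rightarrow> complex"
  proof -
    obtain C where "\<And>x. f x = C" using has_vector_derivative_zero_constant[of UNIV f] z by auto
    thus ?thesis by blast
  qed
  have const: "(\<forall>x. g K x = 0) \<or> (k = 0 \<and> cc K = 0 \<and> (\<exists>C. \<forall>x. g K x = C))"
    if d: "\<And>x. g1 K x = of_real \<mu> * g K x" and \<mu>: "\<mu> = \<kappa> \<or> \<mu> = - \<kappa>" for \<mu>
  proof -
    have "(g K has_vector_derivative of_real \<mu> * g K x) (at x)" for x
      using dg(1)[of x] unfolding d .
    hence "(\<forall>x. g K x = 0) \<or> \<mu> = - cc K"
      by (rule exponential_solution) (rule shg)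
    moreover have "k = 0 \<and> cc K = 0 \<and> (\<exists>C. \<forall>x. g K x = C)" if "\<mu> = - cc K"
    proof -
      have \<kappa>0: "\<kappa> = 0" using that \<mu> resK by auto
      have "(g K has_vector_derivative 0) (at x)" for x using dg(1)[of x] \<kappa>0 \<mu> unfolding d by auto
      from zconst[OF this] show ?thesis using k0 \<kappa>0 \<mu> that by auto
    qed
    ultimately show ?thesis by blast
  qed
  show ?thesis
  proof (cases "None \<in> fst K \<and> None \<in> snd K")
    case False
    thus ?thesis using const[of "- \<kappa>"] const[of \<kappa>] dL dR by blast
  next
    case True
    \<comment> \<open>The equation r'' = \<kappa>^2 r factors as (d/dx + \<kappa>)(d/dx - \<kappa>)
      r = 0, so \<open>exponential_solution\<close> is applied to \<open>u\<close> and then to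
      \<open>r K\<close>.\<close>
    define u where "u = (\<lambda>x. r1 K x - of_real \<kappa> * r K x)"
    have du: "(u has_vector_derivative of_real (- \<kappa>) * u x) (at x)" for x
    proof -
      have "(u has_vector_derivative (r2 K x - of_real \<kappa> * r1 K x)) (at x)"
        unfolding u_def by (intro has_vector_derivative_diff has_vector_derivative_mult_right dg)
      thus ?thesis using dLR True by (simp add: u_def algebra_simps)
    qed
    have shu: "u (x + 1) = of_real (exp (cc K)) * u x" for x
      unfolding u_def shr by (simp add: algebra_simps)
    have u0: "u x = 0" for x
    proof (rule disjE[OF exponential_solution[OF du shu]])
      assume kc: "- \<kappa> = cc K"
      hence \<kappa>0: "\<kappa> = 0" using resK by auto
      hence c0: "cc K = 0" using kc by simp
      have "(u has_vector_derivative 0) (at x)" for x using du[of x] \<kappa>0 by simp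
      from zconst[OF this] obtain C where C: "\<And>x. u x = C" by blast
      have r1: "r1 K x = C" for x using C[of x] \<kappa>0 by (simp add: u_def)
      \<comment> \<open>For \<kappa> = 0 the solution is affine in x with slope \<open>C\<close>;
        invariance under x \<mapsto> x + 1 leaves no slope.\<close>
      have "((\<lambda>x. r K x - x *\<^sub>R C) has_vector_derivative r1 K x - 1 *\<^sub>R C) (at x)" for x
        by (intro has_vector_derivative_diff dg) (auto intro!: derivative_eq_intros)
      hence "((\<lambda>x. r K x - x *\<^sub>R C) has_vector_derivative 0) (at x)" for x by (simp add: r1)
      from zconst[OF this] obtain D where D: "\<And>x. r K x - x *\<^sub>R C = D" by blast
      have "C = 0" using D[of 0] D[of 1] shr(1)[of 0] c0 by simp
      thus "u x = 0" using C by simp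
    qed blast
    have dr: "(r K has_vector_derivative of_real \<kappa> * r K x) (at x)" for x
      using dg(3)[of x] u0[of x] by (simp add: u_def)
    have rg: "r K x = 0 \<longleftrightarrow> g K x = 0" for x
      using cpl_sign(1)[of K] V unfolding fourier_coeff_Q[OF K] by auto
    show ?thesis
    proof (rule disjE[OF exponential_solution[OF dr shr(1)]])
      assume "\<forall>x. r K x = 0"
      thus ?thesis using rg by blast
    next
      assume kc: "\<kappa> = cc K"
      hence \<kappa>0: "\<kappa> = 0" "cc K = 0" using resK by auto
      have "(r K has_vector_derivative 0) (at x)" for x using dr[of x] \<kappa>0 by simp
      from zconst[OF this] obtain C where C: "\<And>x. r K x = C" by blast
      have "g K x = g K 0" for x
      proof -
        have "(2 ^ (p + q) * cpl_sign K * V) * cnj (g K x) = (2 ^ (p + q) * cpl_sign K * V) * cnj (g K 0)"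
          using C[of x] C[of 0] unfolding fourier_coeff_Q[OF K] by (simp add: \<kappa>0)
        thus ?thesis using cpl_sign(1)[of K] V by auto
      qed
      thus ?thesis using \<kappa>0 k0 by blast
    qed
  qed
qed

end

text \<open>All nonzero frequencies vanish, so by uniqueness of Fourier series each coefficient
  equals its zero mode, to which \<open>zero_fibre_mode\<close> with \<open>k = 0\<close>
  applies.\<close>

theorem constant_coefficients:
  assumes K: "K \<in> idx p q"
  shows "F K y = F K 0" "cc K \<noteq> 0 \<Longrightarrow> F K 0 = 0"
proof -
  have 0: "fourier_coeff k (F K) x = 0" if k: "intvec k" "k \<noteq> 0" for k x
    using nonzero_fibre_mode[OF k(1) _ _ K] zero_fibre_mode[OF k(1) _ K] k(2) by blast
  have F: "F K y = fourier_coeff 0 (F K) (Re (y $ None))" for y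
    using fourier_coeff_unique[OF aut[OF K] 0, where t = "Linv y" and x = "Re (y $ None)"] by (simp add: zpt_Linv)
  have "freq 0 v = 0" for v by (simp add: freq_def)
  hence z: "(\<forall>x. fourier_coeff 0 (F K) x = 0) \<or> (cc K = 0 \<and> (\<exists>C. \<forall>x. fourier_coeff 0 (F K) x = C))"
    using zero_fibre_mode[OF intvec_simps(1) _ K] by blast
  show "F K y = F K 0"
    using z F[of y] F[of 0] by (elim disjE conjE exE) simp_all
  show "F K 0 = 0" if c: "cc K \<noteq> 0"
    using z F[of 0] c by (elim disjE conjE exE) simp_all
qed

end

section \<open>Bott-Chern harmonic forms are the invariant forms of weight zero\<close>

lemma wirtinger_deriv_const: "wirtinger_deriv t (\<lambda>x. c) = (\<lambda>x. 0)"
  by (auto simp: wirtinger_deriv_def dir_deriv_const fun_eq_iff split: sum.splits)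

lemma sum_idx:
  fixes f :: "'m::finite set \<times> 'm set \<Rightarrow> complex"
  shows "(\<Sum>p\<le>CARD('m). \<Sum>q\<le>CARD('m). \<Sum>K\<in>idx p q. f K) = (\<Sum>K\<in>UNIV. f K)"
proof -
  have "(\<Sum>K\<in>UNIV. f K) = (\<Sum>pq\<in>{..CARD('m)} \<times> {..CARD('m)}. \<Sum>K\<in>{K \<in> UNIV. (card (fst K), card (snd K)) = pq}. f K)"
    by (rule sum.group[symmetric]) (auto intro: card_mono)
  also have "\<dots> = (\<Sum>pq\<in>{..CARD('m)} \<times> {..CARD('m)}. \<Sum>K\<in>idx (fst pq) (snd pq). f K)"
    by (intro sum.cong refl) (auto simp: idx_def)
  finally show ?thesis by (simp add: sum.cartesian_product case_prod_unfold)
qed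

context nakamura
begin

text \<open>The constant-coefficient forms that descend to the quotient; all types are mixed, as in
  \<open>bc_harmonic\<close>.\<close>

definition invform :: "'n option ext \<Rightarrow> bool" where
  "invform \<gamma> \<longleftrightarrow> (\<exists>A. (\<forall>K. cc K \<noteq> 0 \<longrightarrow> A K = 0) \<and> \<gamma> = (\<lambda>vs. \<Sum>K\<in>UNIV. A K * ee K vs))"

lemma invform_lin:
  assumes "invform \<alpha>" "invform \<beta>" shows "invform (\<lambda>vs. a * \<alpha> vs + b * \<beta> vs)"
proof -
  obtain A B where A: "\<forall>K. cc K \<noteq> 0 \<longrightarrow> A K = 0" "\<alpha> = (\<lambda>vs. \<Sum>K\<in>UNIV. A K * ee K vs)"
    and B: "\<forall>K. cc K \<noteq> 0 \<longrightarrow> B K = 0" "\<beta> = (\<lambda>vs. \<Sum>K\<in>UNIV. B K * ee K vs)"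
    using assms unfolding invform_def by blast
  show ?thesis unfolding invform_def
    by (rule exI[of _ "\<lambda>K. a * A K + b * B K"])
      (use A B in \<open>simp add: sum_distrib_left sum.distrib distrib_right mult.assoc\<close>)
qed

lemma invform_ee: "cc K = 0 \<Longrightarrow> invform (ee K)"
  unfolding invform_def
  by (rule exI[of _ "\<lambda>K'. if K' = K then 1 else 0"]) (auto simp: if_distrib[of "\<lambda>x. x * _"] cong: if_cong)

lemma invform_zero: "invform (\<lambda>vs. 0)"
  unfolding invform_def by (rule exI[of _ "\<lambda>K. 0"]) simp

lemma invform_sum:
  "(\<And>i. i \<in> A \<Longrightarrow> invform (\<alpha> i)) \<Longrightarrow> invform (\<lambda>vs. \<Sum>i\<in>A. c i * \<alpha> i vs)"
proof (induction A rule: infinite_finite_induct)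
  case (insert i A)
  have "invform (\<alpha> i)" "invform (\<lambda>vs. \<Sum>i\<in>A. c i * \<alpha> i vs)" using insert by auto
  from invform_lin[OF this, of "c i" 1] show ?case using insert by simp
qed (simp_all add: invform_zero)

lemma invform_wedge_ee:
  assumes "cc K = 0" "cc K' = 0" shows "invform (wedge (ee K) (ee K'))"
proof (cases "fst K \<inter> fst K' = {} \<and> snd K \<inter> snd K' = {}")
  case False
  hence "wedge (ee K) (ee K') = (\<lambda>vs. 0)" by (intro wedge_ee_not_disjoint) auto
  thus ?thesis by (simp add: invform_zero)
next
  case True
  let ?U = "(fst K \<union> fst K', snd K \<union> snd K')"
  have "cc ?U = cc K + cc K'" using True by (simp add: cc_def sum.union_disjoint)
  hence "cc ?U = 0" using assms by simp
  note i = invform_ee[OF this]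
  obtain s where "wedge (ee K) (ee K') = (\<lambda>vs. s * ee ?U vs)" using wedge_ee_disjoint True by blast
  thus ?thesis using invform_lin[OF i i, of s 0] by simp
qed

lemma invform_wedge:
  assumes "invform \<alpha>" "invform \<beta>" shows "invform (wedge \<alpha> \<beta>)"
proof -
  obtain A B where A: "\<forall>K. cc K \<noteq> 0 \<longrightarrow> A K = 0" "\<alpha> = (\<lambda>vs. \<Sum>K\<in>UNIV. A K * ee K vs)"
    and B: "\<forall>K. cc K \<noteq> 0 \<longrightarrow> B K = 0" "\<beta> = (\<lambda>vs. \<Sum>K\<in>UNIV. B K * ee K vs)"
    using assms unfolding invform_def by blast
  let ?Z = "{K. cc K = 0}"
  have rA: "\<alpha> = (\<lambda>vs. \<Sum>K\<in>?Z. A K * ee K vs)" and rB: "\<beta> = (\<lambda>vs. \<Sum>K\<in>?Z. B K * ee K vs)"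
    unfolding A(2) B(2) using A(1) B(1) by (intro ext sum.mono_neutral_right; force)+
  have "wedge \<alpha> \<beta> = (\<lambda>vs. \<Sum>K\<in>?Z. A K * (\<Sum>K'\<in>?Z. B K' * wedge (ee K) (ee K') vs))"
    unfolding rA rB by (simp add: fun_eq_iff wedge_sum_left wedge_sum_right)
  thus ?thesis by (simp only:) (intro invform_sum invform_wedge_ee; simp)
qed

lemma nmetric_star:
  assumes V: "V \<noteq> 0" "\<And>x. volume_form (hdiag (wt x)) = (\<lambda>vs. V * ee full vs)"
    and pq: "p \<le> CARD('n option)" "q \<le> CARD('n option)"
  shows "hodge_star (nmetric c y) p q (\<lambda>vs. \<Sum>K\<in>idx p q. f K * ee K vs) vs =
    (\<Sum>K\<in>idx p q. (2 ^ (p + q) * cpl_sign K * V) * (of_real (exp (2 * cc K * Re (y $ None))) * cnj (f K)) * ee (cpl K) vs)"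
  unfolding nmetric_def hodge_star_hdiag[OF wt_pos pq V(2,1)]
  by (intro sum.cong refl) (simp add: pnorm_wt)

lemma ex_volume:
  obtains V where "V \<noteq> 0" "\<And>x. volume_form (hdiag (wt x)) = (\<lambda>vs. V * ee full vs)"
proof -
  obtain C where C: "C \<noteq> 0" "\<And>w::'n option \<Rightarrow> real. volume_form (hdiag w) = (\<lambda>vs. C * of_real (\<Prod>k\<in>UNIV. w k) * ee full vs)"
    by (rule volume_form_full) (rule that)
  show ?thesis by (rule that[OF C(1)]) (simp add: C(2) prod_wt)
qed

text \<open>Every point of the cover lies in a chart image, so the chartwise equations hold on the
  whole cover and \<open>constant_coefficients\<close> becomes available.\<close>

lemma bc_harmonic_const:
  assumes \<alpha>: "\<alpha> \<in> bc_harmonic_pq atl nmetric p q"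
    and pq: "p \<le> CARD('n option)" "q \<le> CARD('n option)"
    and nonres: "\<And>I J. (\<exists>k::int. \<tau> * c_IJ lam I J = 2 * pi * of_int k) \<longleftrightarrow> c_IJ lam I J = 0"
  shows "\<exists>\<gamma>. invform \<gamma> \<and> (\<forall>c\<in>atl. \<forall>x\<in>chart_image c. \<alpha> c x = \<gamma>)"
proof -
  obtain V where V: "V \<noteq> 0" "\<And>x. volume_form (hdiag (wt x)) = (\<lambda>vs. V * ee full vs)" by (rule ex_volume) (rule that)
  have "\<alpha> \<in> pq_forms atl p q" using \<alpha> by (simp add: bc_harmonic_pq_def)
  from pq_forms_lift[OF this] obtain F where F: "\<And>K. K \<in> idx p q \<Longrightarrow> automorphic (cc K) (F K)"
    "\<And>c x. c \<in> atl \<Longrightarrow> x \<in> chart_image c \<Longrightarrow> \<alpha> c x = (\<lambda>vs. \<Sum>K\<in>idx p q. F K x * ee K vs)" by blast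
  have closed: "del (\<alpha> c) x vs = 0" "delbar (\<alpha> c) x vs = 0"
    "del (delbar (\<lambda>y. hodge_star (nmetric c y) p q (\<alpha> c y))) x vs = 0"
    if "c \<in> atl" "x \<in> chart_image c" for c x vs
    using \<alpha> that unfolding bc_harmonic_pq_def by blast+
  note sF = automorphicD(1)[OF F(1)]
  let ?Q = "\<lambda>K y. (2 ^ (p + q) * cpl_sign K * V) * (of_real (exp (2 * cc K * Re (y $ None))) * cnj (F K y))"
  interpret nakamura_bc_form M P lam \<tau> p q F V
  proof unfold_locales
    fix x vs
    obtain c where c: "c \<in> atl" "x \<in> chart_image c" using ex_chart by blast
    note o = open_chart_image[OF c(1)] c(2) finite_idx
    show "(\<Sum>k\<in>UNIV. \<Sum>K\<in>idx p q. wirtinger_deriv (Inl k) (F K) x * wedge (cov (Inl k)) (ee K) vs) = 0"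
      using closed(1)[OF c, of vs] by (subst (asm) del_expand(1)[OF o, where f = F and \<beta> = ee])
        (auto simp: F(2)[OF c(1)] intro: smooth_differentiable sF)
    show "(\<Sum>k\<in>UNIV. \<Sum>K\<in>idx p q. wirtinger_deriv (Inr k) (F K) x * wedge (cov (Inr k)) (ee K) vs) = 0"
      using closed(2)[OF c, of vs] by (subst (asm) del_expand(2)[OF o, where f = F and \<beta> = ee])
        (auto simp: F(2)[OF c(1)] intro: smooth_differentiable sF)
    have sQ: "smooth (?Q K)" if "K \<in> idx p q" for K
      by (intro smooth_simps(2-4) smooth_exp_Re sF that)
    show "(\<Sum>k\<in>UNIV. \<Sum>l\<in>UNIV. \<Sum>K\<in>idx p q. wirtinger_deriv (Inl k) (wirtinger_deriv (Inr l) (?Q K)) x *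
        wedge (cov (Inl k)) (wedge (cov (Inr l)) (ee (cpl K))) vs) = 0"
      using closed(3)[OF c, of vs]
      by (subst (asm) del_delbar_expand[OF o, where f = ?Q and \<beta> = "\<lambda>K. ee (cpl K)"])
        (use sQ in \<open>auto simp: F(2)[OF c(1)] nmetric_star[OF V pq]\<close>)
  qed (use pq F(1) V(1) nonres in auto)
  let ?A = "\<lambda>K. if K \<in> idx p q then F K 0 else 0"
  let ?\<gamma> = "\<lambda>vs. \<Sum>K\<in>UNIV. ?A K * ee K vs"
  have "invform ?\<gamma>" unfolding invform_def
    by (rule exI[of _ ?A]) (use constant_coefficients(2) in auto)
  moreover have "\<alpha> c x = ?\<gamma>" if "c \<in> atl" "x \<in> chart_image c" for c x
  proof
    fix vs
    have "?\<gamma> vs = (\<Sum>K\<in>idx p q. F K 0 * ee K vs)"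
      by (rule sum.mono_neutral_cong_right) auto
    also have "\<dots> = \<alpha> c x vs"
      unfolding F(2)[OF that] by (intro sum.cong refl arg_cong2[where f = "(*)"] constant_coefficients(1)[symmetric])
    finally show "\<alpha> c x vs = ?\<gamma> vs" by simp
  qed
  ultimately show ?thesis by blast
qed

text \<open>At weight 0 the exponential factor in the Hodge star is 1, so the starred form has
  constant coefficients too and all derivatives vanish.\<close>

lemma const_bc_harmonic:
  assumes a: "\<And>K. cc K \<noteq> 0 \<Longrightarrow> a K = 0" and pq: "p \<le> CARD('n option)" "q \<le> CARD('n option)"
  shows "(\<lambda>c x vs. \<Sum>K\<in>idx p q. a K * ee K vs) \<in> bc_harmonic_pq atl nmetric p q"
  unfolding bc_harmonic_pq_def
proof (intro CollectI conjI ballI allI)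
  obtain V where V: "V \<noteq> 0" "\<And>x. volume_form (hdiag (wt x)) = (\<lambda>vs. V * ee full vs)" by (rule ex_volume) (rule that)
  show "(\<lambda>c x vs. \<Sum>K\<in>idx p q. a K * ee K vs) \<in> pq_forms atl p q" by (rule pq_forms_const) (rule a)
  fix c x vs assume c: "c \<in> atl" "x \<in> chart_image c"
  note o = open_chart_image[OF c(1)] c(2) finite_idx
  show "del (\<lambda>x vs. \<Sum>K\<in>idx p q. a K * ee K vs) x vs = 0"
    by (subst del_expand(1)[OF o, where f = "\<lambda>K x. a K" and \<beta> = ee]) (auto simp: wirtinger_deriv_const)
  show "delbar (\<lambda>x vs. \<Sum>K\<in>idx p q. a K * ee K vs) x vs = 0"
    by (subst del_expand(2)[OF o, where f = "\<lambda>K x. a K" and \<beta> = ee]) (auto simp: wirtinger_deriv_const)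
  have "hodge_star (nmetric c y) p q (\<lambda>vs. \<Sum>K\<in>idx p q. a K * ee K vs) vs =
      (\<Sum>K\<in>idx p q. (2 ^ (p + q) * cpl_sign K * V * cnj (a K)) * ee (cpl K) vs)" for y vs
    unfolding nmetric_star[OF V pq]
  proof (intro sum.cong refl)
    fix K :: "'n option set \<times> 'n option set"
    show "2 ^ (p + q) * cpl_sign K * V * (of_real (exp (2 * cc K * Re (y $ None))) * cnj (a K)) * ee (cpl K) vs =
        2 ^ (p + q) * cpl_sign K * V * cnj (a K) * ee (cpl K) vs"
      using a[of K] by (cases "cc K = 0") simp_all
  qed
  thus "del (delbar (\<lambda>y. hodge_star (nmetric c y) p q (\<lambda>vs. \<Sum>K\<in>idx p q. a K * ee K vs))) x vs = 0"
    by (subst del_delbar_expand[OF o, where f = "\<lambda>K x. 2 ^ (p + q) * cpl_sign K * V * cnj (a K)" and \<beta> = "\<lambda>K. ee (cpl K)"])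
      (auto simp: wirtinger_deriv_const intro: smooth_simps(4))
qed

lemma bc_harmonic_invform:
  assumes \<alpha>: "\<alpha> \<in> bc_harmonic atl nmetric"
    and nonres: "\<And>I J. (\<exists>k::int. \<tau> * c_IJ lam I J = 2 * pi * of_int k) \<longleftrightarrow> c_IJ lam I J = 0"
  shows "\<exists>\<gamma>. invform \<gamma> \<and> (\<forall>c\<in>atl. \<forall>x\<in>chart_image c. \<alpha> c x = \<gamma>)"
proof -
  let ?m = "CARD('n option)"
  obtain a where a: "\<And>p q. p \<le> ?m \<Longrightarrow> q \<le> ?m \<Longrightarrow> a p q \<in> bc_harmonic_pq atl nmetric p q"
    "\<And>c x vs. c \<in> atl \<Longrightarrow> x \<in> chart_image c \<Longrightarrow> \<alpha> c x vs = (\<Sum>p\<le>?m. \<Sum>q\<le>?m. a p q c x vs)"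
    using \<alpha> unfolding bc_harmonic_def by blast
  have "\<forall>p q. \<exists>\<gamma>. p \<le> ?m \<and> q \<le> ?m \<longrightarrow> invform \<gamma> \<and> (\<forall>c\<in>atl. \<forall>x\<in>chart_image c. a p q c x = \<gamma>)"
    using bc_harmonic_const[OF a(1) _ _ nonres] by blast
  from this[unfolded choice_iff] obtain \<gamma> where "\<forall>p q. p \<le> ?m \<and> q \<le> ?m \<longrightarrow>
      invform (\<gamma> p q) \<and> (\<forall>c\<in>atl. \<forall>x\<in>chart_image c. a p q c x = \<gamma> p q)"
    by blast
  hence \<gamma>: "\<And>p q. p \<le> ?m \<Longrightarrow> q \<le> ?m \<Longrightarrow> invform (\<gamma> p q)"
    "\<And>p q c x. p \<le> ?m \<Longrightarrow> q \<le> ?m \<Longrightarrow> c \<in> atl \<Longrightarrow> x \<in> chart_image c \<Longrightarrow> a p q c x = \<gamma> p q"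
    by blast+
  \<comment> \<open>The factors 1 fit the shape of \<open>invform_sum\<close>.\<close>
  have "invform (\<lambda>vs. \<Sum>p\<le>?m. 1 * (\<Sum>q\<le>?m. 1 * \<gamma> p q vs))"
    by (intro invform_sum \<gamma>) auto
  moreover have "\<alpha> c x = (\<lambda>vs. \<Sum>p\<le>?m. 1 * (\<Sum>q\<le>?m. 1 * \<gamma> p q vs))" if "c \<in> atl" "x \<in> chart_image c" for c x
    using a(2)[OF that] \<gamma>(2)[OF _ _ that] by (simp add: fun_eq_iff)
  ultimately show ?thesis by blast
qed

text \<open>Regrouping the sum over all multi-indices by type supplies the components that
  \<open>bc_harmonic\<close> asks for.\<close>

lemma invform_bc_harmonic:
  assumes \<gamma>: "invform \<gamma>" "\<And>c x. c \<in> atl \<Longrightarrow> x \<in> chart_image c \<Longrightarrow> \<alpha> c x = \<gamma>"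
  shows "\<alpha> \<in> bc_harmonic atl nmetric"
proof -
  obtain A where A: "\<And>K. cc K \<noteq> 0 \<Longrightarrow> A K = 0" "\<gamma> = (\<lambda>vs. \<Sum>K\<in>UNIV. A K * ee K vs)"
    using \<gamma>(1) unfolding invform_def by blast
  have e: "\<gamma> vs = (\<Sum>p\<le>CARD('n option). \<Sum>q\<le>CARD('n option). \<Sum>K\<in>idx p q. A K * ee K vs)" for vs
    unfolding A(2) by (rule sum_idx[symmetric])
  have h: "(\<lambda>c x vs. \<Sum>K\<in>idx p q. A K * ee K vs) \<in> bc_harmonic_pq atl nmetric p q"
    if "p \<le> CARD('n option)" "q \<le> CARD('n option)" for p q
    using A(1) that by (rule const_bc_harmonic)
  show ?thesis unfolding bc_harmonic_def
    by (intro CollectI exI[of _ "\<lambda>p q c x vs. \<Sum>K\<in>idx p q. A K * ee K vs"] conjI allI ballI impI)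
      (erule (1) h, simp only: \<gamma>(2) e)
qed

theorem nmetric_BC_formal:
  assumes "\<And>I J. (\<exists>k::int. \<tau> * c_IJ lam I J = 2 * pi * of_int k) \<longleftrightarrow> c_IJ lam I J = 0"
  shows "geometrically_BC_formal atl nmetric"
  unfolding geometrically_BC_formal_def
proof (intro ballI)
  fix \<alpha> \<beta> assume \<alpha>: "\<alpha> \<in> bc_harmonic atl nmetric" and \<beta>: "\<beta> \<in> bc_harmonic atl nmetric"
  obtain \<gamma> where \<gamma>: "invform \<gamma>" "\<And>c x. c \<in> atl \<Longrightarrow> x \<in> chart_image c \<Longrightarrow> \<alpha> c x = \<gamma>"
    using bc_harmonic_invform[OF \<alpha> assms] by blast
  obtain \<delta> where \<delta>: "invform \<delta>" "\<And>c x. c \<in> atl \<Longrightarrow> x \<in> chart_image c \<Longrightarrow> \<beta> c x = \<delta>"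
    using bc_harmonic_invform[OF \<beta> assms] by blast
  show "(\<lambda>c x. wedge (\<alpha> c x) (\<beta> c x)) \<in> bc_harmonic atl nmetric"
    by (rule invform_bc_harmonic[OF invform_wedge[OF \<gamma>(1) \<delta>(1)]]) (simp add: \<gamma>(2) \<delta>(2))
qed

end

theorem theorem4p1:
  fixes M :: "int^('n::{finite,linorder})^('n::{finite,linorder})"
    and P :: "real^('n::{finite,linorder})^('n::{finite,linorder})"
    and lam :: "'n \<Rightarrow> real"
    and \<tau> :: real
  assumes "det M = 1"
    and "invertible P"
    and "P ** (\<chi> i j. real_of_int (M $ i $ j)) ** matrix_inv P =
           (\<chi> i j. if i = j then exp (lam i) else 0)"
    and "\<tau> \<noteq> 0"
    and "\<exists>i. lam i \<noteq> 0"
    and "\<And>I J. (\<exists>k::int. \<tau> * c_IJ lam I J = 2 * pi * of_int k) \<longleftrightarrow> c_IJ lam I J = 0"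
  shows "\<exists>h. hermitian_metric (nakamura_atlas lam P \<tau>) h \<and>
             geometrically_BC_formal (nakamura_atlas lam P \<tau>) h"
proof -
  interpret nakamura M P lam \<tau>
    by unfold_locales (rule assms(1), rule assms(2), rule assms(3), rule assms(4))
  show ?thesis using hermitian_metric_nmetric nmetric_BC_formal[OF assms(6)] by blast
qed

end
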